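(* Let $\mathcal K$ be a Fra\"{\i}ss\'{e} class of finite ordered binary relational structures with the Ramsey property and let $T$ be an $\mathbf{F_{\max}}$-tree. For every type $\tau$ of a finite induced substructure of $\mathbf{F_{\max}}$ and every Baire-measurable coloring $c:\binom{\mathbf{F(T)}}{\tau}\to2$, there is an $\mathbf{F_{\max}}$-subtree $S$ of $T$ such that $c$ is constant on $\binom{\mathbf{F(S)}}{\tau}$.
   Context: Setting: $L=\{<,R_0,\dots,R_{k-1}\}$ with binary $R_\ell$; $\mathcal K$ a Fra\"{\i}ss\'{e} class with the Ramsey property. $\mathrm{Flim}(\mathcal K)$ on $\omega$; $\mathrm{Flim}(\mathcal K)_n$ its restriction to $\{0,\dots,n\}$. Trees: $\omega^{<\omega}$ with initial segments; $|s|$; $\mathrm{succ}_T(t)$; $[T]$ infinite branches; $x\cap y$ longest common initial segment of distinct branches. $T_{\max}$: $\mathrm{succ}_{T_{\max}}(t)=\{t^\frown\langle0\rangle,\dots,t^\frown\langle|t|\rangle\}$. Fixed $\mathbf{F_t}\in\mathcal K$ on $\mathrm{succ}_{T_{\max}}(t)$ (lexicographic order) isomorphic to $\mathrm{Flim}(\mathcal K)_{|t|}$. $\mathbf{F_{\max}}$ on $[T_{\max}]$ ordered lexicographically, $(x,y)\in R_\ell$ for distinct $x,y$ iff $(x\upharpoonright(|x\cap y|+1),y\upharpoonright(|x\cap y|+1))\in R_\ell^{\mathbf{F_{x\cap y}}}$. For a subtree $T$: $\mathbf{F^T_t}$ the induced substructure of $\mathbf{F_t}$ on $\mathrm{succ}_T(t)$;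 $\mathbf{F(T)}$ the induced substructure of $\mathbf{F_{\max}}$ on $[T]$. $\mathbf{F_{\max}}$-tree: subtree $T\subseteq T_{\max}$ such that for all $\mathbf F\in\mathcal K$, $t\in T$ there is $s\supseteq t$ in $T$ with $\mathbf F$ embedding in $\mathbf{F^T_s}$; $\mathbf{F_{\max}}$-subtree of $T$: an $\mathbf{F_{\max}}$-tree contained in $T$. Types: strong isomorphism classes of finite induced substructures of $\mathbf{F_{\max}}$ (isomorphisms $\varphi$ with $|x_0\cap y_0|\le|x_1\cap y_1|\iff|\varphi(x_0)\cap\varphi(y_0)|\le|\varphi(x_1)\cap\varphi(y_1)|$). $\binom{\mathbf{F(T)}}{\tau}$: induced substructures of $\mathbf{F(T)}$ of type $\tau$. Topology: on $n$-element induced substructures of $\mathbf{F_{\max}}$, $\mathcal U$ is open iff every member has open neighborhoods $U_1,\dots,U_n$ (in $[T_{\max}]\subseteq\omega^\omega$) of its elements such that every $n$-element induced substructure with exactly one element in each $U_i$ is in $\mathcal U$; subsets get the subspace topology. A coloring is Baire-measurable if each color class has the property of Baire.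
   Formalization: Each relation R_ℓ is assumed irreflexive throughout K or reflexive throughout K (otherwise loops coding a unary predicate give a counterexample), and the neighborhoods U_1,…,U_n in the topology are taken pairwise disjoint (otherwise it is discrete for n ≥ 2). *)

theory Defs
  imports
    "HOL-Analysis.Analysis"
    "HOL-Library.Sublist"
    "HOL-Library.Fun_Lexorder"
begin

text \<open>
  Structures for the language with symbols \<open><, R\<^sub>0, \<dots>, R\<^sub>k\<^sub>-\<^sub>1\<close>.
  The values of the relations outside the universe, and of \<open>rel\<close> at indices \<open>\<ge> k\<close>, carry no
  information: no notion below depends on them. In particular the induced substructure on \<open>X\<close>
  just has a smaller universe.
\<close>

record 'a struct =
  universe :: "'a set"
  ordr :: "'a \<Rightarrow> 'a \<Rightarrow> bool"
  rel :: "nat \<Rightarrow> 'a \<Rightarrow> 'a \<Rightarrow> bool"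

definition induced :: "'a struct \<Rightarrow> 'a set \<Rightarrow> 'a struct" where
  "induced A X = A\<lparr>universe := X\<rparr>"

definition ordered :: "'a struct \<Rightarrow> bool" where
  "ordered A \<longleftrightarrow>
     irreflp_on (universe A) (ordr A) \<and>
     transp_on (universe A) (ordr A) \<and>
     totalp_on (universe A) (ordr A)"

definition embedding :: "nat \<Rightarrow> ('a \<Rightarrow> 'b) \<Rightarrow> 'a struct \<Rightarrow> 'b struct \<Rightarrow> bool" where
  "embedding k f A B \<longleftrightarrow>
     inj_on f (universe A) \<and> f ` universe A \<subseteq> universe B \<and>
     (\<forall>x\<in>universe A. \<forall>y\<in>universe A.
        (ordr A x y \<longleftrightarrow> ordr B (f x) (f y)) \<and>
        (\<forall>l<k. rel A l x y \<longleftrightarrow> rel B l (f x) (f y)))"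

definition embeds :: "nat \<Rightarrow> 'a struct \<Rightarrow> 'b struct \<Rightarrow> bool" where
  "embeds k A B \<longleftrightarrow> (\<exists>f. embedding k f A B)"

definition isomorphism :: "nat \<Rightarrow> ('a \<Rightarrow> 'b) \<Rightarrow> 'a struct \<Rightarrow> 'b struct \<Rightarrow> bool" where
  "isomorphism k f A B \<longleftrightarrow> embedding k f A B \<and> f ` universe A = universe B"

definition isomorphic :: "nat \<Rightarrow> 'a struct \<Rightarrow> 'b struct \<Rightarrow> bool" where
  "isomorphic k A B \<longleftrightarrow> (\<exists>f. isomorphism k f A B)"

text \<open>
  A class of finite structures is represented by its members with universe a set of natural
  numbers. The hereditary property includes closure under isomorphism. Countability up to
  isomorphism is automatic, since the language is finite. As usual, the class has members of
  arbitrarily large finite size, so that its limit is infinite and can live on \<open>\<omega>\<close>.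
\<close>

definition fraisse_class :: "nat \<Rightarrow> nat struct set \<Rightarrow> bool" where
  "fraisse_class k K \<longleftrightarrow>
     (\<forall>A\<in>K. finite (universe A) \<and> ordered A) \<and>
     (\<forall>n. \<exists>A\<in>K. n \<le> card (universe A)) \<and>
     (\<forall>B\<in>K. \<forall>A. embeds k A B \<longrightarrow> A \<in> K) \<and>
     (\<forall>A\<in>K. \<forall>B\<in>K. \<exists>C\<in>K. embeds k A C \<and> embeds k B C) \<and>
     (\<forall>A\<in>K. \<forall>B\<in>K. \<forall>C\<in>K. \<forall>f g. embedding k f A B \<and> embedding k g A C \<longrightarrow>
        (\<exists>D\<in>K. \<exists>f' g'. embedding k f' B D \<and> embedding k g' C D \<and>
           (\<forall>x\<in>universe A. f' (f x) = g' (g x))))"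

definition copies :: "nat \<Rightarrow> 'a struct \<Rightarrow> 'b struct \<Rightarrow> 'a set set" where
  "copies k C A = {X. X \<subseteq> universe C \<and> isomorphic k (induced C X) A}"

definition ramsey_property :: "nat \<Rightarrow> nat struct set \<Rightarrow> bool" where
  "ramsey_property k K \<longleftrightarrow>
     (\<forall>A\<in>K. \<forall>B\<in>K. \<forall>r::nat. \<exists>C\<in>K. \<forall>c \<in> copies k C A \<rightarrow> {..<r}.
        \<exists>Y\<in>copies k C B. c constant_on copies k (induced C Y) A)"

text \<open>
  The relations of the structures here are relations between \<^emph>\<open>distinct\<close> elements, and this is how
  they enter the structure on branches defined below. Accordingly the diagonal has to be void of
  information: each relation is irreflexive throughout the class, or reflexive throughout the
  class. (If loops could be used to code a nontrivial unary predicate, then which of the nodes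
  \<open>x \<restriction> (\<bar>x \<inter> y\<bar> + 1)\<close>, \<open>y \<restriction> (\<bar>x \<inter> y\<bar> + 1)\<close> carry a loop would be a continuous invariant of pairs of
  branches that is not determined by the type.)
\<close>

definition trivial_diagonal :: "nat \<Rightarrow> nat struct set \<Rightarrow> bool" where
  "trivial_diagonal k K \<longleftrightarrow>
     (\<forall>l<k. (\<forall>A\<in>K. \<forall>x\<in>universe A. \<not> rel A l x x) \<or> (\<forall>A\<in>K. \<forall>x\<in>universe A. rel A l x x))"

definition fraisse_limit :: "nat \<Rightarrow> nat struct set \<Rightarrow> nat struct \<Rightarrow> bool" where
  "fraisse_limit k K M \<longleftrightarrow>
     universe M = UNIV \<and>
     {A. finite (universe A) \<and> embeds k A M} = K \<and>
     (\<forall>X Y f. finite X \<and> X \<subseteq> universe M \<and> Y \<subseteq> universe M \<and>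
          isomorphism k f (induced M X) (induced M Y) \<longrightarrow>
        (\<exists>g. isomorphism k g M M \<and> (\<forall>x\<in>X. g x = f x)))"

definition is_tree :: "nat list set \<Rightarrow> bool" where
  "is_tree T \<longleftrightarrow> T \<noteq> {} \<and> (\<forall>t\<in>T. \<forall>s. prefix s t \<longrightarrow> s \<in> T)"

definition succs :: "nat list set \<Rightarrow> nat list \<Rightarrow> nat list set" where
  "succs T t = {s \<in> T. \<exists>i. s = t @ [i]}"

definition restr :: "(nat \<Rightarrow> nat) \<Rightarrow> nat \<Rightarrow> nat list" where
  "restr x n = map x [0..<n]"

definition branches :: "nat list set \<Rightarrow> (nat \<Rightarrow> nat) set" where
  "branches T = {x. \<forall>n. restr x n \<in> T}"

text \<open>The length of \<open>x \<inter> y\<close>; only meaningful for \<open>x \<noteq> y\<close>.\<close>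

definition meet_length :: "(nat \<Rightarrow> nat) \<Rightarrow> (nat \<Rightarrow> nat) \<Rightarrow> nat" where
  "meet_length x y = (LEAST n. x n \<noteq> y n)"

definition meet :: "(nat \<Rightarrow> nat) \<Rightarrow> (nat \<Rightarrow> nat) \<Rightarrow> nat list" where
  "meet x y = restr x (meet_length x y)"

inductive_set T_max :: "nat list set" where
  T_max_Nil: "[] \<in> T_max"
| T_max_snoc: "t \<in> T_max \<Longrightarrow> i \<le> length t \<Longrightarrow> t @ [i] \<in> T_max"

text \<open>
  \<open>F\<close> is the assignment of the structures \<open>F\<^sub>t\<close> to the nodes \<open>t\<close>, given the Fraisse limit \<open>M\<close> on \<open>\<omega>\<close>.
  That \<open>F\<^sub>t\<close> is in the class follows from its being isomorphic to a finite substructure of \<open>M\<close>.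
\<close>

definition node_structures :: "nat \<Rightarrow> nat struct \<Rightarrow> (nat list \<Rightarrow> nat list struct) \<Rightarrow> bool" where
  "node_structures k M F \<longleftrightarrow>
     (\<forall>t\<in>T_max.
        universe (F t) = succs T_max t \<and>
        (\<forall>s\<in>succs T_max t. \<forall>s'\<in>succs T_max t. ordr (F t) s s' \<longleftrightarrow> (s, s') \<in> lexord less_than) \<and>
        isomorphic k (F t) (induced M {0..length t}))"

definition F_max :: "(nat list \<Rightarrow> nat list struct) \<Rightarrow> (nat \<Rightarrow> nat) struct" where
  "F_max F =
     \<lparr>universe = branches T_max,
      ordr = less_fun,
      rel = (\<lambda>l x y. x \<noteq> y \<and>
        rel (F (meet x y)) l (restr x (meet_length x y + 1)) (restr y (meet_length x y + 1)))\<rparr>"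

definition F_of :: "(nat list \<Rightarrow> nat list struct) \<Rightarrow> nat list set \<Rightarrow> (nat \<Rightarrow> nat) struct" where
  "F_of F T = induced (F_max F) (branches T)"

definition F_max_tree ::
    "nat \<Rightarrow> nat struct set \<Rightarrow> (nat list \<Rightarrow> nat list struct) \<Rightarrow> nat list set \<Rightarrow> bool" where
  "F_max_tree k K F T \<longleftrightarrow>
     is_tree T \<and> T \<subseteq> T_max \<and>
     (\<forall>A\<in>K. \<forall>t\<in>T. \<exists>s\<in>T. prefix t s \<and> embeds k A (induced (F s) (succs T s)))"

text \<open>Induced substructures of \<open>F_max\<close> are identified with their universes.\<close>

definition strong_isomorphism ::
    "nat \<Rightarrow> (nat list \<Rightarrow> nat list struct) \<Rightarrow> ((nat \<Rightarrow> nat) \<Rightarrow> (nat \<Rightarrow> nat)) \<Rightarrow>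
     (nat \<Rightarrow> nat) set \<Rightarrow> (nat \<Rightarrow> nat) set \<Rightarrow> bool" where
  "strong_isomorphism k F \<phi> A B \<longleftrightarrow>
     isomorphism k \<phi> (induced (F_max F) A) (induced (F_max F) B) \<and>
     (\<forall>x0\<in>A. \<forall>y0\<in>A. \<forall>x1\<in>A. \<forall>y1\<in>A. x0 \<noteq> y0 \<and> x1 \<noteq> y1 \<longrightarrow>
        (meet_length x0 y0 \<le> meet_length x1 y1 \<longleftrightarrow>
         meet_length (\<phi> x0) (\<phi> y0) \<le> meet_length (\<phi> x1) (\<phi> y1)))"

definition type_of ::
    "nat \<Rightarrow> (nat list \<Rightarrow> nat list struct) \<Rightarrow> (nat \<Rightarrow> nat) set \<Rightarrow> (nat \<Rightarrow> nat) set set" where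
  "type_of k F A = {B. B \<subseteq> universe (F_max F) \<and> (\<exists>\<phi>. strong_isomorphism k F \<phi> A B)}"

definition substructures_of_type ::
    "(nat list \<Rightarrow> nat list struct) \<Rightarrow> nat list set \<Rightarrow> (nat \<Rightarrow> nat) set set \<Rightarrow> (nat \<Rightarrow> nat) set set" where
  "substructures_of_type F T \<tau> = {B. B \<subseteq> universe (F_of F T) \<and> B \<in> \<tau>}"

text \<open>The neighbourhoods \<open>U\<^sub>a\<close>, indexed by the elements \<open>a\<close> of \<open>A\<close>, are taken to be pairwise disjoint;
  otherwise, choosing all of them equal to the whole space would make every set open for
  \<open>n \<ge> 2\<close>.\<close>

definition n_subsets_open :: "nat \<Rightarrow> (nat \<Rightarrow> nat) set set \<Rightarrow> bool" where
  "n_subsets_open n \<U> \<longleftrightarrow>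
     \<U> \<subseteq> {A. A \<subseteq> branches T_max \<and> finite A \<and> card A = n} \<and>
     (\<forall>A\<in>\<U>. \<exists>U.
        (\<forall>a\<in>A. openin (top_of_set (branches T_max)) (U a) \<and> a \<in> U a) \<and>
        disjoint_family_on U A \<and>
        (\<forall>B. B \<subseteq> branches T_max \<and> finite B \<and> card B = n \<and> (\<forall>a\<in>A. \<exists>!b. b \<in> B \<and> b \<in> U a) \<longrightarrow> B \<in> \<U>))"

definition n_subsets_topology :: "nat \<Rightarrow> (nat \<Rightarrow> nat) set topology" where
  "n_subsets_topology n = topology (n_subsets_open n)"

lemma n_subsets_open_Int:
  assumes "n_subsets_open n \<U>" "n_subsets_open n \<V>"
  shows "n_subsets_open n (\<U> \<inter> \<V>)"
  unfolding n_subsets_open_def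
proof (intro conjI ballI)
  show "\<U> \<inter> \<V> \<subseteq> {A. A \<subseteq> branches T_max \<and> finite A \<and> card A = n}"
    using assms(1) unfolding n_subsets_open_def by blast
next
  fix A assume A: "A \<in> \<U> \<inter> \<V>"
  have fA: "finite A" "card A = n"
    using A assms(1) unfolding n_subsets_open_def by blast+
  obtain U where U: "\<forall>a\<in>A. openin (top_of_set (branches T_max)) (U a) \<and> a \<in> U a"
      "disjoint_family_on U A"
      "\<forall>B. B \<subseteq> branches T_max \<and> finite B \<and> card B = n \<and> (\<forall>a\<in>A. \<exists>!b. b \<in> B \<and> b \<in> U a) \<longrightarrow> B \<in> \<U>"
    using assms(1) A unfolding n_subsets_open_def by blast
  obtain V where V: "\<forall>a\<in>A. openin (top_of_set (branches T_max)) (V a) \<and> a \<in> V a"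
      "disjoint_family_on V A"
      "\<forall>B. B \<subseteq> branches T_max \<and> finite B \<and> card B = n \<and> (\<forall>a\<in>A. \<exists>!b. b \<in> B \<and> b \<in> V a) \<longrightarrow> B \<in> \<V>"
    using assms(2) A unfolding n_subsets_open_def by blast
  define W where "W a = U a \<inter> V a" for a
  have "B \<in> \<U> \<inter> \<V>"
    if B: "B \<subseteq> branches T_max" "finite B" "card B = n" "\<forall>a\<in>A. \<exists>!b. b \<in> B \<and> b \<in> W a" for B
  proof -
    obtain g where g: "\<And>a. a \<in> A \<Longrightarrow> g a \<in> B \<and> g a \<in> W a"
      using B(4) by metis
    have inj: "inj_on g A"
    proof (rule inj_onI)
      fix a a' assume "a \<in> A" "a' \<in> A" "g a = g a'"
      then show "a = a'"
        using g[of a] g[of a'] U(2) unfolding W_def disjoint_family_on_def by (metis IntD1 disjoint_iff)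
    qed
    have gA: "g ` A = B"
      using inj g fA B by (intro card_subset_eq) (auto simp: card_image)
    have *: "\<forall>a\<in>A. \<exists>!b. b \<in> B \<and> b \<in> Z a"
      if Z: "disjoint_family_on Z A" "\<And>a. W a \<subseteq> Z a" for Z
    proof (intro ballI ex1I conjI)
      fix a assume a: "a \<in> A"
      show "g a \<in> B" "g a \<in> Z a" using g[OF a] Z(2) by blast+
      fix b assume b: "b \<in> B \<and> b \<in> Z a"
      then obtain a' where a': "a' \<in> A" "b = g a'" using gA by blast
      then have "b \<in> Z a'" using g Z(2) by blast
      then have "a' = a" using Z(1) a a'(1) b unfolding disjoint_family_on_def by blast
      then show "b = g a" using a' by simp
    qed
    have "\<forall>a\<in>A. \<exists>!b. b \<in> B \<and> b \<in> U a" by (rule *[OF U(2)]) (simp add: W_def)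
    moreover have "\<forall>a\<in>A. \<exists>!b. b \<in> B \<and> b \<in> V a" by (rule *[OF V(2)]) (simp add: W_def)
    ultimately show ?thesis using U(3) V(3) B(1-3) by simp
  qed
  moreover have "\<forall>a\<in>A. openin (top_of_set (branches T_max)) (W a) \<and> a \<in> W a"
    using U(1) V(1) unfolding W_def by blast
  moreover have "disjoint_family_on W A"
    using U(2) unfolding W_def disjoint_family_on_def by blast
  ultimately show "\<exists>U.
        (\<forall>a\<in>A. openin (top_of_set (branches T_max)) (U a) \<and> a \<in> U a) \<and>
        disjoint_family_on U A \<and>
        (\<forall>B. B \<subseteq> branches T_max \<and> finite B \<and> card B = n \<and> (\<forall>a\<in>A. \<exists>!b. b \<in> B \<and> b \<in> U a)
           \<longrightarrow> B \<in> \<U> \<inter> \<V>)"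
    by (intro exI[of _ W]) blast
qed

lemma istopology_n_subsets_open: "istopology (n_subsets_open n)"
  unfolding istopology_def
proof (intro conjI allI impI)
  fix \<S> \<T> assume "n_subsets_open n \<S>" "n_subsets_open n \<T>"
  then show "n_subsets_open n (\<S> \<inter> \<T>)" by (rule n_subsets_open_Int)
next
  fix \<K> assume *: "\<forall>\<U>\<in>\<K>. n_subsets_open n \<U>"
  show "n_subsets_open n (\<Union>\<K>)"
    unfolding n_subsets_open_def
  proof (intro conjI ballI)
    have "\<U> \<subseteq> {A. A \<subseteq> branches T_max \<and> finite A \<and> card A = n}" if "\<U> \<in> \<K>" for \<U>
      using *[rule_format, OF that] unfolding n_subsets_open_def by (rule conjunct1)
    then show "\<Union>\<K> \<subseteq> {A. A \<subseteq> branches T_max \<and> finite A \<and> card A = n}"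
      by (rule Union_least)
  next
    fix A assume "A \<in> \<Union>\<K>"
    then obtain \<U> where \<U>: "\<U> \<in> \<K>" "A \<in> \<U>" by blast
    have "n_subsets_open n \<U>" using * \<U>(1) by (rule bspec)
    then obtain U where U: "\<forall>a\<in>A. openin (top_of_set (branches T_max)) (U a) \<and> a \<in> U a"
      "disjoint_family_on U A"
      "\<forall>B. B \<subseteq> branches T_max \<and> finite B \<and> card B = n \<and> (\<forall>a\<in>A. \<exists>!b. b \<in> B \<and> b \<in> U a) \<longrightarrow> B \<in> \<U>"
      using \<U>(2) unfolding n_subsets_open_def by blast
    show "\<exists>U.
        (\<forall>a\<in>A. openin (top_of_set (branches T_max)) (U a) \<and> a \<in> U a) \<and>
        disjoint_family_on U A \<and>
        (\<forall>B. B \<subseteq> branches T_max \<and> finite B \<and> card B = n \<and> (\<forall>a\<in>A. \<exists>!b. b \<in> B \<and> b \<in> U a)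
           \<longrightarrow> B \<in> \<Union>\<K>)"
      using U \<U>(1) by (intro exI[of _ U]) blast
  qed
qed

lemma openin_n_subsets_topology: "openin (n_subsets_topology n) = n_subsets_open n"
  unfolding n_subsets_topology_def by (rule topology_inverse'[OF istopology_n_subsets_open])

lemma topspace_n_subsets_topology:
  "topspace (n_subsets_topology n) = {A. A \<subseteq> branches T_max \<and> finite A \<and> card A = n}"
proof -
  let ?X = "{A. A \<subseteq> branches T_max \<and> finite A \<and> card A = n}"
  have "n_subsets_open n ?X"
    unfolding n_subsets_open_def
  proof (intro conjI ballI subset_refl)
    fix A assume A: "A \<in> ?X"
    define d :: "(nat \<Rightarrow> nat) \<Rightarrow> (nat \<Rightarrow> nat) \<Rightarrow> nat" where "d x y = (SOME m. x m \<noteq> y m)" for x y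
    have d: "x (d x y) \<noteq> y (d x y)" if "x \<noteq> y" for x y
    proof -
      from that have "\<exists>m. x m \<noteq> y m" by (simp add: fun_eq_iff)
      then show ?thesis unfolding d_def by (rule someI_ex)
    qed
    define D where "D = (\<lambda>(x, y). d x y) ` (A \<times> A)"
    define U where "U a = {x \<in> branches T_max. \<forall>m\<in>D. x m = a m}" for a
    have "finite D" using A unfolding D_def by auto
    have "open {x :: nat \<Rightarrow> nat. x m = a m}" for m and a :: "nat \<Rightarrow> nat"
    proof -
      have "open ((\<lambda>x :: nat \<Rightarrow> nat. x m) -` {a m})"
        by (rule open_vimage[OF open_discrete continuous_on_product_coordinates])
      then show ?thesis by (simp add: vimage_def)
    qed
    then have "open (\<Inter>m\<in>D. {x :: nat \<Rightarrow> nat. x m = a m})" for a :: "nat \<Rightarrow> nat"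
      using \<open>finite D\<close> by (intro open_INT) auto
    moreover have "U a = branches T_max \<inter> (\<Inter>m\<in>D. {x. x m = a m})" for a
      unfolding U_def by auto
    ultimately have "openin (top_of_set (branches T_max)) (U a)" for a
      by (simp add: openin_open_Int)
    moreover have "a \<in> U a" if "a \<in> A" for a
    proof -
      have "a \<in> branches T_max" using A that by blast
      then show ?thesis unfolding U_def by simp
    qed
    moreover have "disjoint_family_on U A"
      unfolding disjoint_family_on_def
    proof (intro ballI impI)
      fix x y assume xy: "x \<in> A" "y \<in> A" "x \<noteq> y"
      then have "d x y \<in> D" unfolding D_def by force
      then have "z (d x y) = x (d x y) \<and> z (d x y) = y (d x y)" if "z \<in> U x \<inter> U y" for z
        using that unfolding U_def by blast
      then show "U x \<inter> U y = {}"
        using d[OF xy(3)] by (metis all_not_in_conv)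
    qed
    ultimately show "\<exists>U.
        (\<forall>a\<in>A. openin (top_of_set (branches T_max)) (U a) \<and> a \<in> U a) \<and>
        disjoint_family_on U A \<and>
        (\<forall>B. B \<subseteq> branches T_max \<and> finite B \<and> card B = n \<and> (\<forall>a\<in>A. \<exists>!b. b \<in> B \<and> b \<in> U a) \<longrightarrow> B \<in> ?X)"
      by (intro exI[of _ U]) blast
  qed
  then have "openin (n_subsets_topology n) ?X"
    by (simp add: openin_n_subsets_topology)
  then have "?X \<subseteq> topspace (n_subsets_topology n)"
    by (rule openin_subset)
  moreover have "topspace (n_subsets_topology n) \<subseteq> ?X"
    using openin_topspace[of "n_subsets_topology n"]
    unfolding openin_n_subsets_topology n_subsets_open_def by (rule conjunct1)
  ultimately show ?thesis by (rule subset_antisym[rotated])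
qed

definition nowhere_dense_in :: "'a topology \<Rightarrow> 'a set \<Rightarrow> bool" where
  "nowhere_dense_in X A \<longleftrightarrow> A \<subseteq> topspace X \<and> X interior_of (X closure_of A) = {}"

definition meager_in :: "'a topology \<Rightarrow> 'a set \<Rightarrow> bool" where
  "meager_in X A \<longleftrightarrow> (\<exists>\<N>. countable \<N> \<and> (\<forall>N\<in>\<N>. nowhere_dense_in X N) \<and> A = \<Union>\<N>)"

definition baire_property_in :: "'a topology \<Rightarrow> 'a set \<Rightarrow> bool" where
  "baire_property_in X A \<longleftrightarrow>
     A \<subseteq> topspace X \<and> (\<exists>U. openin X U \<and> meager_in X ((A - U) \<union> (U - A)))"

definition baire_measurable_coloring :: "'a topology \<Rightarrow> ('a \<Rightarrow> bool) \<Rightarrow> bool" where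
  "baire_measurable_coloring X c \<longleftrightarrow> (\<forall>i. baire_property_in X {x \<in> topspace X. c x = i})"

end

theory Submission
  imports Defs "HOL-Library.Ramsey"
begin

text \<open>
  Shrinking \<open>T\<close> level by level, one finds a copy of the tree \<open>T_max\<close> of words in which the letter
  \<open>a\<close> is the element \<open>a\<close> of the Fraisse limit, such that the colour of a set of branches that avoids
  countably many nowhere dense sets is decided by the words through which its members pass at any
  level that separates them. This leaves a colouring of finite tuples of words.

  It is made constant by ultrafilters. By the Hales-Jewett and Ramsey theorems there is an idempotent
  ultrafilter on variable words, whose letters are functions giving one letter to each member of a
  tuple, that is invariant under substituting for the variable and under order preserving changes of
  the coordinates. By the Ramsey property there is an ultrafilter on maps \<open>\<eta>\<close> that is concentrated on
  embeddings of the initial segments of the limit into the limit and does not distinguish isomorphic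
  sets of letters. A set of branches arises from the root by a sequence of splittings, its shape,
  which is determined by its type as soon as no two different nodes of the same level both split.
  Each tuple that has gone through an initial segment of a shape has an expected colour with respect
  to the ultrafilters. Idempotence allows one to keep all these colours equal to a single one while
  the nodes are extended and split one after the other, and a set is coloured when its shape is
  completed.
\<close>

section \<open>Ultrafilters\<close>

text \<open>The obstacle is that splitting one node lengthens all the others: an incomplete tuple
  must keep its expected colour although its words receive the letters of a variable word chosen for
  a different node. Two invariances remove it. By substitution, a filled variable word is
  distributed like a generic word without variables, whatever letter is put in; by idempotence, one
  more generic extension does not change an expected colour. For a tuple that is not split, the
  splitting of another node is therefore mere waiting. Invariance under changes of coordinates lets
  one ultrafilter serve all tuples at once: a tuple picked from many nodes behaves like the first
  few coordinates. For this the letters have to be functions on all of \<open>nat\<close>, and the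
  infinite alphabet is reached from finite combinatorics by compactness. The Ramsey property of the
  class is needed only for the letters at a splitting, where all isomorphic choices must give the
  same colour. A complete tuple needs no further care: any separating level decides its colour, so
  the first one may be used.\<close>

text \<open>Ultrafilters are maps from predicates to truth values. In this form they are points of a
  compact product space, and products and images are compositions.\<close>

definition ultra :: "(('s \<Rightarrow> bool) \<Rightarrow> bool) \<Rightarrow> bool" where
  "ultra V \<longleftrightarrow> V (\<lambda>_. True) \<and> (\<forall>P Q. V (\<lambda>x. P x \<and> Q x) \<longleftrightarrow> V P \<and> V Q) \<and>
     (\<forall>P. V (\<lambda>x. \<not> P x) \<longleftrightarrow> \<not> V P)"

lemma ultra_True: "ultra V \<Longrightarrow> V (\<lambda>_. True)"
  and ultra_conj: "ultra V \<Longrightarrow> V (\<lambda>x. P x \<and> Q x) \<longleftrightarrow> V P \<and> V Q"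
  and ultra_not: "ultra V \<Longrightarrow> V (\<lambda>x. \<not> P x) \<longleftrightarrow> \<not> V P"
  unfolding ultra_def by blast+

lemma ultra_False: "ultra V \<Longrightarrow> \<not> V (\<lambda>_. False)"
  using ultra_not[of V "\<lambda>_. True"] ultra_True by simp

lemma ultra_mono:
  assumes "ultra V" "V P" "\<And>x. P x \<Longrightarrow> Q x"
  shows "V Q"
proof -
  have "(\<lambda>x. P x \<and> Q x) = P" using assms(3) by auto
  then show ?thesis using ultra_conj[OF assms(1), of P Q] assms(2) by simp
qed

lemma ultra_eq_const: "ultra V \<Longrightarrow> V (\<lambda>x. P x = b) \<longleftrightarrow> V P = b"
  by (cases b) (simp_all add: ultra_not)

lemma ultra_ball:
  assumes "ultra V" "finite I"
  shows "V (\<lambda>x. \<forall>i\<in>I. P i x) \<longleftrightarrow> (\<forall>i\<in>I. V (P i))"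
  using assms(2) by induction (simp_all add: ultra_True ultra_conj[OF assms(1)] assms(1))

lemma ultra_ex:
  assumes "ultra V" "V P"
  obtains x where "P x"
proof -
  have "P \<noteq> (\<lambda>_. False)" using assms ultra_False by metis
  then show ?thesis using that by (auto simp: fun_eq_iff)
qed

lemma ultra_principal: "ultra (\<lambda>P. P x)"
  by (simp add: ultra_def)

lemma ultra_map: "ultra V \<Longrightarrow> ultra (\<lambda>P. V (\<lambda>x. P (f x)))"
  by (simp add: ultra_def)

lemma ultra_color:
  assumes "ultra V" "finite C" "V (\<lambda>x. f x \<in> C)"
  obtains c where "c \<in> C" "V (\<lambda>x. f x = c)"
proof (rule ccontr)
  assume "\<not> thesis"
  then have "\<forall>c\<in>C. V (\<lambda>x. f x \<noteq> c)"
    using that by (auto simp: ultra_not[OF assms(1)])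
  then have "V (\<lambda>x. \<forall>c\<in>C. f x \<noteq> c)" by (simp add: ultra_ball[OF assms(1,2)])
  with assms(3) have "V (\<lambda>x. f x \<in> C \<and> (\<forall>c\<in>C. f x \<noteq> c))"
    by (simp add: ultra_conj[OF assms(1)])
  moreover have "(\<lambda>x. f x \<in> C \<and> (\<forall>c\<in>C. f x \<noteq> c)) = (\<lambda>_. False)" by auto
  ultimately show False using ultra_False[OF assms(1)] by simp
qed

section \<open>Compactness of the space of ultrafilters\<close>

lemma open_eval: "open {V :: 'b \<Rightarrow> bool. V P}"
proof -
  have "open ((\<lambda>V :: 'b \<Rightarrow> bool. V P) -` {True})"
    by (rule open_vimage[OF open_discrete continuous_on_product_coordinates])
  then show ?thesis by (simp add: vimage_def)
qed

lemma closed_eval: "closed {V :: 'b \<Rightarrow> bool. V P}"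
proof -
  have "open ((\<lambda>V :: 'b \<Rightarrow> bool. V P) -` {False})"
    by (rule open_vimage[OF open_discrete continuous_on_product_coordinates])
  moreover have "(\<lambda>V :: 'b \<Rightarrow> bool. V P) -` {False} = - {V. V P}" by auto
  ultimately show ?thesis by (simp add: closed_def)
qed

lemma closed_eval_eq: "closed {V :: 'b \<Rightarrow> bool. V P = V Q}"
  by (intro closed_Collect_eq continuous_on_product_coordinates)

lemma closed_ultra: "closed {V. ultra V}"
proof -
  have 1: "closed {V :: ('s \<Rightarrow> bool) \<Rightarrow> bool. V (\<lambda>x. P x \<and> Q x) \<longleftrightarrow> V P \<and> V Q}" for P Q
    unfolding iff_conv_conj_imp
    by (intro closed_Collect_conj closed_Collect_imp open_Collect_conj open_eval closed_eval)
  have 2: "closed {V :: ('s \<Rightarrow> bool) \<Rightarrow> bool. V (\<lambda>x. \<not> P x) \<longleftrightarrow> \<not> V P}" for P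
    unfolding iff_conv_conj_imp
    by (intro closed_Collect_conj closed_Collect_imp open_Collect_neg closed_Collect_neg
        open_eval closed_eval)
  show ?thesis
    unfolding ultra_def
    by (intro closed_Collect_conj closed_Collect_all closed_eval 1 2)
qed

lemma compact_UNIV_bool_fun: "compact (UNIV :: ('b \<Rightarrow> bool) set)"
proof -
  have "compact_space (euclidean :: bool topology)"
    by (simp add: compact_space_def finite_imp_compact)
  then have "compact_space (product_topology (\<lambda>_ :: 'b. euclidean :: bool topology) UNIV)"
    by (simp add: compact_space_product_topology)
  then show ?thesis
    by (simp add: euclidean_product_topology compact_space_def)
qed

text \<open>Each equation compares two coordinates and is a closed condition. All properties wanted
  of ultrafilters later are written as such equations; that \<open>V P\<close> holds is the equation
  of \<open>P\<close> with \<open>\<lambda>_. True\<close>.\<close>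

lemma compact_ultra_eqs: "compact {V. ultra V \<and> (\<forall>(P, Q)\<in>E. V P = V Q)}"
proof -
  have "closed ({V. ultra V} \<inter> (\<Inter>(P, Q)\<in>E. {V. V P = V Q}))"
    by (intro closed_Int closed_ultra closed_INT) (auto intro: closed_eval_eq)
  moreover have "{V. ultra V} \<inter> (\<Inter>(P, Q)\<in>E. {V. V P = V Q}) =
      {V. ultra V \<and> (\<forall>(P, Q)\<in>E. V P = V Q)}" by auto
  ultimately show ?thesis using compact_UNIV_bool_fun compact_Int_closed by fastforce
qed

lemma ultra_compactness:
  assumes "\<And>E0. finite E0 \<Longrightarrow> E0 \<subseteq> E \<Longrightarrow> \<exists>V. ultra V \<and> (\<forall>(P, Q)\<in>E0. V P = V Q)"
  shows "\<exists>V. ultra V \<and> (\<forall>(P, Q)\<in>E. V P = V Q)"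
proof -
  \<comment> \<open>With no equations the compact set consists of all ultrafilters; the members of
    \<open>E\<close> enter as closed sets with the finite intersection property.\<close>
  have "{V. ultra V \<and> (\<forall>(P, Q)\<in>{}. V P = V Q)} \<inter> (\<Inter>e\<in>E. {V. V (fst e) \<longleftrightarrow> V (snd e)}) \<noteq> {}"
  proof (rule compact_imp_fip_image[OF compact_ultra_eqs])
    fix e assume "e \<in> E"
    show "closed {V. V (fst e) \<longleftrightarrow> V (snd e)}" by (rule closed_eval_eq)
  next
    fix E0 assume E0: "finite E0" "E0 \<subseteq> E"
    from assms[OF this] obtain V where "ultra V" "\<forall>(P, Q)\<in>E0. V P = V Q" by blast
    then have "V \<in> {V. ultra V \<and> (\<forall>(P, Q)\<in>{}. V P = V Q)} \<inter> (\<Inter>e\<in>E0. {V. V (fst e) \<longleftrightarrow> V (snd e)})"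
      by auto
    then show "{V. ultra V \<and> (\<forall>(P, Q)\<in>{}. V P = V Q)} \<inter> (\<Inter>e\<in>E0. {V. V (fst e) \<longleftrightarrow> V (snd e)}) \<noteq> {}"
      by blast
  qed
  then show ?thesis by fastforce
qed

text \<open>A point satisfying finitely many equations is a principal ultrafilter satisfying them.
  In this way finite combinatorial theorems turn into ultrafilters.\<close>

lemma ultra_compactness_points:
  assumes "\<And>E0. finite E0 \<Longrightarrow> E0 \<subseteq> E \<Longrightarrow> \<exists>x. \<forall>e\<in>E0. fst e x = snd e x"
  shows "\<exists>V. ultra V \<and> (\<forall>(P, Q)\<in>E. V P = V Q)"
proof (rule ultra_compactness)
  fix E0 assume "finite E0" "E0 \<subseteq> E"
  then obtain x where "\<forall>e\<in>E0. fst e x = snd e x" using assms by blast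
  then show "\<exists>V. ultra V \<and> (\<forall>(P, Q)\<in>E0. V P = V Q)"
    by (intro exI[of _ "\<lambda>P. P x"] conjI ultra_principal) (simp add: case_prod_beta)
qed

text \<open>Zorn's lemma gives a minimal compact subsemigroup \<open>X\<close>. For \<open>v\<close>
  in it, minimality yields \<open>X v = X\<close>, so some \<open>u0\<close> fixes \<open>v\<close>
  from the left. The elements that fix \<open>v\<close> form a compact subsemigroup again, hence all
  of \<open>X\<close>, and \<open>v\<close> fixes itself. Continuity is used for multiplication by a
  fixed element on the right.\<close>

theorem Ellis_idempotent:
  fixes m :: "'a :: topological_space \<Rightarrow> 'a \<Rightarrow> 'a"
  assumes H: "Hausdorff_space (euclidean :: 'a topology)"
    and C: "compact C" "C \<noteq> {}"
    and cl: "\<And>u v. u \<in> C \<Longrightarrow> v \<in> C \<Longrightarrow> m u v \<in> C"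
    and assoc: "\<And>u v w. u \<in> C \<Longrightarrow> v \<in> C \<Longrightarrow> w \<in> C \<Longrightarrow> m (m u v) w = m u (m v w)"
    and cont: "\<And>v. v \<in> C \<Longrightarrow> continuous_on C (\<lambda>u. m u v)"
  obtains v where "v \<in> C" "m v v = v"
proof -
  have closedI: "closed X" if "compact X" for X :: "'a set"
    using compactin_imp_closedin[OF H] that by simp
  define \<A> where "\<A> = {X. X \<subseteq> C \<and> X \<noteq> {} \<and> compact X \<and> (\<forall>u\<in>X. \<forall>v\<in>X. m u v \<in> X)}"
  have "\<exists>X\<in>\<A>. \<forall>Y\<in>\<A>. Y \<subseteq> X \<longrightarrow> Y = X"
  proof (rule predicate_Zorn)
    show "partial_order_on \<A> (relation_of (\<lambda>X Y. Y \<subseteq> X) \<A>)"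
      by (rule partial_order_on_relation_ofI) auto
  next
    fix \<C> assume "\<C> \<in> Chains (relation_of (\<lambda>X Y. Y \<subseteq> X) \<A>)"
    then have ch: "\<And>X Y. X \<in> \<C> \<Longrightarrow> Y \<in> \<C> \<Longrightarrow> X \<in> \<A> \<and> Y \<in> \<A> \<and> (X \<subseteq> Y \<or> Y \<subseteq> X)"
      unfolding Chains_def relation_of_def by auto
    show "\<exists>X\<in>\<A>. \<forall>Y\<in>\<C>. X \<subseteq> Y"
    proof (cases "\<C> = {}")
      case True
      have "C \<in> \<A>" using C cl by (simp add: \<A>_def)
      then show ?thesis using True by auto
    next
      case False
      have sub: "X \<subseteq> C" "X \<noteq> {}" "compact X" if "X \<in> \<C>" for X
        using ch[OF that that] by (auto simp: \<A>_def)
      have "C \<inter> \<Inter>\<C> \<noteq> {}"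
      proof (rule compact_imp_fip[OF C(1)])
        show "closed X" if "X \<in> \<C>" for X using sub(3)[OF that] by (rule closedI)
      next
        fix \<F> assume \<F>: "finite \<F>" "\<F> \<subseteq> \<C>"
        show "C \<inter> \<Inter>\<F> \<noteq> {}"
        proof (cases "\<F> = {}")
          case False
          have "\<exists>X\<in>\<F>. \<forall>Y\<in>\<F>. X \<subseteq> Y"
            using \<F>(1) False \<F>(2)
          proof (induction rule: finite_ne_induct)
            case (insert Z G)
            then obtain X where X: "X \<in> G" "\<forall>Y\<in>G. X \<subseteq> Y" by auto
            have "X \<subseteq> Z \<or> Z \<subseteq> X" using ch insert.prems X(1) by blast
            then show ?case using X by auto
          qed auto
          then obtain X where X: "X \<in> \<F>" "\<forall>Y\<in>\<F>. X \<subseteq> Y" by blast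
          then have "X \<subseteq> \<Inter>\<F>" "X \<in> \<C>" using \<F>(2) by auto
          then show ?thesis using sub[of X] by blast
        qed (use C in simp)
      qed
      moreover have "\<Inter>\<C> \<subseteq> C" using False sub(1) by blast
      moreover have "compact (\<Inter>\<C>)"
      proof -
        have "closed (\<Inter>\<C>)" using sub(3) by (intro closed_Inter) (auto intro: closedI)
        then show ?thesis using C(1) \<open>\<Inter>\<C> \<subseteq> C\<close> compact_Int_closed[of C "\<Inter>\<C>"]
          by (simp add: Int_absorb1)
      qed
      moreover have "m u v \<in> \<Inter>\<C>" if "u \<in> \<Inter>\<C>" "v \<in> \<Inter>\<C>" for u v
      proof
        fix X assume "X \<in> \<C>"
        then have "X \<in> \<A>" using ch by blast
        then show "m u v \<in> X" using that \<open>X \<in> \<C>\<close> by (auto simp: \<A>_def)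
      qed
      ultimately have "\<Inter>\<C> \<in> \<A>" by (auto simp: \<A>_def Int_absorb1)
      then show ?thesis by blast
    qed
  qed
  then obtain X where X: "X \<in> \<A>" "\<And>Y. Y \<in> \<A> \<Longrightarrow> Y \<subseteq> X \<Longrightarrow> Y = X" by blast
  have XC: "X \<subseteq> C" "X \<noteq> {}" "compact X" "\<And>u v. u \<in> X \<Longrightarrow> v \<in> X \<Longrightarrow> m u v \<in> X"
    using X(1) by (auto simp: \<A>_def)
  obtain v where v: "v \<in> X" using XC(2) by blast
  have vC: "v \<in> C" using v XC(1) by blast
  have contX: "continuous_on X (\<lambda>u. m u v)" using cont[OF vC] XC(1) continuous_on_subset by blast
  have "(\<lambda>u. m u v) ` X = X"
  proof (rule X(2))
    have "m (m x v) (m y v) \<in> (\<lambda>u. m u v) ` X" if "x \<in> X" "y \<in> X" for x y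
    proof -
      have "m (m x v) (m y v) = m (m (m x v) y) v"
        using assoc[of "m x v" y v] that v XC(1) XC(4)[of x v] by (simp add: subset_iff)
      then show ?thesis using that v XC(4) by blast
    qed
    then show "(\<lambda>u. m u v) ` X \<in> \<A>"
      using XC(1,2) XC(4)[OF _ v] compact_continuous_image[OF contX XC(3)]
      unfolding \<A>_def by blast
    show "(\<lambda>u. m u v) ` X \<subseteq> X" using XC(4) v by blast
  qed
  then obtain u0 where u0: "u0 \<in> X" "m u0 v = v" using v by (metis imageE)
  have "{u \<in> X. m u v = v} = X"
  proof (rule X(2))
    have "closed (X \<inter> (\<lambda>u. m u v) -` {v})"
      by (intro continuous_closed_preimage contX closedI XC(3)) auto
    moreover have "X \<inter> (\<lambda>u. m u v) -` {v} = X \<inter> {u \<in> X. m u v = v}" by auto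
    ultimately have "compact {u \<in> X. m u v = v}"
      using compact_Int_closed[OF XC(3), of "X \<inter> (\<lambda>u. m u v) -` {v}"] by (simp add: Int_def)
    moreover have "m (m x y) v = v" if "x \<in> X" "y \<in> X" "m x v = v" "m y v = v" for x y
    proof -
      have "m (m x y) v = m x (m y v)" using that v XC(1) by (intro assoc) auto
      then show ?thesis using that by simp
    qed
    ultimately show "{u \<in> X. m u v = v} \<in> \<A>"
      using XC u0 by (auto simp: \<A>_def)
  qed auto
  then show ?thesis using that v vC by blast
qed

text \<open>The extension of concatenation to ultrafilters. It is continuous in the left factor: for
  fixed \<open>V'\<close>, the value at \<open>P\<close> is a single coordinate of
  \<open>V\<close>.\<close>

definition conv :: "(('a list \<Rightarrow> bool) \<Rightarrow> bool) \<Rightarrow> (('a list \<Rightarrow> bool) \<Rightarrow> bool) \<Rightarrow> ('a list \<Rightarrow> bool) \<Rightarrow> bool" where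
  "conv V V' P \<longleftrightarrow> V (\<lambda>x. V' (\<lambda>y. P (x @ y)))"

lemma ultra_conv: "ultra V \<Longrightarrow> ultra V' \<Longrightarrow> ultra (conv V V')"
  unfolding ultra_def conv_def by simp

lemma conv_assoc: "conv (conv U V) W = conv U (conv V W)"
  by (rule ext) (simp add: conv_def)

text \<open>The equations cut out a compact set, and if \<open>conv\<close> preserves them it is a
  semigroup to which \<open>Ellis_idempotent\<close> applies.\<close>

lemma idempotent_ultra:
  fixes E :: "(('a list \<Rightarrow> bool) \<times> ('a list \<Rightarrow> bool)) set"
  assumes ne: "\<exists>V. ultra V \<and> (\<forall>(P, Q)\<in>E. V P = V Q)"
    and cl: "\<And>U V P Q. ultra U \<Longrightarrow> ultra V \<Longrightarrow> \<forall>(P, Q)\<in>E. U P = U Q \<Longrightarrow>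
      \<forall>(P, Q)\<in>E. V P = V Q \<Longrightarrow> (P, Q) \<in> E \<Longrightarrow> conv U V P = conv U V Q"
  obtains V where "ultra V" "\<forall>(P, Q)\<in>E. V P = V Q" "conv V V = V"
proof -
  let ?C = "{V. ultra V \<and> (\<forall>(P, Q)\<in>E. V P = V Q)}"
  have cont: "continuous_on ?C (\<lambda>U. conv U V)" for V
  proof (rule continuous_on_coordinatewise_then_product)
    fix P
    have "continuous_on ?C (\<lambda>U :: ('a list \<Rightarrow> bool) \<Rightarrow> bool. U (\<lambda>x. V (\<lambda>y. P (x @ y))))"
      by (rule continuous_on_subset[OF continuous_on_product_coordinates subset_UNIV])
    then show "continuous_on ?C (\<lambda>U. conv U V P)" by (simp add: conv_def)
  qed
  obtain V where "V \<in> ?C" "conv V V = V"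
  proof (rule Ellis_idempotent[of ?C conv])
    have "Hausdorff_space (euclidean :: bool topology)"
      unfolding Hausdorff_space_def disjnt_def open_openin[symmetric] by (intro allI impI hausdorff) simp
    then have "Hausdorff_space (product_topology (\<lambda>_. euclidean :: bool topology) (UNIV :: ('a list \<Rightarrow> bool) set))"
      by (simp add: Hausdorff_space_product_topology)
    then show "Hausdorff_space (euclidean :: (('a list \<Rightarrow> bool) \<Rightarrow> bool) topology)"
      by (simp add: euclidean_product_topology)
    show "compact ?C" by (rule compact_ultra_eqs)
    show "?C \<noteq> {}" using ne by blast
    show "conv U V \<in> ?C" if "U \<in> ?C" "V \<in> ?C" for U V
      using that cl[of U V] by (auto intro: ultra_conv)
  qed (auto simp: conv_assoc cont)
  then show ?thesis using that by auto
qed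

section \<open>Variable words\<close>

text \<open>The variable is \<open>None\<close>.\<close>

definition fill :: "'l \<Rightarrow> 'l option list \<Rightarrow> 'l list" where
  "fill a x = map (\<lambda>o'. case o' of None \<Rightarrow> a | Some f \<Rightarrow> f) x"

lemma fill_append [simp]: "fill a (x @ y) = fill a x @ fill a y"
  and fill_map_Some [simp]: "fill a (map Some w) = w"
  by (simp_all add: fill_def comp_def)

definition hales_jewett :: "'l set \<Rightarrow> bool" where
  "hales_jewett A \<longleftrightarrow> (\<forall>f :: 'l list \<Rightarrow> nat. \<forall>r. (\<forall>w. f w < r) \<longrightarrow>
     (\<exists>x c. None \<in> set x \<and> (\<forall>a\<in>A. f (fill a x) = c)))"

text \<open>The colour of a word is the set of predicates in \<open>\<P>\<close> that hold of it,
  coded as a number; one variable word then serves all of them.\<close>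

lemma hales_jewett_predicates:
  fixes A :: "'l set"
  assumes "hales_jewett A" "finite \<P>"
  obtains x where "None \<in> set x" "\<And>P a b. P \<in> \<P> \<Longrightarrow> a \<in> A \<Longrightarrow> b \<in> A \<Longrightarrow> P (fill a x) \<longleftrightarrow> P (fill b x)"
proof -
  have fin: "finite (Pow \<P>)" using assms(2) by simp
  define code where "code = to_nat_on (Pow \<P>)"
  have inj: "inj_on code (Pow \<P>)"
    unfolding code_def by (rule inj_on_to_nat_on[OF countable_finite[OF fin]])
  define f where "f w = code {P \<in> \<P>. P w}" for w
  define r where "r = Suc (Max (code ` Pow \<P>))"
  have "f w < r" for w
    unfolding f_def r_def using fin by (intro le_imp_less_Suc Max_ge) auto
  then obtain x c where x: "None \<in> set x" "\<forall>a\<in>A. f (fill a x) = c"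
    using assms(1) unfolding hales_jewett_def by blast
  have "P (fill a x) \<longleftrightarrow> P (fill b x)" if "P \<in> \<P>" "a \<in> A" "b \<in> A" for P a b
  proof -
    have "code {P \<in> \<P>. P (fill a x)} = code {P \<in> \<P>. P (fill b x)}"
      using x(2) that unfolding f_def by simp
    then have "{P \<in> \<P>. P (fill a x)} = {P \<in> \<P>. P (fill b x)}"
      by (rule inj_onD[OF inj]) auto
    then show ?thesis using that(1) by blast
  qed
  then show ?thesis using x(1) that by blast
qed

text \<open>Finitely many equations involve finitely many predicates, and
  \<open>hales_jewett_predicates\<close> gives a single variable word for these.\<close>

lemma hales_jewett_ultra:
  fixes A :: "'l set"
  assumes "hales_jewett A"
  obtains V where "ultra V" "V (\<lambda>x. None \<in> set x)"
    "\<And>P a b. a \<in> A \<Longrightarrow> b \<in> A \<Longrightarrow> V (\<lambda>x. P (fill a x)) \<longleftrightarrow> V (\<lambda>x. P (fill b x))"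
proof -
  define E where "E = {(\<lambda>x. P (fill a x), \<lambda>x. P (fill b x)) | P a b. a \<in> A \<and> b \<in> A}
    \<union> {(\<lambda>x :: 'l option list. None \<in> set x, \<lambda>_. True)}"
  have "\<exists>V. ultra V \<and> (\<forall>(P, Q)\<in>E. V P = V Q)"
  proof (rule ultra_compactness_points)
    fix E0 assume E0: "finite E0" "E0 \<subseteq> E"
    define R where "R e P \<longleftrightarrow> e = (\<lambda>x. None \<in> set x, \<lambda>_. True) \<or>
        (\<exists>a\<in>A. \<exists>b\<in>A. e = (\<lambda>x. P (fill a x), \<lambda>x. P (fill b x)))" for e P
    have "\<exists>P. R e P" if "e \<in> E0" for e
    proof -
      have "e \<in> E" using that E0(2) by blast
      then consider P a b where "a \<in> A" "b \<in> A" "e = (\<lambda>x. P (fill a x), \<lambda>x. P (fill b x))"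
        | "e = (\<lambda>x. None \<in> set x, \<lambda>_. True)"
        unfolding E_def by blast
      then show ?thesis
      proof cases
        case (1 P a b)
        then have "R e P" unfolding R_def by blast
        then show ?thesis using [[show_types]] by (rule exI[of "R e" P])
      qed (simp add: R_def)
    qed
    then have p: "R e (SOME P. R e P)" if "e \<in> E0" for e using someI_ex[OF _, of "R e"] that by simp
    define p where "p e = (SOME P. R e P)" for e
    note p = p[folded p_def]
    obtain x where x: "None \<in> set x"
      "\<And>P a b. P \<in> p ` E0 \<Longrightarrow> a \<in> A \<Longrightarrow> b \<in> A \<Longrightarrow> P (fill a x) \<longleftrightarrow> P (fill b x)"
      using hales_jewett_predicates[OF assms finite_imageI[OF E0(1)]] by blast
    have R: "fst e x = snd e x" if "R e P" "\<And>a b. a \<in> A \<Longrightarrow> b \<in> A \<Longrightarrow> P (fill a x) \<longleftrightarrow> P (fill b x)" for e P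
      using that(1) unfolding R_def
    proof (elim disjE bexE)
      fix a b assume "a \<in> A" "b \<in> A" "e = (\<lambda>x. P (fill a x), \<lambda>x. P (fill b x))"
      then show ?thesis using that(2)[of a b] by simp
    qed (use x(1) in simp)
    have "fst e x = snd e x" if "e \<in> E0" for e
      by (rule R[OF p[OF that]]) (rule x(2)[OF imageI[OF that]])
    then show "\<exists>x. \<forall>e\<in>E0. fst e x = snd e x" by blast
  qed
  then obtain V where V: "ultra V" "\<And>P Q. (P, Q) \<in> E \<Longrightarrow> V P = V Q" by blast
  show ?thesis
  proof (rule that[OF V(1)])
    have "V (\<lambda>x. None \<in> set x) = V (\<lambda>_. True)" by (rule V(2)) (simp add: E_def)
    then show "V (\<lambda>x. None \<in> set x)" using ultra_True[OF V(1)] by simp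
  qed (auto simp: E_def intro!: V(2))
qed

text \<open>Colour focusing. Passing to the limit colour \<open>f'\<close> along an ultrafilter replaces the usual
  choice of blocks of bounded length.\<close>

lemma hales_jewett_insert:
  fixes A :: "'l set"
  assumes HJ: "hales_jewett A" and fin: "finite A" and a0: "a0 \<in> A"
  shows "hales_jewett (insert c A)"
  unfolding hales_jewett_def
proof (intro allI impI)
  fix f :: "'l list \<Rightarrow> nat" and r assume r: "\<forall>w. f w < r"
  obtain V where V: "ultra V" "V (\<lambda>x. None \<in> set x)"
    "\<And>P a b. a \<in> A \<Longrightarrow> b \<in> A \<Longrightarrow> V (\<lambda>x. P (fill a x)) \<longleftrightarrow> V (\<lambda>x. P (fill b x))"
    using hales_jewett_ultra[OF HJ] by metis
  let ?mono = "\<lambda>f :: 'l list \<Rightarrow> nat. \<exists>x d. None \<in> set x \<and> (\<forall>a\<in>insert c A. f (fill a x) = d)"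
  \<comment> \<open>The variable words \<open>X i\<close> become the same word \<open>y\<close> at
    the new letter \<open>c\<close>; each is monochromatic on \<open>A\<close>, and their
    \<open>s\<close> colours are different.\<close>
  let ?focus = "\<lambda>(f :: 'l list \<Rightarrow> nat) (s :: nat). \<exists>X y \<gamma>. inj_on \<gamma> {..<s} \<and>
      (\<forall>i<s. None \<in> set (X i) \<and> fill c (X i) = y \<and> (\<forall>a\<in>A. f (fill a (X i)) = \<gamma> i))"
  have "\<forall>w. f w < r \<Longrightarrow> ?mono f \<or> ?focus f s" for f s
  proof (induction s arbitrary: f)
    case (Suc s)
    have lim: "\<exists>d<r. V (\<lambda>z. f (fill a0 z @ v) = d)" for v
      using Suc.prems ultra_color[OF V(1), of "{..<r}" "\<lambda>z. f (fill a0 z @ v)"] ultra_True[OF V(1)]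
      by auto
    then obtain f' where f': "\<And>v. f' v < r" "\<And>v. V (\<lambda>z. f (fill a0 z @ v) = f' v)" by metis
    \<comment> \<open>By substitution invariance the limit colour does not depend on which letter of
      \<open>A\<close> fills the prefix.\<close>
    have f'A: "V (\<lambda>z. f (fill a z @ v) = f' v)" if "a \<in> A" for a v
      using V(3)[OF a0 that, of "\<lambda>w. f (w @ v) = f' v"] f'(2) by simp
    have pick: "\<exists>z. None \<in> set z \<and> (\<forall>a\<in>A. \<forall>v\<in>W. f (fill a z @ v) = f' v)" if "finite W" for W
    proof -
      have "V (\<lambda>z. None \<in> set z \<and> (\<forall>a\<in>A. \<forall>v\<in>W. f (fill a z @ v) = f' v))"
        using V(2) f'A by (simp add: ultra_conj[OF V(1)] ultra_ball[OF V(1)] fin that)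
      then show ?thesis by (rule ultra_ex[OF V(1)]) blast
    qed
    have mono: "?mono f" if m: "?mono f'"
    proof -
      obtain x d where x: "None \<in> set x" "\<forall>a\<in>insert c A. f' (fill a x) = d" using m by blast
      obtain z where z: "\<forall>a\<in>A. \<forall>v\<in>(\<lambda>a. fill a x) ` insert c A. f (fill a z @ v) = f' v"
        using pick[of "(\<lambda>a. fill a x) ` insert c A"] fin by auto
      have "\<forall>a\<in>insert c A. f (fill a (map Some (fill a0 z) @ x)) = d"
        using x(2) z a0 by simp
      then show ?thesis using x(1) by (intro exI[of _ "map Some (fill a0 z) @ x"]) auto
    qed
    have "\<forall>w. f' w < r" using f'(1) by simp
    from Suc.IH[OF this] show ?case
    proof
      assume "?focus f' s"
      then obtain X y \<gamma> where X: "inj_on \<gamma> {..<s}"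
        "\<And>i. i < s \<Longrightarrow> None \<in> set (X i)" "\<And>i. i < s \<Longrightarrow> fill c (X i) = y"
        "\<And>i a. i < s \<Longrightarrow> a \<in> A \<Longrightarrow> f' (fill a (X i)) = \<gamma> i" by metis
      show ?case
      proof (cases "\<exists>i<s. f' y = \<gamma> i")
        case True
        then obtain i where i: "i < s" "f' y = \<gamma> i" by blast
        \<comment> \<open>If the focal word has the colour of one of the foci, this focus is
          monochromatic at \<open>c\<close> as well.\<close>
        then have "?mono f'" using X by (intro exI[of _ "X i"] exI[of _ "\<gamma> i"]) auto
        then show ?thesis using mono by blast
      next
        case False
        let ?W = "insert y ((\<lambda>(i, a). fill a (X i)) ` ({..<s} \<times> A))"
        obtain z where z: "None \<in> set z" "\<forall>a\<in>A. \<forall>v\<in>?W. f (fill a z @ v) = f' v"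
          using pick[of ?W] fin by auto
        \<comment> \<open>Otherwise every focus is prolonged by \<open>z\<close>, and the word
          \<open>y\<close>, preceded by \<open>z\<close>, becomes one more focus with its variables
          in \<open>z\<close>; its colour \<open>f' y\<close> is new.\<close>
        define X' where "X' i = (if i < s then z @ X i else z @ map Some y)" for i
        define \<gamma>' where "\<gamma>' i = (if i < s then \<gamma> i else f' y)" for i
        have "inj_on \<gamma>' {..<Suc s}"
          using X(1) False by (auto simp: \<gamma>'_def inj_on_def less_Suc_eq)
        moreover have "None \<in> set (X' i) \<and> fill c (X' i) = fill c z @ y \<and> (\<forall>a\<in>A. f (fill a (X' i)) = \<gamma>' i)"
          if "i < Suc s" for i
        proof (cases "i < s")
          case True
          have "f (fill a z @ fill a (X i)) = \<gamma> i" if "a \<in> A" for a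
          proof -
            have "fill a (X i) \<in> ?W" using that True by (auto intro!: image_eqI[where x = "(i, a)"])
            then show ?thesis using z(2) X(4) that True by auto
          qed
          then show ?thesis using True z X(2,3) by (simp add: X'_def \<gamma>'_def)
        qed (use z in \<open>simp add: X'_def \<gamma>'_def\<close>)
        ultimately have "?focus f (Suc s)"
          by (intro exI[of _ X'] exI[of _ "fill c z @ y"] exI[of _ \<gamma>']) blast
        then show ?thesis ..
      qed
    qed (use mono in blast)
  qed (intro disjI2 exI, auto)
  \<comment> \<open>\<open>Suc r\<close> foci would need \<open>Suc r\<close> different colours
    below \<open>r\<close>.\<close>
  from this[OF r, of "Suc r"] show "?mono f"
  proof
    assume "?focus f (Suc r)"
    then obtain X \<gamma> where "inj_on \<gamma> {..<Suc r}" "\<forall>i<Suc r. f (fill a0 (X i)) = \<gamma> i"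
      using a0 by metis
    moreover from this have "\<gamma> ` {..<Suc r} \<subseteq> {..<r}" using r by (auto simp: image_subset_iff) (metis)
    ultimately have "card {..<Suc r} \<le> card {..<r}" by (intro card_inj_on_le) auto
    then show ?thesis by simp
  qed
qed

theorem hales_jewett:
  assumes "finite A"
  shows "hales_jewett A"
  using assms
proof induction
  case empty
  show ?case unfolding hales_jewett_def by (auto intro: exI[of _ "[None]"])
next
  case (insert c A)
  show ?case
  proof (cases "A = {}")
    case True
    show ?thesis unfolding hales_jewett_def True by (auto intro: exI[of _ "[None]"])
  next
    case False
    then obtain a where "a \<in> A" by blast
    then show ?thesis by (rule hales_jewett_insert[OF insert.IH insert.hyps(1)])
  qed
qed

text \<open>A letter \<open>f\<close> gives the letter \<open>f i\<close> to the coordinate \<open>i\<close> of a tuple.\<close>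

type_synonym vword = "(nat \<Rightarrow> nat) option list"

definition wpull :: "(nat \<Rightarrow> nat) \<Rightarrow> (nat \<Rightarrow> nat) list \<Rightarrow> (nat \<Rightarrow> nat) list" where
  "wpull h w = map (\<lambda>f. f \<circ> h) w"

definition pull :: "(nat \<Rightarrow> nat) \<Rightarrow> vword \<Rightarrow> vword" where
  "pull h x = map (map_option (\<lambda>f. f \<circ> h)) x"

definition vagree :: "nat \<Rightarrow> vword \<Rightarrow> vword \<Rightarrow> bool" where
  "vagree p x y \<longleftrightarrow> list_all2 (rel_option (\<lambda>f g. \<forall>i<p. f i = g i)) x y"

definition supported :: "nat \<Rightarrow> (vword \<Rightarrow> bool) \<Rightarrow> bool" where
  "supported p P \<longleftrightarrow> (\<forall>x y. vagree p x y \<longrightarrow> P x = P y)"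

text \<open>These constant letters lengthen a node before the variable splits it, which leaves room
  for large letters at the splitting.\<close>

definition vprefix :: "vword \<Rightarrow> vword" where
  "vprefix x = takeWhile (\<lambda>f. f \<noteq> None) x"

lemma pull_append [simp]: "pull h (x @ y) = pull h x @ pull h y"
  and pull_pull: "pull h (pull g x) = pull (g \<circ> h) x"
  by (simp_all add: pull_def option.map_comp comp_def)

lemma fill_pull: "fill (a \<circ> h) (pull h x) = wpull h (fill a x)"
  by (auto simp: fill_def pull_def wpull_def split: option.split)

lemma vagree_refl [simp]: "vagree p x x"
  by (auto simp: vagree_def intro!: list.rel_refl option.rel_refl)

lemma vagree_append: "vagree p x x' \<Longrightarrow> vagree p y y' \<Longrightarrow> vagree p (x @ y) (x' @ y')"
  unfolding vagree_def by (rule list_all2_appendI)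

lemma vagree_pull: "(\<And>i. i < p \<Longrightarrow> g i = h i) \<Longrightarrow> vagree p (pull g x) (pull h x)"
  by (auto simp: vagree_def pull_def list_all2_conv_all_nth option.rel_map
      intro!: option.rel_refl)

lemma supported_pull:
  assumes "supported p P" "\<And>i. i < p \<Longrightarrow> g i = h i"
  shows "P (pull g x) = P (pull h x)"
  using assms vagree_pull unfolding supported_def by metis

section \<open>An idempotent invariant under substitutions and changes of coordinates\<close>

definition fill_eqs :: "((vword \<Rightarrow> bool) \<times> (vword \<Rightarrow> bool)) set" where
  "fill_eqs = range (\<lambda>(P, a, b). (\<lambda>x. P (fill a x), \<lambda>x. P (fill b x)))"

definition length_eqs :: "((vword \<Rightarrow> bool) \<times> (vword \<Rightarrow> bool)) set" where
  "length_eqs = range (\<lambda>l. (\<lambda>x. None \<in> set x \<and> l \<le> length (vprefix x), \<lambda>_. True))"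

text \<open>The predicates have finite support, since the invariance comes from Ramsey's theorem for
  sets of \<open>p\<close> coordinates.\<close>

definition order_eqs :: "((vword \<Rightarrow> bool) \<times> (vword \<Rightarrow> bool)) set" where
  "order_eqs = (\<lambda>(p, P, h). (\<lambda>x. P (pull h x), P)) `
     {(p, P, h). supported p P \<and> strict_mono_on {..<p} h}"

text \<open>Finitely many equations mention a finite alphabet \<open>A\<close> and finitely many
  lengths. The Hales-Jewett theorem is applied to the predicates shifted by a constant word
  \<open>z\<close>, and putting \<open>z\<close> in front of the result makes its constant prefix
  long.\<close>

lemma fill_length_ultra: "\<exists>V. ultra V \<and> (\<forall>(P, Q)\<in>fill_eqs \<union> length_eqs. V P = V Q)"
proof (rule ultra_compactness_points)
  fix E0 assume E0: "finite E0" "E0 \<subseteq> fill_eqs \<union> length_eqs"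
  obtain C where C: "finite C" "E0 \<inter> fill_eqs = (\<lambda>(P, a, b). (\<lambda>x. P (fill a x), \<lambda>x. P (fill b x))) ` C"
    using finite_subset_image[of "E0 \<inter> fill_eqs" "\<lambda>(P, a, b). (\<lambda>x. P (fill a x), \<lambda>x. P (fill b x))" UNIV] E0(1)
    unfolding fill_eqs_def by auto
  obtain L where L: "finite L" "E0 \<inter> length_eqs =
      (\<lambda>l. (\<lambda>x. None \<in> set x \<and> l \<le> length (vprefix x), \<lambda>_. True)) ` L"
    using finite_subset_image[of "E0 \<inter> length_eqs"
        "\<lambda>l. (\<lambda>x. None \<in> set x \<and> l \<le> length (vprefix x), \<lambda>_. True)" UNIV] E0(1)
    unfolding length_eqs_def by auto
  define m where "m = Max (insert 0 L)"
  define z where "z = replicate m (\<lambda>_ :: nat. 0 :: nat)"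
  define A where "A = (\<lambda>(P, a, b). a) ` C \<union> (\<lambda>(P, a, b). b) ` C"
  define \<P> where "\<P> = (\<lambda>(P, a, b) w. P (z @ w)) ` C"
  have "hales_jewett A" by (rule hales_jewett) (simp add: A_def C)
  then obtain x where x: "None \<in> set x"
    "\<And>P a b. P \<in> \<P> \<Longrightarrow> a \<in> A \<Longrightarrow> b \<in> A \<Longrightarrow> P (fill a x) \<longleftrightarrow> P (fill b x)"
    using hales_jewett_predicates[of A \<P>] C(1) by (auto simp: \<P>_def)
  let ?x = "map Some z @ x"
  have 1: "fst e ?x = snd e ?x" if e: "e \<in> E0" "e \<in> fill_eqs" for e
  proof -
    obtain P a b where Pab: "(P, a, b) \<in> C" "e = (\<lambda>x. P (fill a x), \<lambda>x. P (fill b x))"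
    proof -
      have "e \<in> (\<lambda>(P, a, b). (\<lambda>x. P (fill a x), \<lambda>x. P (fill b x))) ` C" using e C(2) by blast
      then show thesis by (elim imageE) (use that in \<open>simp split: prod.splits\<close>)
    qed
    have "(\<lambda>w. P (z @ w)) \<in> \<P>" "a \<in> A" "b \<in> A"
      using Pab(1) unfolding \<P>_def A_def by force+
    from x(2)[OF this] show ?thesis using Pab(2) by simp
  qed
  have 2: "fst e ?x = snd e ?x" if e: "e \<in> E0" "e \<in> length_eqs" for e
  proof -
    obtain l where l: "l \<in> L" "e = (\<lambda>x. None \<in> set x \<and> l \<le> length (vprefix x), \<lambda>_. True)"
    proof -
      have "e \<in> (\<lambda>l. (\<lambda>x. None \<in> set x \<and> l \<le> length (vprefix x), \<lambda>_. True)) ` L" using e L(2) by blast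
      then show thesis using that by (elim imageE)
    qed
    have "l \<le> m" unfolding m_def using L(1) l(1) by (intro Max_ge) auto
    moreover have "vprefix ?x = map Some z @ vprefix x"
      unfolding vprefix_def by (subst takeWhile_append2) auto
    ultimately show ?thesis using l(2) x(1) by (simp add: z_def)
  qed
  show "\<exists>x. \<forall>e\<in>E0. fst e x = snd e x"
    using 1 2 E0(2) by (intro exI[of _ ?x]) blast
qed

lemma strict_mono_on_sorted_list:
  assumes "strict_mono_on {..<p} (h :: nat \<Rightarrow> nat)"
  shows "sorted_list_of_set (h ` {..<p}) = map h [0..<p]"
proof (rule sorted_distinct_set_unique)
  have "h i \<le> h j" if "i \<le> j" "j < p" for i j
    using assms that by (cases "i = j") (auto simp: strict_mono_on_def less_imp_le)
  then show "sorted (map h [0..<p])" by (simp add: sorted_iff_nth_mono)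
  show "distinct (map h [0..<p])"
    using strict_mono_on_imp_inj_on[OF assms] by (simp add: distinct_map lessThan_atLeast0)
qed (auto simp: lessThan_atLeast0)

text \<open>One application of Ramsey's theorem for each member of \<open>C\<close>: a set of
  \<open>p\<close> coordinates is coloured by the truth value obtained from its increasing
  enumeration, and \<open>g'\<close> enumerates an infinite homogeneous set. Earlier members of
  \<open>C\<close> stay satisfied because \<open>g' \<circ> h\<close> is increasing again.\<close>

lemma Ramsey_order:
  assumes "ultra V" "finite C" "\<And>p P. (p, P) \<in> C \<Longrightarrow> supported p P"
  shows "\<exists>g. strict_mono g \<and> (\<forall>(p, P)\<in>C. \<forall>h. strict_mono_on {..<p} h \<longrightarrow>
    V (\<lambda>x. P (pull (g \<circ> h) x)) = V (\<lambda>x. P (pull g x)))"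
  using assms(2,3)
proof (induction C)
  case empty
  show ?case by (intro exI[of _ id]) (simp add: strict_mono_def)
next
  case (insert c C)
  obtain p P where c: "c = (p, P)" by fastforce
  have "\<exists>g. strict_mono g \<and> (\<forall>(p, P)\<in>C. \<forall>h. strict_mono_on {..<p} h \<longrightarrow>
      V (\<lambda>x. P (pull (g \<circ> h) x)) = V (\<lambda>x. P (pull g x)))"
    by (rule insert.IH) (use insert.prems in blast)
  then obtain g where g0: "strict_mono g" "\<forall>(p, P)\<in>C. \<forall>h. strict_mono_on {..<p} h \<longrightarrow>
      V (\<lambda>x. P (pull (g \<circ> h) x)) = V (\<lambda>x. P (pull g x))" by (elim exE conjE)
  have g: "strict_mono g" "V (\<lambda>x. P (pull (g \<circ> h) x)) = V (\<lambda>x. P (pull g x))"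
    if "(p, P) \<in> C" "strict_mono_on {..<p} h" for p P h
    using g0(1) bspec[OF g0(2) that(1)] that(2) by simp_all
  have sup: "supported p P" using insert.prems c by blast
  define f where "f X = (if V (\<lambda>x. P (pull (g \<circ> (\<lambda>i. sorted_list_of_set X ! i)) x)) then 1 else 0 :: nat)" for X
  have fh: "f (h ` {..<p}) = (if V (\<lambda>x. P (pull (g \<circ> h) x)) then 1 else 0)"
    if "strict_mono_on {..<p} h" for h
  proof -
    \<comment> \<open>The enumeration has meaningless values from \<open>p\<close> on; the support
      of \<open>P\<close> makes them harmless.\<close>
    have "P (pull (g \<circ> (\<lambda>i. sorted_list_of_set (h ` {..<p}) ! i)) x) = P (pull (g \<circ> h) x)" for x
      by (rule supported_pull[OF sup]) (simp add: strict_mono_on_sorted_list[OF that])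
    then show ?thesis unfolding f_def by simp
  qed
  obtain Y t where Y: "infinite Y" "f ` nsets Y p \<subseteq> {t}"
  proof (rule Ramsey_nsets[of UNIV f p 2])
    show "f ` nsets UNIV p \<subseteq> {..<2}" by (auto simp: f_def)
  qed simp_all
  define g' where "g' = enumerate Y"
  have g': "strict_mono g'" "\<And>i. g' i \<in> Y"
    using Y(1) by (simp_all add: g'_def strict_mono_enumerate enumerate_in_set)
  have const: "V (\<lambda>x. P (pull (g \<circ> (g' \<circ> h)) x)) \<longleftrightarrow> t = 1"
    if h: "strict_mono_on {..<p} h" for h
  proof -
    have sm: "strict_mono_on {..<p} (g' \<circ> h)"
      using h g'(1) by (auto simp: strict_mono_on_def strict_mono_def)
    have "card ((g' \<circ> h) ` {..<p}) = p"
      using card_image[OF strict_mono_on_imp_inj_on[OF sm]] by simp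
    then have "(g' \<circ> h) ` {..<p} \<in> nsets Y p"
      using g'(2) unfolding nsets_def by auto
    then have "f ((g' \<circ> h) ` {..<p}) = t" using Y(2) by blast
    then show ?thesis using fh[OF sm] by (auto split: if_splits)
  qed
  have mono_id: "strict_mono_on {..<p} id" for p :: nat by (simp add: strict_mono_on_def)
  have "V (\<lambda>x. Q (pull ((g \<circ> g') \<circ> h) x)) = V (\<lambda>x. Q (pull (g \<circ> g') x))"
    if "(q, Q) \<in> insert c C" "strict_mono_on {..<q} h" for q Q h
  proof (cases "(q, Q) \<in> C")
    case True
    have "strict_mono_on {..<q} (g' \<circ> h)" "strict_mono_on {..<q} g'"
      using that(2) g'(1) by (auto simp: strict_mono_on_def strict_mono_def)
    from this[THEN g(2)[OF True]] show ?thesis by (simp add: comp_assoc)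
  next
    case False
    then have "q = p" "Q = P" using that(1) c by auto
    then show ?thesis using const[OF that(2)[unfolded \<open>q = p\<close>]] const[OF mono_id]
      by (simp add: comp_assoc)
  qed
  moreover have "strict_mono (g \<circ> g')" using g0(1) g'(1) by (auto simp: strict_mono_def)
  ultimately show ?case by (intro exI[of _ "g \<circ> g'"]) blast
qed

text \<open>The ultrafilter of \<open>fill_length_ultra\<close> is moved by \<open>pull g\<close>
  for the \<open>g\<close> of \<open>Ramsey_order\<close>. As \<open>g\<close> is injective, each
  letter factors through it, so invariance under substitution survives; the positions of the
  variables do not change, so the lengths survive too.\<close>

lemma order_ultra: "\<exists>V. ultra V \<and> (\<forall>(P, Q)\<in>fill_eqs \<union> length_eqs \<union> order_eqs. V P = V Q)"
proof (rule ultra_compactness)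
  obtain V where V: "ultra V" "\<And>P Q. (P, Q) \<in> fill_eqs \<union> length_eqs \<Longrightarrow> V P = V Q"
    using fill_length_ultra by blast
  fix E0 assume E0: "finite E0" "E0 \<subseteq> fill_eqs \<union> length_eqs \<union> order_eqs"
  have "\<exists>C\<subseteq>{(p, P, h). supported p P \<and> strict_mono_on {..<p} h}. finite C \<and>
      E0 \<inter> order_eqs = (\<lambda>(p, P, h). (\<lambda>x. P (pull h x), P)) ` C"
    by (rule finite_subset_image) (use E0(1) in \<open>auto simp: order_eqs_def\<close>)
  then obtain C where C: "finite C" "C \<subseteq> {(p, P, h). supported p P \<and> strict_mono_on {..<p} h}"
      "E0 \<inter> order_eqs = (\<lambda>(p, P, h). (\<lambda>x. P (pull h x), P)) ` C" by (elim exE conjE)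
  have "\<exists>g. strict_mono g \<and> (\<forall>(p, P)\<in>(\<lambda>(p, P, h). (p, P)) ` C. \<forall>h. strict_mono_on {..<p} h \<longrightarrow>
    V (\<lambda>x. P (pull (g \<circ> h) x)) = V (\<lambda>x. P (pull g x)))"
    by (rule Ramsey_order[OF V(1)]) (use C in auto)
  then obtain g where g0: "strict_mono g" "\<forall>(p, P)\<in>(\<lambda>(p, P, h). (p, P)) ` C. \<forall>h.
      strict_mono_on {..<p} h \<longrightarrow> V (\<lambda>x. P (pull (g \<circ> h) x)) = V (\<lambda>x. P (pull g x))"
    by (elim exE conjE)
  have g: "strict_mono g" "\<And>p P h' h. (p, P, h') \<in> C \<Longrightarrow> strict_mono_on {..<p} h \<Longrightarrow>
    V (\<lambda>x. P (pull (g \<circ> h) x)) = V (\<lambda>x. P (pull g x))" using g0 by force+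
  define U where "U P = V (\<lambda>x. P (pull g x))" for P
  have "ultra U" unfolding U_def by (rule ultra_map[OF V(1)])
  moreover have "U P = U Q" if PQ: "(P, Q) \<in> E0" for P Q
  proof -
    consider "(P, Q) \<in> fill_eqs" | "(P, Q) \<in> length_eqs" | "(P, Q) \<in> E0 \<inter> order_eqs"
      using PQ E0(2) by blast
    then show ?thesis
    proof cases
      case 1
      then obtain R a b where R: "P = (\<lambda>x. R (fill a x))" "Q = (\<lambda>x. R (fill b x))"
        by (auto simp: fill_eqs_def)
      have inv: "f \<circ> inv g \<circ> g = f" for f :: "nat \<Rightarrow> nat"
        using strict_mono_imp_inj_on[OF g(1)] by (simp add: fun_eq_iff)
      have fill: "fill f (pull g x) = wpull g (fill (f \<circ> inv g) x)" for f x
        using fill_pull[of "f \<circ> inv g" g x] by (simp add: inv)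
      have "(\<lambda>x. R (wpull g (fill (a \<circ> inv g) x)), \<lambda>x. R (wpull g (fill (b \<circ> inv g) x))) \<in> fill_eqs"
        unfolding fill_eqs_def by (rule range_eqI[where x = "(\<lambda>w. R (wpull g w), a \<circ> inv g, b \<circ> inv g)"]) simp
      then show ?thesis unfolding U_def R fill by (intro V(2)) blast
    next
      case 2
      then obtain l where l: "P = (\<lambda>x. None \<in> set x \<and> l \<le> length (vprefix x))" "Q = (\<lambda>_. True)"
        by (auto simp: length_eqs_def)
      have "vprefix (pull g x) = pull g (vprefix x)" for x
        unfolding vprefix_def pull_def by (simp add: takeWhile_map comp_def)
      then have "(\<lambda>x. P (pull g x)) = P"
        unfolding l by (auto simp: pull_def image_iff)
      then show ?thesis unfolding U_def using V(2)[of P Q] 2 l by simp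
    next
      case 3
      then obtain p h where "(p, Q, h) \<in> C" "P = (\<lambda>x. Q (pull h x))" unfolding C(3) by auto
      then show ?thesis unfolding U_def using g(2)[of p Q h h] C(2) by (auto simp: pull_pull)
    qed
  qed
  ultimately show "\<exists>V. ultra V \<and> (\<forall>(P, Q)\<in>E0. V P = V Q)" by blast
qed

theorem invariant_idempotent:
  obtains V :: "(vword \<Rightarrow> bool) \<Rightarrow> bool" where "ultra V" "conv V V = V"
    "\<And>P a b. V (\<lambda>x. P (fill a x)) = V (\<lambda>x. P (fill b x))"
    "\<And>l. V (\<lambda>x. None \<in> set x \<and> l \<le> length (vprefix x))"
    "\<And>p P h. supported p P \<Longrightarrow> strict_mono_on {..<p} h \<Longrightarrow> V (\<lambda>x. P (pull h x)) = V P"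
proof -
  let ?E = "fill_eqs \<union> length_eqs \<union> order_eqs"
  have fill: "V (\<lambda>x. P (fill a x)) = V (\<lambda>x. P (fill b x))" if "\<forall>(P, Q)\<in>?E. V P = V Q" for V P a b
  proof -
    have "(\<lambda>x. P (fill a x), \<lambda>x. P (fill b x)) \<in> ?E"
      unfolding fill_eqs_def by (intro UnI1 range_eqI[where x = "(P, a, b)"]) simp
    then show ?thesis using that by blast
  qed
  have len: "V (\<lambda>x. None \<in> set x \<and> l \<le> length (vprefix x))" if "\<forall>(P, Q)\<in>?E. V P = V Q" "ultra V" for V l
  proof -
    have "(\<lambda>x. None \<in> set x \<and> l \<le> length (vprefix x), \<lambda>_. True) \<in> ?E"
      unfolding length_eqs_def by blast
    then show ?thesis using that ultra_True by fastforce
  qed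
  have ord: "V (\<lambda>x. P (pull h x)) = V P"
    if "\<forall>(P, Q)\<in>?E. V P = V Q" "supported p P" "strict_mono_on {..<p} h" for V p P h
  proof -
    have "(\<lambda>x. P (pull h x), P) \<in> ?E"
      unfolding order_eqs_def by (intro UnI2 image_eqI[where x = "(p, P, h)"]) (use that in auto)
    then show ?thesis using that(1) by blast
  qed
  obtain V where V: "ultra V" "\<forall>(P, Q)\<in>?E. V P = V Q" "conv V V = V"
  proof (rule idempotent_ultra[OF order_ultra])
    fix U V :: "(vword \<Rightarrow> bool) \<Rightarrow> bool" and P Q
    assume U: "ultra U" "\<forall>(P, Q)\<in>?E. U P = U Q" and V: "ultra V" "\<forall>(P, Q)\<in>?E. V P = V Q"
      and PQ: "(P, Q) \<in> ?E"
    consider R a b where "P = (\<lambda>x. R (fill a x))" "Q = (\<lambda>x. R (fill b x))"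
      | l where "P = (\<lambda>x. None \<in> set x \<and> l \<le> length (vprefix x))" "Q = (\<lambda>_. True)"
      | p h where "supported p Q" "strict_mono_on {..<p} h" "P = (\<lambda>x. Q (pull h x))"
    proof -
      note PQ[unfolded Un_iff]
      then show thesis
      proof (elim disjE)
        assume "(P, Q) \<in> fill_eqs"
        then obtain R a b where "P = (\<lambda>x. R (fill a x))" "Q = (\<lambda>x. R (fill b x))"
          unfolding fill_eqs_def by (elim rangeE) (simp split: prod.splits)
        then show thesis by (rule that(1))
      next
        assume "(P, Q) \<in> length_eqs"
        then obtain l where "P = (\<lambda>x. None \<in> set x \<and> l \<le> length (vprefix x))" "Q = (\<lambda>_. True)"
          unfolding length_eqs_def by (elim rangeE) simp
        then show thesis by (rule that(2))
      next
        assume "(P, Q) \<in> order_eqs"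
        then obtain p h where "supported p Q" "strict_mono_on {..<p} h" "P = (\<lambda>x. Q (pull h x))"
          unfolding order_eqs_def by (elim imageE) (auto split: prod.splits)
        then show thesis by (rule that(3))
      qed
    qed
    then show "conv U V P = conv U V Q"
    proof cases
      case (1 R a b)
      \<comment> \<open>The letter is exchanged in the second factor first, for a fixed first
        factor, and then in the first factor.\<close>
      have "V (\<lambda>y. R (fill a x @ fill a y)) = V (\<lambda>y. R (fill a x @ fill b y))" for x
        using fill[of V, OF V(2), of "\<lambda>z. R (fill a x @ z)" a b] .
      then show ?thesis
        using fill[of U, OF U(2), of "\<lambda>z. V (\<lambda>y. R (z @ fill b y))" a b] by (simp add: 1 conv_def)
    next
      case (2 l)
      have 3: "None \<in> set (x @ y) \<and> l \<le> length (vprefix (x @ y))"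
        if "None \<in> set x \<and> l \<le> length (vprefix x)" for x y
        using that unfolding vprefix_def by (subst takeWhile_append1[of None]) auto
      have "conv U V P" unfolding conv_def 2
      proof (rule ultra_mono[of U, OF U(1) len[of U l, OF U(2,1)]])
        fix x :: vword assume x: "None \<in> set x \<and> l \<le> length (vprefix x)"
        have "(\<lambda>y. None \<in> set (x @ y) \<and> l \<le> length (vprefix (x @ y))) = (\<lambda>_. True)"
          using 3[OF x] by blast
        then show "V (\<lambda>y. None \<in> set (x @ y) \<and> l \<le> length (vprefix (x @ y)))"
          by (simp only: ultra_True[OF V(1)])
      qed
      then show ?thesis unfolding 2 conv_def by (simp add: ultra_True[OF V(1)] ultra_True[OF U(1)])
    next
      case (3 p h)
      have a: "supported p (\<lambda>y. Q (x @ y))" for x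
        using 3(1) vagree_append[OF vagree_refl] unfolding supported_def by blast
      have b: "supported p (\<lambda>x. V (\<lambda>y. Q (x @ y)))"
        unfolding supported_def
      proof (intro allI impI)
        fix x x' assume x: "vagree p x x'"
        have "Q (x @ y) = Q (x' @ y)" for y
          using 3(1) vagree_append[OF x vagree_refl] unfolding supported_def by blast
        then show "V (\<lambda>y. Q (x @ y)) = V (\<lambda>y. Q (x' @ y))" by simp
      qed
      have "V (\<lambda>y. Q (pull h x @ pull h y)) = V (\<lambda>y. Q (pull h x @ y))" for x
        using ord[of V, OF V(2) a 3(2)] .
      moreover have "U (\<lambda>x. V (\<lambda>y. Q (pull h x @ y))) = U (\<lambda>x. V (\<lambda>y. Q (x @ y)))"
        using ord[of U, OF U(2) b 3(2)] .
      ultimately show ?thesis by (simp only: 3(3) conv_def pull_append)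
    qed
  qed
  show ?thesis using that[OF V(1,3) fill[of V, OF V(2)] len[of V, OF V(2,1)] ord[of V, OF V(2)]] .
qed

text \<open>Serves to show that finite ordered structures are rigid: an isomorphism is determined by
  its domain and its image.\<close>

lemma sorted_wrt_unique:
  assumes "sorted_wrt R xs" "sorted_wrt R ys" "set xs = set ys"
    and "\<And>a b. a \<in> set xs \<Longrightarrow> b \<in> set xs \<Longrightarrow> R a b \<Longrightarrow> \<not> R b a"
  shows "xs = ys"
  using assms
proof (induction xs arbitrary: ys)
  case (Cons x xs)
  obtain y ys' where ys: "ys = y # ys'" using Cons.prems(3) by (cases ys) simp_all
  have irr: "\<not> R a a" if "a \<in> set (x # xs)" for a using Cons.prems(4)[OF that that] by blast
  have "x = y"
  proof (rule ccontr)
    assume "x \<noteq> y"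
    then have "y \<in> set xs" "x \<in> set ys'" using Cons.prems(3) ys by auto
    then have "R x y" "R y x" using Cons.prems(1,2) ys by auto
    then show False using Cons.prems(4)[of x y] \<open>y \<in> set xs\<close> by auto
  qed
  moreover have "x \<notin> set xs" using Cons.prems(1) irr by auto
  moreover have "y \<notin> set ys'" using Cons.prems(2,3) ys irr by auto
  ultimately have "set xs = set ys'" using Cons.prems(3) ys by auto
  then have "xs = ys'" using Cons.prems(1,2,4) ys by (intro Cons.IH) simp_all
  then show ?case using \<open>x = y\<close> ys by simp
qed simp

lemma isomorphism_inv:
  assumes "isomorphism k f A B"
  shows "isomorphism k (inv_into (universe A) f) B A"
proof -
  let ?g = "inv_into (universe A) f"
  have f: "inj_on f (universe A)" "f ` universe A = universe B"
    using assms by (auto simp: isomorphism_def embedding_def)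
  have g: "?g y \<in> universe A" "f (?g y) = y" if "y \<in> universe B" for y
    using that f(2) by (auto intro: inv_into_into f_inv_into_f)
  have bij: "bij_betw ?g (universe B) (universe A)"
    using f by (intro bij_betw_inv_into) (simp add: bij_betw_def)
  have "(ordr B x y \<longleftrightarrow> ordr A (?g x) (?g y)) \<and> (\<forall>l<k. rel B l x y \<longleftrightarrow> rel A l (?g x) (?g y))"
    if "x \<in> universe B" "y \<in> universe B" for x y
    using assms g[OF that(1)] g[OF that(2)] unfolding isomorphism_def embedding_def by metis
  then show ?thesis using bij unfolding isomorphism_def embedding_def bij_betw_def by auto
qed

lemma embedding_comp:
  assumes "embedding k f A B" "embedding k g B C"
  shows "embedding k (g \<circ> f) A C"
  using assms unfolding embedding_def by (auto simp: image_subset_iff inj_on_def)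

lemma induced_simps [simp]:
  "universe (induced A X) = X" "ordr (induced A X) = ordr A" "rel (induced A X) = rel A"
  "induced (induced A X) Y = induced A Y"
  by (simp_all add: induced_def)

lemma embedding_restrict:
  assumes f: "embedding k f A B" and X: "X \<subseteq> universe A"
  shows "embedding k f (induced A X) (induced B (f ` X))"
proof -
  have "inj_on f X" using f X unfolding embedding_def by (metis inj_on_subset)
  moreover have "(ordr A x y \<longleftrightarrow> ordr B (f x) (f y)) \<and> (\<forall>l<k. rel A l x y \<longleftrightarrow> rel B l (f x) (f y))"
    if "x \<in> X" "y \<in> X" for x y
    using f X that unfolding embedding_def by (meson subsetD)
  ultimately show ?thesis unfolding embedding_def by simp
qed

section \<open>Letters\<close>

locale ramsey_limit =
  fixes k :: nat and K :: "nat struct set" and M :: "nat struct"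
  assumes fraisse: "fraisse_class k K" and diagonal: "trivial_diagonal k K"
    and ramsey: "ramsey_property k K" and limit: "fraisse_limit k K M"
begin

abbreviation lt :: "nat \<Rightarrow> nat \<Rightarrow> bool" where "lt \<equiv> ordr M"

lemma universe_M [simp]: "universe M = UNIV"
  using limit by (simp add: fraisse_limit_def)

lemma K_iff: "A \<in> K \<longleftrightarrow> finite (universe A) \<and> embeds k A M"
  using limit unfolding fraisse_limit_def by blast

lemma induced_in_K: "finite X \<Longrightarrow> induced M X \<in> K"
  by (auto simp: K_iff embeds_def embedding_def intro!: exI[of _ id])

lemma K_ordered: "A \<in> K \<Longrightarrow> ordered A"
  using fraisse by (simp add: fraisse_class_def)

lemma ordered_triple: "ordered (induced M {x, y, z})"
  by (intro K_ordered induced_in_K) simp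

lemma lt_irrefl [simp]: "\<not> lt x x"
  using ordered_triple[of x x x] by (simp add: ordered_def irreflp_on_def)

lemma lt_trans: "lt x y \<Longrightarrow> lt y z \<Longrightarrow> lt x z"
  using ordered_triple[of x y z] unfolding ordered_def transp_on_def induced_simps by blast

lemma lt_total: "x \<noteq> y \<Longrightarrow> lt x y \<or> lt y x"
  using ordered_triple[of x y y] unfolding ordered_def totalp_on_def induced_simps by blast

lemma lt_asym: "lt x y \<Longrightarrow> \<not> lt y x"
  using lt_trans lt_irrefl by blast

text \<open>The form in which the hypothesis on the diagonal is used: loops do not distinguish
  elements, so \<open>iso_letters\<close> may ignore equal indices.\<close>

lemma rel_diagonal: "l < k \<Longrightarrow> rel M l x x \<longleftrightarrow> rel M l y y"
  using diagonal induced_in_K[of "{x}"] induced_in_K[of "{y}"]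
  unfolding trivial_diagonal_def by fastforce

definition iso_letters :: "nat list \<Rightarrow> nat list \<Rightarrow> bool" where
  "iso_letters e e' \<longleftrightarrow> length e = length e' \<and>
     (\<forall>i<length e. \<forall>j<length e. i \<noteq> j \<longrightarrow> (lt (e ! i) (e ! j) \<longleftrightarrow> lt (e' ! i) (e' ! j)) \<and>
        (\<forall>l<k. rel M l (e ! i) (e ! j) \<longleftrightarrow> rel M l (e' ! i) (e' ! j)))"

abbreviation partial_embedding :: "nat \<Rightarrow> (nat \<Rightarrow> nat) \<Rightarrow> bool" where
  "partial_embedding j \<eta> \<equiv> embedding k \<eta> (induced M {..<j}) M"

lemma sorted_lt_distinct: "sorted_wrt lt e \<Longrightarrow> distinct e"
  by (auto simp: sorted_wrt_iff_nth_less distinct_conv_nth) (metis linorder_neqE_nat lt_irrefl)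

lemma iso_letters_sorted:
  assumes "sorted_wrt lt e" "iso_letters e e'"
  shows "sorted_wrt lt e'"
  using assms unfolding sorted_wrt_iff_nth_less iso_letters_def by (metis less_imp_neq less_trans)

lemma iso_letters_map:
  assumes "embedding k f A B" "set e \<subseteq> universe A"
  shows "\<And>i j l. i < length e \<Longrightarrow> j < length e \<Longrightarrow> l < k \<Longrightarrow> rel A l (e ! i) (e ! j) \<longleftrightarrow> rel B l (f (e ! i)) (f (e ! j))"
    and "\<And>i j. i < length e \<Longrightarrow> j < length e \<Longrightarrow> ordr A (e ! i) (e ! j) \<longleftrightarrow> ordr B (f (e ! i)) (f (e ! j))"
  using assms unfolding embedding_def by (meson nth_mem subsetD)+

lemma iso_letters_embedding:
  assumes "sorted_wrt lt e" "iso_letters e e'"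
  obtains f where "embedding k f (induced M (set e)) (induced M (set e'))" "map f e = e'"
proof -
  have d: "distinct e" "distinct e'" and len: "length e = length e'"
    using sorted_lt_distinct iso_letters_sorted assms by (auto simp: iso_letters_def)
  define f where "f x = the (map_of (zip e e') x)" for x
  have f: "f (e ! i) = e' ! i" if "i < length e" for i
    unfolding f_def using map_of_zip_nth[OF len d(1)] that len by simp
  have 1: "map f e = e'" using f len by (simp add: list_eq_iff_nth_eq)
  have "inj_on f (set e)" using d(2) 1 by (metis distinct_map)
  moreover have "(lt x y \<longleftrightarrow> lt (f x) (f y)) \<and> (\<forall>l<k. rel M l x y \<longleftrightarrow> rel M l (f x) (f y))"
    if xy: "x \<in> set e" "y \<in> set e" for x y
  proof (cases "x = y")
    case False
    obtain i j where "i < length e" "j < length e" "x = e ! i" "y = e ! j"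
      using xy by (metis in_set_conv_nth)
    then show ?thesis using False assms(2) f unfolding iso_letters_def by metis
  qed (use rel_diagonal in auto)
  ultimately have "embedding k f (induced M (set e)) (induced M (set e'))"
    using 1 unfolding embedding_def by (auto simp: set_map[symmetric] simp del: set_map)
  then show ?thesis using that 1 by blast
qed

text \<open>Induction on the number of conditions. For a new pair the Ramsey property gives a
  structure \<open>D\<close>, which is embedded into an initial segment of \<open>M\<close> where
  \<open>\<eta>'\<close> already satisfies the other conditions. A homogeneous copy of
  \<open>B\<close> inside \<open>D\<close> yields \<open>\<eta>\<close>.\<close>

lemma Ramsey_letters:
  fixes C :: "((nat list \<Rightarrow> bool) \<times> nat list) set"
  assumes "finite C" "\<And>P e. (P, e) \<in> C \<Longrightarrow> sorted_wrt lt e"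
  shows "\<exists>\<eta>. partial_embedding j \<eta> \<and> (\<forall>(P, e)\<in>C. \<exists>b. \<forall>e'. iso_letters e e' \<and> set e' \<subseteq> {..<j} \<longrightarrow>
    P (map \<eta> e') = b)"
  using assms
proof (induction C arbitrary: j)
  case empty
  show ?case by (intro exI[of _ id]) (simp add: embedding_def)
next
  case (insert c C)
  obtain P e where c: "c = (P, e)" by fastforce
  have e: "sorted_wrt lt e" using insert.prems c by blast
  define A where "A = induced M (set e)"
  define B where "B = induced M {..<j}"
  have "A \<in> K" "B \<in> K" unfolding A_def B_def by (simp_all add: induced_in_K)
  then obtain D where D: "D \<in> K" "\<And>col. col \<in> copies k D A \<rightarrow> {..<2::nat} \<Longrightarrow>
      \<exists>Y\<in>copies k D B. col constant_on copies k (induced D Y) A"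
    using ramsey unfolding ramsey_property_def by meson
  obtain g where g: "embedding k g D M" using D(1) by (auto simp: K_iff embeds_def)
  have finD: "finite (universe D)" using D(1) by (simp add: K_iff)
  \<comment> \<open>The induction hypothesis is needed for an initial segment that contains the copy
    of \<open>D\<close>, not for \<open>j\<close>.\<close>
  define j' where "j' = Suc (Max (insert 0 (g ` universe D)))"
  have gj: "g x < j'" if "x \<in> universe D" for x
    unfolding j'_def using finD that by (intro le_imp_less_Suc Max_ge) auto
  have "\<exists>\<eta>. partial_embedding j' \<eta> \<and> (\<forall>(P, e)\<in>C. \<exists>b. \<forall>e'. iso_letters e e' \<and> set e' \<subseteq> {..<j'} \<longrightarrow>
    P (map \<eta> e') = b)" by (rule insert.IH) (use insert.prems in blast)
  then obtain \<eta>' where \<eta>': "partial_embedding j' \<eta>'" "\<forall>(P, e)\<in>C. \<exists>b. \<forall>e'. iso_letters e e' \<and>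
     set e' \<subseteq> {..<j'} \<longrightarrow> P (map \<eta>' e') = b" by (elim exE conjE)
  \<comment> \<open>A copy of \<open>A\<close> is coloured through an arbitrarily chosen
    isomorphism. By rigidity the choice is immaterial, which \<open>sorted_wrt_unique\<close>
    confirms below.\<close>
  define iso where "iso X = (SOME f. isomorphism k f A (induced D X))" for X
  define col where "col X = (if P (map (\<eta>' \<circ> g \<circ> iso X) e) then 1 else 0 :: nat)" for X
  obtain Y where Y: "Y \<in> copies k D B" "col constant_on copies k (induced D Y) A"
    using D(2)[of col] by (auto simp: col_def)
  have YD: "Y \<subseteq> universe D" using Y(1) by (simp add: copies_def)
  obtain h0 where "isomorphism k h0 (induced D Y) B" using Y(1) by (auto simp: copies_def isomorphic_def)
  from isomorphism_inv[OF this] obtain h where h: "isomorphism k h B (induced D Y)" by blast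
  have hD: "embedding k h B D" "h ` {..<j} = Y"
    using h YD by (auto simp: isomorphism_def embedding_def B_def)
  have gh: "embedding k (g \<circ> h) B M" by (rule embedding_comp[OF hD(1) g])
  have ghj: "(g \<circ> h) ` {..<j} \<subseteq> {..<j'}" using gj hD(2) YD by auto
  define \<eta> where "\<eta> = \<eta>' \<circ> (g \<circ> h)"
  have emb: "partial_embedding j \<eta>"
  proof -
    have "embedding k (g \<circ> h) B (induced M {..<j'})"
      using gh ghj unfolding embedding_def by (simp add: B_def)
    from embedding_comp[OF this \<eta>'(1)] show ?thesis by (simp add: \<eta>_def B_def)
  qed
  have old: "\<exists>b. \<forall>e'. iso_letters e1 e' \<and> set e' \<subseteq> {..<j} \<longrightarrow> Q (map \<eta> e') = b" if Q: "(Q, e1) \<in> C" for Q e1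
  proof -
    obtain b where b: "\<And>e'. iso_letters e1 e' \<Longrightarrow> set e' \<subseteq> {..<j'} \<Longrightarrow> Q (map \<eta>' e') = b"
      using bspec[OF \<eta>'(2) Q] by auto
    have "Q (map \<eta> e') = b" if e': "iso_letters e1 e'" "set e' \<subseteq> {..<j}" for e'
    proof -
      have "iso_letters e1 (map (g \<circ> h) e')"
        using e' iso_letters_map[OF gh, of e'] by (simp add: iso_letters_def B_def)
      moreover have "set (map (g \<circ> h) e') \<subseteq> {..<j'}" using ghj e'(2) by auto
      ultimately have "Q (map \<eta>' (map (g \<circ> h) e')) = b" by (rule b)
      then show ?thesis unfolding \<eta>_def map_map .
    qed
    then show ?thesis by (intro exI[of _ b] allI impI) (elim conjE)
  qed
  have new: "\<exists>b. \<forall>e'. iso_letters e e' \<and> set e' \<subseteq> {..<j} \<longrightarrow> P (map \<eta> e') = b"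
  proof -
    obtain d where d: "\<And>X. X \<in> copies k (induced D Y) A \<Longrightarrow> col X = d"
      using Y(2) by (auto simp: constant_on_def)
    have "P (map \<eta> e') \<longleftrightarrow> d = 1" if e': "iso_letters e e'" "set e' \<subseteq> {..<j}" for e'
    proof -
      obtain f where f: "embedding k f (induced M (set e)) (induced M (set e'))" "map f e = e'"
        using iso_letters_embedding[OF e e'(1)] by blast
      define X where "X = h ` set e'"
      have "embedding k h (induced M (set e')) (induced D X)"
        using embedding_restrict[OF hD(1), of "set e'"] e'(2) by (simp add: X_def B_def)
      from embedding_comp[OF f(1) this] have "embedding k (h \<circ> f) A (induced D X)" by (simp add: A_def)
      moreover have "(h \<circ> f) ` universe A = X"
        using f(2) by (auto simp: A_def X_def)
      ultimately have iso1: "isomorphism k (h \<circ> f) A (induced D X)" by (simp add: isomorphism_def)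
      then have iso2: "isomorphism k (iso X) A (induced D X)" unfolding iso_def
        by (rule someI[of "\<lambda>f. isomorphism k f A (induced D X)"])
      have "X \<subseteq> Y" using hD(2) e'(2) by (auto simp: X_def)
      then have "X \<in> copies k (induced D Y) A"
        using isomorphism_inv[OF iso1] by (auto simp: copies_def isomorphic_def)
      then have colX: "col X = d" by (rule d)
      have srt: "sorted_wrt (ordr D) (map f' e)" "set (map f' e) = X"
        if "isomorphism k f' A (induced D X)" for f'
      proof -
        have "embedding k f' A (induced D X)" "f' ` universe A = X"
          using that by (auto simp: isomorphism_def)
        from iso_letters_map(2)[OF this(1), of e] this(2) e
        show "sorted_wrt (ordr D) (map f' e)" "set (map f' e) = X"
          by (auto simp: A_def sorted_wrt_iff_nth_less)
      qed
      have "map (h \<circ> f) e = map (iso X) e"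
      proof (rule sorted_wrt_unique[OF srt(1)[OF iso1] srt(1)[OF iso2]])
        show "set (map (h \<circ> f) e) = set (map (iso X) e)" using srt(2) iso1 iso2 by blast
        fix a b assume "a \<in> set (map (h \<circ> f) e)" "b \<in> set (map (h \<circ> f) e)" "ordr D a b"
        then have ab: "a \<in> universe D" "b \<in> universe D" "ordr D a b"
          using srt(2)[OF iso1] \<open>X \<subseteq> Y\<close> YD by blast+
        from K_ordered[OF D(1)] show "\<not> ordr D b a"
          using ab unfolding ordered_def irreflp_on_def transp_on_def by blast
      qed
      then have "map (\<eta>' \<circ> g) (map (h \<circ> f) e) = map (\<eta>' \<circ> g) (map (iso X) e)" by simp
      then have "map \<eta> e' = map (\<eta>' \<circ> g \<circ> iso X) e"
        using f(2) by (auto simp: \<eta>_def comp_def)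
      then show ?thesis using colX by (simp add: col_def split: if_splits)
    qed
    then show ?thesis by (intro exI[of _ "d = 1"] allI impI) (elim conjE)
  qed
  have "\<forall>(P, e)\<in>insert c C. \<exists>b. \<forall>e'. iso_letters e e' \<and> set e' \<subseteq> {..<j} \<longrightarrow> P (map \<eta> e') = b"
  proof
    fix x assume x: "x \<in> insert c C"
    obtain Q e1 where Q: "x = (Q, e1)" by fastforce
    have "\<exists>b. \<forall>e'. iso_letters e1 e' \<and> set e' \<subseteq> {..<j} \<longrightarrow> Q (map \<eta> e') = b"
      using x new old[of Q e1] unfolding c Q by (elim insertE) simp_all
    then show "case x of (P, e) \<Rightarrow> \<exists>b. \<forall>e'. iso_letters e e' \<and> set e' \<subseteq> {..<j} \<longrightarrow> P (map \<eta> e') = b"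
      unfolding Q by simp
  qed
  then show ?case using emb by (intro exI[of _ \<eta>] conjI)
qed

lemma partial_embedding_mono: "partial_embedding j \<eta> \<Longrightarrow> i \<le> j \<Longrightarrow> partial_embedding i \<eta>"
  unfolding embedding_def by (auto simp: inj_on_def)

text \<open>Finitely many equations mention letters below some \<open>j\<close>, and there one map
  from \<open>Ramsey_letters\<close> satisfies them all.\<close>

theorem letter_ultrafilter:
  obtains W :: "((nat \<Rightarrow> nat) \<Rightarrow> bool) \<Rightarrow> bool" where "ultra W" "\<And>j. W (partial_embedding j)"
    "\<And>P e e'. sorted_wrt lt e \<Longrightarrow> iso_letters e e' \<Longrightarrow> W (\<lambda>\<eta>. P (map \<eta> e)) = W (\<lambda>\<eta>. P (map \<eta> e'))"
proof -
  let ?f = "\<lambda>(P, e, e'). (\<lambda>\<eta> :: nat \<Rightarrow> nat. P (map \<eta> e), \<lambda>\<eta> :: nat \<Rightarrow> nat. P (map \<eta> e'))"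
  let ?g = "\<lambda>j. (partial_embedding j, \<lambda>_ :: nat \<Rightarrow> nat. True)"
  define S :: "((nat list \<Rightarrow> bool) \<times> nat list \<times> nat list) set"
    where "S = {(P, e, e'). sorted_wrt lt e \<and> iso_letters e e'}"
  have "\<exists>W. ultra W \<and> (\<forall>(P, Q)\<in>?f ` S \<union> range ?g. W P = W Q)"
  proof (rule ultra_compactness_points)
    fix E0 assume E0: "finite E0" "E0 \<subseteq> ?f ` S \<union> range ?g"
    have "\<exists>C\<subseteq>S. finite C \<and> E0 \<inter> ?f ` S = ?f ` C"
      by (rule finite_subset_image) (use E0(1) in auto)
    then obtain C where C: "C \<subseteq> S" "finite C" "E0 \<inter> ?f ` S = ?f ` C" by (elim exE conjE)
    have "\<exists>J\<subseteq>UNIV. finite J \<and> E0 \<inter> range ?g = ?g ` J"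
      by (rule finite_subset_image) (use E0(1) in auto)
    then obtain J where J: "finite J" "E0 \<inter> range ?g = ?g ` J" by (elim exE conjE)
    define L where "L = insert 0 (J \<union> (\<Union>(P, e, e')\<in>C. set e \<union> set e'))"
    define j where "j = Suc (Max L)"
    have "finite L" unfolding L_def using C(2) J(1) by auto
    then have L: "x < j" if "x \<in> L" for x unfolding j_def using that by (intro le_imp_less_Suc Max_ge)
    have "\<exists>\<eta>. partial_embedding j \<eta> \<and> (\<forall>(P, e)\<in>(\<lambda>(P, e, e'). (P, e)) ` C. \<exists>b. \<forall>e'. iso_letters e e' \<and>
        set e' \<subseteq> {..<j} \<longrightarrow> P (map \<eta> e') = b)"
      by (rule Ramsey_letters) (use C(1,2) in \<open>auto simp: S_def\<close>)
    then obtain \<eta> where \<eta>: "partial_embedding j \<eta>" "\<forall>(P, e)\<in>(\<lambda>(P, e, e'). (P, e)) ` C. \<exists>b. \<forall>e'.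
        iso_letters e e' \<and> set e' \<subseteq> {..<j} \<longrightarrow> P (map \<eta> e') = b" by (elim exE conjE)
    have 1: "fst a \<eta> = snd a \<eta>" if a: "a \<in> E0" "a \<in> ?f ` S" for a
    proof -
      have "a \<in> ?f ` C" using a C(3) by blast
      then obtain c where "c \<in> C" "a = ?f c" by (elim imageE)
      then obtain P e e' where Pe: "(P, e, e') \<in> C" "a = ?f (P, e, e')" by (cases c) simp
      obtain b where b: "\<And>e'. iso_letters e e' \<Longrightarrow> set e' \<subseteq> {..<j} \<Longrightarrow> P (map \<eta> e') = b"
        using \<eta>(2) Pe(1) by force
      have "e \<in> {e. set e \<subseteq> {..<j}}" "e' \<in> {e. set e \<subseteq> {..<j}}"
        using Pe(1) L unfolding L_def by fastforce+
      moreover have "iso_letters e e" "iso_letters e e'"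
        using C(1) Pe(1) by (auto simp: iso_letters_def S_def)
      ultimately show ?thesis using b[of e] b[of e'] Pe(2) by simp
    qed
    have 2: "fst a \<eta> = snd a \<eta>" if a: "a \<in> E0" "a \<in> range ?g" for a
    proof -
      obtain i where i: "i \<in> J" "a = ?g i" using a J(2) by blast
      then have "i < j" by (intro L) (simp add: L_def)
      then show ?thesis using i(2) partial_embedding_mono[OF \<eta>(1)] by simp
    qed
    show "\<exists>x. \<forall>e\<in>E0. fst e x = snd e x" using 1 2 E0(2) by (intro exI[of _ \<eta>]) blast
  qed
  then obtain W where W: "ultra W" "\<forall>(P, Q)\<in>?f ` S \<union> range ?g. W P = W Q" by (elim exE conjE)
  have W2: "W (fst a) = W (snd a)" if "a \<in> ?f ` S \<union> range ?g" for a
    using bspec[OF W(2) that] by (simp add: case_prod_beta)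
  show ?thesis
  proof (rule that[OF W(1)])
    fix j show "W (partial_embedding j)"
    proof -
      have "W (fst (?g j)) = W (snd (?g j))" by (rule W2) blast
      then show ?thesis using ultra_True[OF W(1)] by simp
    qed
  next
    fix P e e' assume "sorted_wrt lt e" "iso_letters e e'"
    then have "(P, e, e') \<in> S" by (simp add: S_def)
    from W2[OF UnI1[OF imageI[OF this]]] show "W (\<lambda>\<eta>. P (map \<eta> e)) = W (\<lambda>\<eta>. P (map \<eta> e'))" by simp
  qed
qed

end

section \<open>Shapes\<close>

lemma exists_sorted_list:
  assumes "\<And>x y z. R x y \<Longrightarrow> R y z \<Longrightarrow> R x z" "finite X" "\<And>x y. x \<in> X \<Longrightarrow> y \<in> X \<Longrightarrow> x \<noteq> y \<Longrightarrow> R x y \<or> R y x"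
  shows "\<exists>xs. sorted_wrt R xs \<and> set xs = X"
  using assms(2,3)
proof (induction rule: finite_induct)
  case (insert x X)
  then obtain xs where xs: "sorted_wrt R xs" "set xs = X" by blast
  let ?ys = "filter (\<lambda>y. R y x) xs @ [x] @ filter (\<lambda>y. R x y) xs"
  have "sorted_wrt R ?ys"
    using xs(1) by (auto simp: sorted_wrt_append sorted_wrt_filter intro: assms(1))
  moreover have "set ?ys = insert x X" using xs(2) insert.hyps(2) insert.prems by auto
  ultimately show ?case by blast
qed simp

text \<open>Forces a word into \<open>T_max\<close>, so that nodes can be extended by arbitrary letters.\<close>

definition clip :: "nat list \<Rightarrow> nat list" where
  "clip u = map (\<lambda>p. if u ! p \<le> p then u ! p else 0) [0..<length u]"

lemma length_clip [simp]: "length (clip u) = length u"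
  by (simp add: clip_def)

lemma nth_clip: "p < length u \<Longrightarrow> clip u ! p = (if u ! p \<le> p then u ! p else 0)"
  by (simp add: clip_def)

lemma clip_Nil [simp]: "clip [] = []"
  by (simp add: clip_def)

lemma clip_append_clip [simp]: "clip (clip u @ w) = clip (u @ w)"
  by (auto simp: list_eq_iff_nth_eq nth_clip nth_append)

lemma clip_idem [simp]: "clip (clip u) = clip u"
  using clip_append_clip[of u "[]"] by simp

lemma take_clip: "take l (clip u) = clip (take l u)"
  by (auto simp: list_eq_iff_nth_eq nth_clip)

lemma prefix_clip: "prefix (clip u) (clip (u @ w))"
  using take_is_prefix[of "length u" "clip (u @ w)"] by (simp add: take_clip)

lemma clip_snoc: "clip (u @ [a]) = clip u @ [if a \<le> length u then a else 0]"
  by (auto simp: list_eq_iff_nth_eq nth_clip nth_append)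

lemma T_max_iff: "u \<in> T_max \<longleftrightarrow> (\<forall>p<length u. u ! p \<le> p)"
proof
  show "u \<in> T_max \<Longrightarrow> \<forall>p<length u. u ! p \<le> p"
    by (induction rule: T_max.induct) (auto simp: nth_append less_Suc_eq)
  show "\<forall>p<length u. u ! p \<le> p \<Longrightarrow> u \<in> T_max"
  proof (induction u rule: rev_induct)
    case (snoc a u)
    have "u ! p \<le> p" if "p < length u" for p
      using snoc.prems[rule_format, of p] that by (simp add: nth_append)
    moreover have "a \<le> length u" using snoc.prems[rule_format, of "length u"] by simp
    ultimately show ?case using snoc.IH by (auto intro: T_max.intros)
  qed (rule T_max.intros)
qed

lemma clip_in_T_max [simp]: "clip u \<in> T_max"
  by (simp add: T_max_iff nth_clip)

lemma take_eq_mono: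
  assumes "take l a = take l b" "q \<le> l"
  shows "take q a = take q b"
proof -
  have "take q (take l a) = take q (take l b)" using assms(1) by simp
  then show ?thesis using assms(2) by (simp add: min_def)
qed

lemma take_eq_nth: "take l a = take l b \<Longrightarrow> i < l \<Longrightarrow> a ! i = b ! i"
  by (metis nth_take)

section \<open>Extending and splitting tuples of words\<close>

definition extend :: "(nat \<Rightarrow> nat list) \<Rightarrow> (nat \<Rightarrow> nat) list \<Rightarrow> nat \<Rightarrow> nat list" where
  "extend u w = (\<lambda>i. clip (u i @ map (\<lambda>f. f i) w))"

lemma extend_extend: "extend (extend u w) w' = extend u (w @ w')"
  by (simp add: extend_def)

lemma extend_comp: "extend (u \<circ> g) (wpull g w) = extend u w \<circ> g"
  by (simp add: extend_def wpull_def comp_def)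

definition wagree :: "nat \<Rightarrow> (nat \<Rightarrow> nat) list \<Rightarrow> (nat \<Rightarrow> nat) list \<Rightarrow> bool" where
  "wagree p v w \<longleftrightarrow> list_all2 (\<lambda>f g. \<forall>i<p. f i = g i) v w"

lemma wagree_extend: "wagree p v w \<Longrightarrow> i < p \<Longrightarrow> u i = u' i \<Longrightarrow> extend u v i = extend u' w i"
proof -
  assume "wagree p v w" "i < p" "u i = u' i"
  then have "map (\<lambda>f. f i) v = map (\<lambda>f. f i) w"
    by (auto simp: wagree_def list_all2_conv_all_nth list_eq_iff_nth_eq)
  then show ?thesis using \<open>u i = u' i\<close> by (simp add: extend_def)
qed

lemma vagree_fill:
  assumes "vagree p x y"
  shows "wagree p (fill a x) (fill a y)"
proof -
  have "\<forall>j<p. (case f of None \<Rightarrow> a | Some f \<Rightarrow> f) j = (case g of None \<Rightarrow> a | Some f \<Rightarrow> f) j"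
    if "rel_option (\<lambda>f g. \<forall>j<p. f j = g j) f g" for f g
    using that by (cases rule: option.rel_cases) auto
  then show ?thesis
    using assms unfolding vagree_def wagree_def fill_def list.rel_map by (elim list_all2_mono) blast
qed

text \<open>When coordinate \<open>b\<close> of a tuple is replaced by \<open>r\<close> new ones, \<open>old_index b r\<close> maps the new indices to
  the old ones, and \<open>new_index b r\<close> is a section of this map.\<close>

definition old_index :: "nat \<Rightarrow> nat \<Rightarrow> nat \<Rightarrow> nat" where
  "old_index b r i = (if i < b then i else if i < b + r then b else i - r + 1)"

definition new_index :: "nat \<Rightarrow> nat \<Rightarrow> nat \<Rightarrow> nat" where
  "new_index b r i = (if i \<le> b then i else i + r - 1)"

text \<open>Coordinates outside the block receive \<open>0\<close> at the variable, a letter that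
  clipping never alters.\<close>

definition label :: "nat \<Rightarrow> nat list \<Rightarrow> nat \<Rightarrow> nat" where
  "label b e i = (if b \<le> i \<and> i < b + length e then e ! (i - b) else 0)"

text \<open>The constant letters before the first variable reach all copies of coordinate
  \<open>b\<close> alike; at the first variable the copies receive the letters of \<open>e\<close>
  and, unless these are clipped, separate according to them.\<close>

definition split_coord :: "nat \<Rightarrow> nat list \<Rightarrow> (nat \<Rightarrow> nat list) \<Rightarrow> vword \<Rightarrow> nat \<Rightarrow> nat list" where
  "split_coord b e u x = extend (u \<circ> old_index b (length e)) (fill (label b e) (pull (old_index b (length e)) x))"

lemma old_index_mono: "1 \<le> r \<Longrightarrow> i \<le> j \<Longrightarrow> old_index b r i \<le> old_index b r j"
  by (auto simp: old_index_def)

lemma old_index_less: "b < p \<Longrightarrow> 1 \<le> r \<Longrightarrow> i < p + r - 1 \<Longrightarrow> old_index b r i < p"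
  by (auto simp: old_index_def)

lemma new_index_less: "b < p \<Longrightarrow> 1 \<le> r \<Longrightarrow> i < p \<Longrightarrow> new_index b r i < p + r - 1"
  by (auto simp: new_index_def)

lemma old_index_new_index: "1 \<le> r \<Longrightarrow> old_index b r (new_index b r i) = i"
  by (auto simp: old_index_def new_index_def)

lemma new_index_strict_mono: "1 \<le> r \<Longrightarrow> i < j \<Longrightarrow> new_index b r i < new_index b r j"
  by (auto simp: new_index_def)

lemma old_index_eq_iff: "1 \<le> r \<Longrightarrow> old_index b r i = b \<longleftrightarrow> b \<le> i \<and> i < b + r"
  by (auto simp: old_index_def)

lemma old_index_eqD: "1 \<le> r \<Longrightarrow> old_index b r i = old_index b r j \<Longrightarrow> i \<noteq> j \<Longrightarrow> old_index b r i = b"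
  by (auto simp: old_index_def split: if_splits)

lemma new_index_old_index: "1 \<le> r \<Longrightarrow> old_index b r i \<noteq> b \<Longrightarrow> new_index b r (old_index b r i) = i"
  by (auto simp: old_index_def new_index_def split: if_splits)

lemma vagree_pull_old_index:
  assumes "vagree p x y" "\<And>i. i < q \<Longrightarrow> g i < p"
  shows "vagree q (pull g x) (pull g y)"
  using assms by (auto simp: vagree_def pull_def list_all2_conv_all_nth option.rel_map
      elim!: option.rel_mono_strong)

lemma split_coord_cong:
  assumes "b < p" "1 \<le> length e" "vagree p x y" "\<And>i. i < p \<Longrightarrow> u i = u' i" "i < p + length e - 1"
  shows "split_coord b e u x i = split_coord b e u' y i"
  unfolding split_coord_def
proof (rule wagree_extend[OF vagree_fill[OF vagree_pull_old_index[OF assms(3)]] assms(5)])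
  show "old_index b (length e) i < p" if "i < p + length e - 1" for i
    using old_index_less[OF assms(1,2) that] .
  show "(u \<circ> old_index b (length e)) i = (u' \<circ> old_index b (length e)) i"
    using assms(4) old_index_less[OF assms(1,2,5)] by simp
qed

text \<open>Coordinates chosen after a splitting form an extension of old coordinates by a filled
  variable word. Hence a tuple without two of the new copies can be treated as if it had only been
  lengthened.\<close>

lemma split_coord_comp: "split_coord b e u x \<circ> h = extend (u \<circ> (old_index b (length e) \<circ> h)) (fill (label b e \<circ> h) (pull (old_index b (length e) \<circ> h) x))"
proof -
  have "fill (label b e \<circ> h) (pull (old_index b (length e) \<circ> h) x) = wpull h (fill (label b e) (pull (old_index b (length e)) x))"
    by (simp only: pull_pull[symmetric] fill_pull)
  then show ?thesis by (simp add: split_coord_def extend_comp[symmetric] comp_assoc)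
qed

lemma extend_fill_pull:
  "extend u (fill a (pull g x)) i = clip (u i @ map (\<lambda>f. case f of None \<Rightarrow> a i | Some f \<Rightarrow> f (g i)) x)"
  by (auto simp: extend_def fill_def pull_def split: option.split intro!: arg_cong[where f = clip])

text \<open>Identifies members of a tuple chosen from all nodes after a splitting with members of
  the splitting of a small tuple, for which an expected colour is known.\<close>

lemma split_coord_eqI:
  assumes "old_index l (length es) (h' i) = h (old_index b (length e) i)" "label l es (h' i) = label b e i"
  shows "split_coord l es u x (h' i) = split_coord b e (u \<circ> h) (pull h x) i"
  unfolding split_coord_def pull_pull extend_fill_pull using assms by simp

fun arity :: "(nat \<times> nat list) list \<Rightarrow> nat" where
  "arity [] = 1"
| "arity ((b, e) # s) = arity s + length e - 1"

context ramsey_limit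
begin

text \<open>A shape is the sequence of splittings through which a finite tuple of branches arises from
  the root, most recent first: coordinate \<open>b\<close> is replaced by new coordinates whose first
  letters are in the same position as the letters in \<open>e\<close>.\<close>

fun has_shape :: "(nat \<times> nat list) list \<Rightarrow> (nat \<Rightarrow> nat list) \<Rightarrow> bool" where
  "has_shape [] u \<longleftrightarrow> True"
| "has_shape ((b, e) # s) u \<longleftrightarrow> b < arity s \<and> 2 \<le> length e \<and> sorted_wrt lt e \<and>
     (\<exists>l. (\<forall>i<arity s + length e - 1. l < length (u i) \<and>
             take l (u i) = take l (u (new_index b (length e) (old_index b (length e) i)))) \<and>
          has_shape s (\<lambda>i. take l (u (new_index b (length e) i))) \<and>
          iso_letters e (map (\<lambda>i. u (b + i) ! l) [0..<length e]))"

lemma has_shape_cong: "(\<And>i. i < arity s \<Longrightarrow> u i = u' i) \<Longrightarrow> has_shape s u \<Longrightarrow> has_shape s u'"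
proof (induction s arbitrary: u u')
  case (Cons c s)
  obtain b e where c: "c = (b, e)" by fastforce
  from Cons.prems(2) obtain l where b: "b < arity s" "2 \<le> length e" "sorted_wrt lt e"
    and l: "\<And>i. i < arity s + length e - 1 \<Longrightarrow> l < length (u i) \<and>
             take l (u i) = take l (u (new_index b (length e) (old_index b (length e) i)))"
      "has_shape s (\<lambda>i. take l (u (new_index b (length e) i)))"
      "iso_letters e (map (\<lambda>i. u (b + i) ! l) [0..<length e])"
    unfolding c by auto
  have eq: "u i = u' i" if "i < arity s + length e - 1" for i using Cons.prems(1) that c by simp
  have new_index: "new_index b (length e) i < arity s + length e - 1" if "i < arity s" for i
    using b that by (intro new_index_less) auto
  have 1: "l < length (u' i) \<and> take l (u' i) = take l (u' (new_index b (length e) (old_index b (length e) i)))"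
    if i: "i < arity s + length e - 1" for i
  proof -
    have "old_index b (length e) i < arity s" using b i by (intro old_index_less) auto
    then show ?thesis using l(1)[OF i] eq[OF i] eq[OF new_index] by simp
  qed
  have 2: "has_shape s (\<lambda>i. take l (u' (new_index b (length e) i)))"
    by (rule Cons.IH[OF _ l(2)]) (simp add: eq[OF new_index])
  have "map (\<lambda>i. u (b + i) ! l) [0..<length e] = map (\<lambda>i. u' (b + i) ! l) [0..<length e]"
    using eq b by simp
  note l(3)[unfolded this]
  then show ?case
    using b 1 2 unfolding c has_shape.simps by (intro conjI exI[of _ l] allI impI) simp_all
qed simp

lemma has_shape_ConsD:
  assumes "has_shape ((b, e) # s) u"
  shows "b < arity s" "2 \<le> length e" "sorted_wrt lt e"
    "\<exists>l. (\<forall>i<arity s + length e - 1. l < length (u i)) \<and>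
      (\<forall>i<arity s + length e - 1. take l (u i) = take l (u (new_index b (length e) (old_index b (length e) i)))) \<and>
      has_shape s (\<lambda>i. take l (u (new_index b (length e) i))) \<and>
      iso_letters e (map (\<lambda>i. u (b + i) ! l) [0..<length e])"
  using assms unfolding has_shape.simps by blast+

lemma has_shape_ConsI:
  assumes "b < arity s" "2 \<le> length e" "sorted_wrt lt e"
    "\<And>i. i < arity s + length e - 1 \<Longrightarrow> l < length (u i)"
    "\<And>i. i < arity s + length e - 1 \<Longrightarrow> take l (u i) = take l (u (new_index b (length e) (old_index b (length e) i)))"
    "has_shape s (\<lambda>i. take l (u (new_index b (length e) i)))"
    "iso_letters e (map (\<lambda>i. u (b + i) ! l) [0..<length e])"
  shows "has_shape ((b, e) # s) u"
  using assms unfolding has_shape.simps by (intro conjI exI[of _ l] allI impI)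

lemma iso_letters_nth_neq:
  assumes "sorted_wrt lt e" "iso_letters e e'" "i < length e" "j < length e" "i \<noteq> j"
  shows "e' ! i \<noteq> e' ! j"
  using sorted_lt_distinct[OF iso_letters_sorted[OF assms(1,2)]] assms
  by (simp add: nth_eq_iff_index_eq iso_letters_def)

text \<open>Members of the last block differ at its splitting level, and any other two differ below
  it by induction.\<close>

lemma has_shape_distinct: "has_shape s u \<Longrightarrow> i < arity s \<Longrightarrow> j < arity s \<Longrightarrow> i \<noteq> j \<Longrightarrow> u i \<noteq> u j"
proof (induction s arbitrary: u i j)
  case (Cons c s)
  obtain b e where c: "c = (b, e)" by fastforce
  let ?r = "length e"
  note D = has_shape_ConsD[OF Cons.prems(1)[unfolded c]]
  obtain l where "\<forall>i<arity s + ?r - 1. l < length (u i)"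
    "\<forall>i<arity s + ?r - 1. take l (u i) = take l (u (new_index b ?r (old_index b ?r i)))"
    "has_shape s (\<lambda>i. take l (u (new_index b ?r i)))" "iso_letters e (map (\<lambda>i. u (b + i) ! l) [0..<?r])"
    using D(4) by (elim exE conjE)
  then have l: "b < arity s" "2 \<le> ?r" "sorted_wrt lt e"
    "\<And>i. i < arity s + ?r - 1 \<Longrightarrow> l < length (u i)"
    "\<And>i. i < arity s + ?r - 1 \<Longrightarrow> take l (u i) = take l (u (new_index b ?r (old_index b ?r i)))"
    "has_shape s (\<lambda>i. take l (u (new_index b ?r i)))"
    "iso_letters e (map (\<lambda>i. u (b + i) ! l) [0..<?r])"
    using D(1-3) by blast+
  have ij: "i < arity s + ?r - 1" "j < arity s + ?r - 1" using Cons.prems(2,3) c by auto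
  have r: "1 \<le> ?r" using l(2) by simp
  show ?case
  proof (cases "old_index b ?r i = old_index b ?r j")
    case False
    from Cons.IH[OF l(6) old_index_less[OF l(1) r ij(1)] old_index_less[OF l(1) r ij(2)] False]
    show ?thesis using l(5)[OF ij(1)] l(5)[OF ij(2)] by metis
  next
    case True
    then have "old_index b ?r i = b" "old_index b ?r j = b" using old_index_eqD[OF r True Cons.prems(4)] by auto
    then have bl: "b \<le> i" "i < b + ?r" "b \<le> j" "j < b + ?r" by (simp_all add: old_index_eq_iff[OF r])
    have "u (b + (i - b)) ! l \<noteq> u (b + (j - b)) ! l"
      using iso_letters_nth_neq[OF l(3,7), of "i - b" "j - b"] bl Cons.prems(4) by simp
    then show ?thesis using bl by auto
  qed
qed simp

text \<open>The last splitting separates the coordinates \<open>b\<close> and \<open>Suc b\<close>.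
  If these are distinct already up to \<open>q\<close>, then its level, and with it the whole shape,
  lies below \<open>q\<close>.\<close>

lemma has_shape_take:
  assumes "has_shape s u" "\<And>i j. i < arity s \<Longrightarrow> j < arity s \<Longrightarrow> i \<noteq> j \<Longrightarrow> take q (u i) \<noteq> take q (u j)"
  shows "has_shape s (\<lambda>i. take q (u i))"
proof (cases s)
  case (Cons c t)
  obtain b e where c: "c = (b, e)" by fastforce
  let ?r = "length e"
  note D = has_shape_ConsD[OF assms(1)[unfolded Cons c]]
  obtain l where "\<forall>i<arity t + ?r - 1. l < length (u i)"
    "\<forall>i<arity t + ?r - 1. take l (u i) = take l (u (new_index b ?r (old_index b ?r i)))"
    "has_shape t (\<lambda>i. take l (u (new_index b ?r i)))" "iso_letters e (map (\<lambda>i. u (b + i) ! l) [0..<?r])"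
    using D(4) by (elim exE conjE)
  then have l: "b < arity t" "2 \<le> ?r" "sorted_wrt lt e"
    "\<And>i. i < arity t + ?r - 1 \<Longrightarrow> l < length (u i)"
    "\<And>i. i < arity t + ?r - 1 \<Longrightarrow> take l (u i) = take l (u (new_index b ?r (old_index b ?r i)))"
    "has_shape t (\<lambda>i. take l (u (new_index b ?r i)))"
    "iso_letters e (map (\<lambda>i. u (b + i) ! l) [0..<?r])"
    using D(1-3) by blast+
  have bb: "b < arity t + ?r - 1" "Suc b < arity t + ?r - 1" using l(1,2) by auto
  have "old_index b ?r b = b" "old_index b ?r (Suc b) = b" using l(2) by (auto simp: old_index_def)
  then have "take l (u b) = take l (u (Suc b))" using l(5)[OF bb(1)] l(5)[OF bb(2)] by simp
  moreover have "take q (u b) \<noteq> take q (u (Suc b))" using assms(2)[of b "Suc b"] bb Cons c by simp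
  ultimately have lq: "l < q" using take_eq_mono[of l _ _ q] linorder_not_less by blast
  have "map (\<lambda>i. take q (u (b + i)) ! l) [0..<?r] = map (\<lambda>i. u (b + i) ! l) [0..<?r]"
    using lq by simp
  then show ?thesis
    unfolding Cons c using l lq by (intro has_shape_ConsI[where l = l]) (simp_all add: min_def del: One_nat_def)
qed simp

lemma exists_sorted_lt: "finite X \<Longrightarrow> \<exists>xs. sorted_wrt lt xs \<and> set xs = X"
  using lt_trans lt_total by (intro exists_sorted_list) blast+

definition sorted_letters :: "nat \<Rightarrow> nat list" where
  "sorted_letters j = (SOME xs. sorted_wrt lt xs \<and> set xs = {..<j})"

lemma sorted_letters: "sorted_wrt lt (sorted_letters j)" "set (sorted_letters j) = {..<j}"
  using someI_ex[OF exists_sorted_lt[of "{..<j}"]] by (auto simp: sorted_letters_def)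

lemma length_sorted_letters [simp]: "length (sorted_letters j) = j"
  using distinct_card[OF sorted_lt_distinct[OF sorted_letters(1)[of j]]] sorted_letters(2)[of j] by simp

text \<open>The new tuples of a given shape after a splitting come from old tuples of the shape with the
  last splitting removed.\<close>

lemma new_tuple:
  assumes U: "\<And>i. i < N \<Longrightarrow> length (U i) = q" "\<And>i j. i < N \<Longrightarrow> j < N \<Longrightarrow> i \<noteq> j \<Longrightarrow> U i \<noteq> U j"
    and m: "m < N" "1 \<le> j"
    and pre: "\<And>i. i < N + j - 1 \<Longrightarrow> prefix (U (old_index m j i)) (U' i)"
    and v: "prefix (U m) v" "\<And>i. m \<le> i \<Longrightarrow> i < m + j \<Longrightarrow> prefix (v @ [es ! (i - m)]) (U' i)"
    and es: "es = map \<eta> (sorted_letters j)" "partial_embedding j \<eta>"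
    and h': "strict_mono_on {..<arity ((b, e) # s)} h'" "h' ` {..<arity ((b, e) # s)} \<subseteq> {..<N + j - 1}"
    and sh: "has_shape ((b, e) # s) (U' \<circ> h')"
    and ninj: "\<not> inj_on (old_index m j \<circ> h') {..<arity ((b, e) # s)}"
  obtains h e'' where "strict_mono_on {..<arity s} h" "h ` {..<arity s} \<subseteq> {..<N}" "has_shape s (U \<circ> h)"
    "set e'' \<subseteq> {..<j}" "iso_letters e e''"
    "\<And>i. i < arity ((b, e) # s) \<Longrightarrow> old_index m j (h' i) = h (old_index b (length e) i)"
    "\<And>i. i < arity ((b, e) # s) \<Longrightarrow> label m es (h' i) = label b (map \<eta> e'') i"
proof -
  let ?r = "length e" and ?p = "arity ((b, e) # s)" and ?\<pi> = "old_index m j"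
  define u where "u = U' \<circ> h'"
  note D = has_shape_ConsD[OF sh[folded u_def]]
  obtain l where "\<forall>i<arity s + ?r - 1. l < length (u i)"
    "\<forall>i<arity s + ?r - 1. take l (u i) = take l (u (new_index b ?r (old_index b ?r i)))"
    "has_shape s (\<lambda>i. take l (u (new_index b ?r i)))" "iso_letters e (map (\<lambda>i. u (b + i) ! l) [0..<?r])"
    using D(4) by (elim exE conjE)
  then have l: "b < arity s" "2 \<le> ?r" "sorted_wrt lt e"
    "\<And>i. i < arity s + ?r - 1 \<Longrightarrow> l < length (u i)"
    "\<And>i. i < arity s + ?r - 1 \<Longrightarrow> take l (u i) = take l (u (new_index b ?r (old_index b ?r i)))"
    "has_shape s (\<lambda>i. take l (u (new_index b ?r i)))"
    "iso_letters e (map (\<lambda>i. u (b + i) ! l) [0..<?r])"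
    using D(1-3) by blast+
  have r: "1 \<le> ?r" using l(2) by simp
  have p: "?p = arity s + ?r - 1" by simp
  have es_len: "length es = j" by (simp add: es)
  have hN: "h' i < N + j - 1" if "i < ?p" for i using h'(2) that by auto
  have \<pi>N: "?\<pi> (h' i) < N" if "i < ?p" for i using old_index_less[OF m hN[OF that]] .
  have tq: "take q (u i) = U (?\<pi> (h' i))" if "i < ?p" for i
    using pre[OF hN[OF that]] U(1)[OF \<pi>N[OF that]] by (auto simp: u_def prefix_def)
  have qv: "q \<le> length v" using prefix_length_le[OF v(1)] U(1)[OF m(1)] by simp
  have blk: "take (length v) (u i) = v \<and> u i ! length v = es ! (h' i - m) \<and> length v < length (u i)"
    if "?\<pi> (h' i) = m" for i
    using v(2)[of "h' i"] that old_index_eq_iff[OF m(2), of m "h' i"] by (auto simp: u_def prefix_def nth_append)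
  \<comment> \<open>Members that come from different old nodes are distinct already at level
    \<open>q\<close>.\<close>
  have far: "take (length v) (u i) \<noteq> take (length v) (u i')"
    if "i < ?p" "i' < ?p" "?\<pi> (h' i) \<noteq> ?\<pi> (h' i')" for i i'
  proof
    assume "take (length v) (u i) = take (length v) (u i')"
    then have "take q (u i) = take q (u i')" using qv by (rule take_eq_mono)
    then show False using tq that U(2)[OF \<pi>N[OF that(1)] \<pi>N[OF that(2)]] by simp
  qed
  \<comment> \<open>Two members that were a single node before the splitting; this node must be
    \<open>U m\<close>.\<close>
  obtain i0 i1 where i01: "i0 < ?p" "i1 < ?p" "i0 \<noteq> i1" "?\<pi> (h' i0) = ?\<pi> (h' i1)"
    using ninj by (auto simp: inj_on_def)
  have inj_h': "h' i \<noteq> h' i'" if "i < ?p" "i' < ?p" "i \<noteq> i'" for i i'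
    using strict_mono_on_imp_inj_on[OF h'(1)] that by (auto simp: inj_on_def)
  have m01: "?\<pi> (h' i0) = m" "?\<pi> (h' i1) = m"
    using old_index_eqD[OF m(2) i01(4) inj_h'[OF i01(1-3)]] i01(4) by auto
  have pjl: "old_index b ?r i < arity s" if "i < ?p" for i using old_index_less[OF l(1) r] that p by simp
  have dist_l: "take l (u i) \<noteq> take l (u i')" if "i < ?p" "i' < ?p" "old_index b ?r i \<noteq> old_index b ?r i'" for i i'
    using has_shape_distinct[OF l(6) pjl[OF that(1)] pjl[OF that(2)] that(3)] l(5)[of i] l(5)[of i'] that p
    by simp
  have bl: "u i ! l \<noteq> u i' ! l \<and> take l (u i) = take l (u i')"
    if "i < ?p" "i' < ?p" "i \<noteq> i'" "old_index b ?r i = b" "old_index b ?r i' = b" for i i'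
  proof -
    have bi: "b \<le> i" "i < b + ?r" "b \<le> i'" "i' < b + ?r" using that(4,5) by (simp_all add: old_index_eq_iff[OF r])
    have "u (b + (i - b)) ! l \<noteq> u (b + (i' - b)) ! l"
      using iso_letters_nth_neq[OF l(3,7), of "i - b" "i' - b"] bi that(3) by simp
    moreover have "take l (u i) = take l (u i')" using l(5)[of i] l(5)[of i'] that p by simp
    ultimately show ?thesis using bi by simp
  qed
  have same: "u i ! length v \<noteq> u i' ! length v" if "i < ?p" "i' < ?p" "i \<noteq> i'" "?\<pi> (h' i) = m" "?\<pi> (h' i') = m" for i i'
  proof -
    have "sorted_wrt lt es"
      using sorted_letters[of j] iso_letters_map(2)[OF es(2), of "sorted_letters j"]
      unfolding es(1) sorted_wrt_iff_nth_less by simp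
    then have "distinct es" by (rule sorted_lt_distinct)
    moreover have "m \<le> h' i" "h' i < m + j" "m \<le> h' i'" "h' i' < m + j"
      using that(4,5) by (simp_all add: old_index_eq_iff[OF m(2)])
    ultimately have "es ! (h' i - m) \<noteq> es ! (h' i' - m)"
      using inj_h'[OF that(1-3)] by (simp add: nth_eq_iff_index_eq es_len)
    then show ?thesis using blk that(4,5) by simp
  qed
  \<comment> \<open>The last splitting of the tuple is the splitting that has just been made. At a
    lower level \<open>i0\<close> and \<open>i1\<close> still agree; at a higher level the first two
    members of the last block would have been separated at \<open>length v\<close> already.\<close>
  have lv: "l = length v"
  proof (rule linorder_cases[of l "length v"])
    assume "l < length v"
    then have "take l (u i0) = take l (u i1)" "u i0 ! l = u i1 ! l"
      using blk[OF m01(1)] blk[OF m01(2)] take_eq_mono[of "length v" "u i0" "u i1" l]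
        take_eq_nth[of "length v" "u i0" "u i1" l] by simp_all
    then show ?thesis using dist_l[OF i01(1,2)] bl[OF i01(1-3)] old_index_eqD[OF r _ i01(3)] by metis
  next
    assume lv: "length v < l"
    have bb: "b < ?p" "Suc b < ?p" using l(1,2) p by auto
    have "old_index b ?r b = b" "old_index b ?r (Suc b) = b" using l(2) by (auto simp: old_index_def)
    then have tl: "take l (u b) = take l (u (Suc b))" using bl[OF bb] by simp
    then have tv: "take (length v) (u b) = take (length v) (u (Suc b))" "u b ! length v = u (Suc b) ! length v"
      using take_eq_mono[OF tl] take_eq_nth[OF tl lv] lv by simp_all
    then have eq: "?\<pi> (h' b) = ?\<pi> (h' (Suc b))" using far[OF bb] by blast
    then have "?\<pi> (h' b) = m" using old_index_eqD[OF m(2) eq inj_h'[OF bb]] by simp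
    then show ?thesis using same[OF bb] eq tv(2) by simp
  qed
  \<comment> \<open>Consequently the last block consists exactly of the members that come from
    \<open>U m\<close>.\<close>
  have iff: "?\<pi> (h' i) = m \<longleftrightarrow> old_index b ?r i = b" if i: "i < ?p" for i
  proof -
    have bb: "b < ?p" "Suc b < ?p" "old_index b ?r b = b" "old_index b ?r (Suc b) = b"
      using l(1,2) p by (auto simp: old_index_def)
    have eq: "?\<pi> (h' b) = ?\<pi> (h' (Suc b))" using bl[OF bb(1,2) _ bb(3,4)] far[OF bb(1,2)] lv by auto
    have hb: "?\<pi> (h' b) = m" using old_index_eqD[OF m(2) eq inj_h'[OF bb(1,2)]] by simp
    show ?thesis
    proof
      assume "?\<pi> (h' i) = m"
      then have "take l (u i) = take l (u b)" using blk hb lv by metis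
      then show "old_index b ?r i = b" using dist_l[OF i bb(1)] bb(3) by metis
    next
      assume "old_index b ?r i = b"
      then have "take l (u i) = take l (u b)" using bl[OF i bb(1) _ _ bb(3)] by (cases "i = b") auto
      then show "?\<pi> (h' i) = m" using far[OF i bb(1)] lv hb by metis
    qed
  qed
  have \<pi>eq: "?\<pi> (h' i) = ?\<pi> (h' (new_index b ?r (old_index b ?r i)))" if i: "i < ?p" for i
  proof (cases "old_index b ?r i = b")
    case True
    have "b < ?p" using l(1,2) p by simp
    moreover have "old_index b ?r b = b" "new_index b ?r b = b" using l(2) by (auto simp: old_index_def new_index_def)
    ultimately show ?thesis using True iff[OF i] iff[of b] by metis
  qed (simp add: new_index_old_index[OF r])
  \<comment> \<open>The tuple before the splitting: one representative of the last block together
    with the other members, at their old indices.\<close>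
  define h where "h i = ?\<pi> (h' (new_index b ?r i))" for i
  have sgp: "new_index b ?r i < ?p" if "i < arity s" for i using new_index_less[OF l(1) r that] p by simp
  have hlt: "h i < h i'" if "i < i'" "i' < arity s" for i i'
  proof -
    have "h' (new_index b ?r i) < h' (new_index b ?r i')"
      using h'(1) new_index_strict_mono[OF r that(1)] sgp that by (auto simp: strict_mono_on_def)
    then have "h i \<le> h i'" unfolding h_def using old_index_mono[OF m(2)] by simp
    moreover have "h i \<noteq> h i'"
    proof
      assume eq: "h i = h i'"
      have "?\<pi> (h' (new_index b ?r i)) = m"
        using old_index_eqD[OF m(2) eq[unfolded h_def]] \<open>h' (new_index b ?r i) < h' (new_index b ?r i')\<close> by simp
      moreover from this have "?\<pi> (h' (new_index b ?r i')) = m" using eq by (simp add: h_def)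
      ultimately have "i = b" "i' = b" using iff sgp that old_index_new_index[OF r] by (metis less_trans)+
      then show False using that by simp
    qed
    ultimately show ?thesis by simp
  qed
  have 1: "strict_mono_on {..<arity s} h" using hlt by (auto simp: strict_mono_on_def)
  have 2: "h ` {..<arity s} \<subseteq> {..<N}" using \<pi>N sgp by (auto simp: h_def)
  have tqh: "take q (take l (u (new_index b ?r i))) = (U \<circ> h) i" if "i < arity s" for i
    using tq[OF sgp[OF that]] qv lv by (simp add: h_def min_def)
  have 3: "has_shape s (U \<circ> h)"
  proof (rule has_shape_cong)
    show "has_shape s (\<lambda>i. take q (take l (u (new_index b ?r i))))"
    proof (rule has_shape_take[OF l(6)])
      fix i i' assume ii: "i < arity s" "i' < arity s" "i \<noteq> i'"
      then have "h i \<noteq> h i'" using hlt[of i i'] hlt[of i' i] by fastforce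
      moreover have "h i < N" "h i' < N" using 2 ii by auto
      ultimately show "take q (take l (u (new_index b ?r i))) \<noteq> take q (take l (u (new_index b ?r i')))"
        using tqh ii U(2) by simp
    qed
    show "take q (take l (u (new_index b ?r i))) = (U \<circ> h) i" if "i < arity s" for i by (rule tqh[OF that])
  qed
  \<comment> \<open>The preimages under \<open>\<eta>\<close> of the letters by which the members of
    the block differ.\<close>
  define e'' where "e'' = map (\<lambda>i. sorted_letters j ! (h' (b + i) - m)) [0..<?r]"
  have bi: "b + i < ?p" "?\<pi> (h' (b + i)) = m" "h' (b + i) - m < j" "m \<le> h' (b + i)" "h' (b + i) < m + j"
    if "i < ?r" for i
  proof -
    show p': "b + i < ?p" using l(1) that p by simp
    have "old_index b ?r (b + i) = b" using that by (simp add: old_index_def)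
    then show "?\<pi> (h' (b + i)) = m" using iff[OF p'] by simp
    then show "m \<le> h' (b + i)" "h' (b + i) < m + j" by (simp_all add: old_index_eq_iff[OF m(2)])
    then show "h' (b + i) - m < j" by simp
  qed
  have 4: "set e'' \<subseteq> {..<j}"
    using bi(3) sorted_letters(2)[of j] nth_mem[of _ "sorted_letters j"] by (auto simp: e''_def)
  have letters: "map \<eta> e'' = map (\<lambda>i. u (b + i) ! l) [0..<?r]"
    using bi blk lv by (simp add: e''_def es)
  have 5: "iso_letters e e''"
  proof -
    have len: "length e'' = ?r" by (simp add: e''_def)
    have "iso_letters e (map \<eta> e'')" using l(7) letters by simp
    then show ?thesis
      using iso_letters_map[OF es(2), of e''] 4 len unfolding iso_letters_def by simp
  qed
  have 6: "?\<pi> (h' i) = h (old_index b ?r i)" if "i < ?p" for i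
    using \<pi>eq[OF that] by (simp add: h_def)
  have 7: "label m es (h' i) = label b (map \<eta> e'') i" if "i < ?p" for i
  proof (cases "old_index b ?r i = b")
    case True
    then have ib: "b \<le> i" "i < b + ?r" by (simp_all add: old_index_eq_iff[OF r])
    then have "i - b < ?r" "b + (i - b) = i" by auto
    then have "e'' ! (i - b) = sorted_letters j ! (h' i - m)" by (simp add: e''_def)
    moreover have "length e'' = ?r" by (simp add: e''_def)
    ultimately show ?thesis using bi[of "i - b"] ib by (simp add: label_def es)
  next
    case False
    then have "\<not> (m \<le> h' i \<and> h' i < m + j)" "\<not> (b \<le> i \<and> i < b + ?r)"
      using iff[OF that] by (simp_all add: old_index_eq_iff[OF m(2)] old_index_eq_iff[OF r])
    moreover have "length e'' = ?r" by (simp add: e''_def)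
    ultimately show ?thesis by (auto simp: label_def es_len)
  qed
  show ?thesis using that[OF 1 2 3 4 5 6 7] .
qed

end

lemma pull_vprefix:
  assumes "None \<in> set x"
  obtains y z where "x = map Some y @ None # z" "length y = length (vprefix x)"
proof -
  obtain ys z where x: "x = ys @ None # z" "None \<notin> set ys" using split_list_first[OF assms] by blast
  have "map (Some \<circ> the) ys = ys"
  proof (rule map_idI)
    fix a assume "a \<in> set ys"
    then have "a \<noteq> None" using x(2) by metis
    then show "(Some \<circ> the) a = a" by auto
  qed
  then have "map Some (map the ys) = ys" unfolding map_map .
  moreover have "\<And>a. a \<in> set ys \<Longrightarrow> a \<noteq> None" using x(2) by metis
  then have "vprefix x = ys" unfolding x(1) vprefix_def by (simp add: takeWhile_append2)
  ultimately show ?thesis using that[of "map the ys" z] x(1) by simp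
qed

section \<open>Growing a tree of words\<close>

context ramsey_limit
begin

text \<open>Indices follow the order that \<open>lt\<close> gives at the level of separation, so
  increasing choices of indices list branches in their own order.\<close>

definition increasing_nodes :: "nat \<Rightarrow> (nat \<Rightarrow> nat list) \<Rightarrow> nat \<Rightarrow> bool" where
  "increasing_nodes N U q \<longleftrightarrow>
     (\<forall>j<N. \<forall>i<j. \<exists>l<q. take l (U i) = take l (U j) \<and> lt (U i ! l) (U j ! l))"

text \<open>In tree terms: at most one node of each level below \<open>q\<close> splits.\<close>

definition skew_nodes :: "nat \<Rightarrow> (nat \<Rightarrow> nat list) \<Rightarrow> nat \<Rightarrow> bool" where
  "skew_nodes N U q \<longleftrightarrow> (\<forall>i<N. \<forall>j<N. \<forall>i'<N. \<forall>j'<N. \<forall>l<q.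
     take l (U i) = take l (U j) \<and> U i ! l \<noteq> U j ! l \<and>
     take l (U i') = take l (U j') \<and> U i' ! l \<noteq> U j' ! l \<longrightarrow> take l (U i) = take l (U i'))"

end

text \<open>Here \<open>s\<close> is in chronological order, as the construction runs through it
  forwards, whereas \<open>has_shape\<close> takes the most recent splitting first; hence the
  \<open>rev\<close>.\<close>

locale colouring = ramsey_limit +
  fixes V :: "(vword \<Rightarrow> bool) \<Rightarrow> bool" and L :: "((nat \<Rightarrow> nat) \<Rightarrow> bool) \<Rightarrow> bool"
    and d :: "(nat \<Rightarrow> nat list) \<Rightarrow> bool" and s :: "(nat \<times> nat list) list"
  assumes V: "ultra V" and V_idem: "conv V V = V"
    and V_fill: "\<And>P a b. V (\<lambda>x. P (fill a x)) = V (\<lambda>x. P (fill b x))"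
    and V_prefix: "\<And>l. V (\<lambda>x. None \<in> set x \<and> l \<le> length (vprefix x))"
    and V_order: "\<And>p P h. supported p P \<Longrightarrow> strict_mono_on {..<p} h \<Longrightarrow> V (\<lambda>x. P (pull h x)) = V P"
    and L: "ultra L" and L_embedding: "\<And>j. L (partial_embedding j)"
    and L_iso: "\<And>P e e'. sorted_wrt lt e \<Longrightarrow> iso_letters e e' \<Longrightarrow> L (\<lambda>\<eta>. P (map \<eta> e)) = L (\<lambda>\<eta>. P (map \<eta> e'))"
    and d_cong: "\<And>u u'. (\<And>i. i < arity (rev s) \<Longrightarrow> u i = u' i) \<Longrightarrow> d u = d u'"
    and s_valid: "\<And>i. i < length s \<Longrightarrow> fst (s ! i) < arity (rev (take i s)) \<and> 2 \<le> length (snd (s ! i)) \<and>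
      sorted_wrt lt (snd (s ! i))"
begin

text \<open>The generic word without variables. The letter \<open>0\<close> is arbitrary, by
  \<open>V_fill\<close>.\<close>

definition W :: "((nat \<Rightarrow> nat) list \<Rightarrow> bool) \<Rightarrow> bool" where
  "W P = V (\<lambda>x. P (fill (\<lambda>_. 0) x))"

lemma W: "ultra W"
  unfolding W_def[abs_def] by (rule ultra_map[OF V])

lemma V_fill_W: "V (\<lambda>x. P (fill a x)) = W P"
  unfolding W_def by (rule V_fill)

lemma W_idem: "W (\<lambda>w. W (\<lambda>w'. P (w @ w'))) = W P"
proof -
  have "conv V V (\<lambda>x. P (fill (\<lambda>_. 0) x)) = V (\<lambda>x. P (fill (\<lambda>_. 0) x))" by (simp add: V_idem)
  then show ?thesis by (simp add: conv_def W_def)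
qed

lemma W_order:
  assumes "\<And>w w'. wagree p w w' \<Longrightarrow> P w = P w'" "strict_mono_on {..<p} h"
  shows "W (\<lambda>w. P (wpull h w)) = W P"
proof -
  have "supported p (\<lambda>x. P (fill (\<lambda>_. 0) x))"
    unfolding supported_def using assms(1) vagree_fill by blast
  from V_order[OF this assms(2)] show ?thesis
    using fill_pull[of "\<lambda>_. 0" h] by (simp add: W_def comp_def)
qed

section \<open>Expected colours of incomplete tuples\<close>

abbreviation p :: "nat \<Rightarrow> nat" where "p i \<equiv> arity (rev (take i s))"

lemma p_Suc: "i < length s \<Longrightarrow> p (Suc i) = p i + length (snd (s ! i)) - 1"
  by (cases "s ! i") (simp add: take_Suc_conv_app_nth)

text \<open>The colour that a tuple will get if it is extended and split, along the ultrafilters, according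
  to the remaining entries of the shape.\<close>

fun expected :: "(nat \<times> nat list) list \<Rightarrow> (nat \<Rightarrow> nat list) \<Rightarrow> bool" where
  "expected [] u = d u"
| "expected ((b, e) # t) u = W (\<lambda>w. L (\<lambda>\<eta>. V (\<lambda>x. expected t (split_coord b (map \<eta> e) (extend u w) x))))"

text \<open>The expected colour at the moment of a splitting, when the extension that precedes it
  has been carried out.\<close>

definition expected_split :: "nat \<Rightarrow> (nat \<Rightarrow> nat list) \<Rightarrow> bool" where
  "expected_split i u = L (\<lambda>\<eta>. V (\<lambda>x. expected (drop (Suc i) s) (split_coord (fst (s ! i)) (map \<eta> (snd (s ! i))) u x)))"

lemma expected_drop: "i < length s \<Longrightarrow> expected (drop i s) u = W (\<lambda>w. expected_split i (extend u w))"
  by (cases "s ! i") (simp add: Cons_nth_drop_Suc[symmetric] expected_split_def)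

lemma expected_cong: "i \<le> length s \<Longrightarrow> (\<And>j. j < p i \<Longrightarrow> u j = u' j) \<Longrightarrow> expected (drop i s) u = expected (drop i s) u'"
proof (induction "length s - i" arbitrary: i u u')
  case 0
  then have "i = length s" by simp
  then show ?case using 0 d_cong[of u u'] by simp
next
  case (Suc n)
  then have i: "i < length s" by simp
  have "expected (drop (Suc i) s) (split_coord (fst (s ! i)) (map \<eta> (snd (s ! i))) (extend u w) x) =
      expected (drop (Suc i) s) (split_coord (fst (s ! i)) (map \<eta> (snd (s ! i))) (extend u' w) x)" for \<eta> w x
  proof (rule Suc.hyps(1))
    show "split_coord (fst (s ! i)) (map \<eta> (snd (s ! i))) (extend u w) x j =
      split_coord (fst (s ! i)) (map \<eta> (snd (s ! i))) (extend u' w) x j" if "j < p (Suc i)" for j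
    proof (rule split_coord_cong[where p = "p i"])
      show "extend u w j = extend u' w j" if "j < p i" for j
        using Suc.prems(2)[OF that] by (simp add: extend_def)
    qed (use s_valid[OF i] that p_Suc[OF i] in auto)
  qed (use Suc.hyps(2) i in auto)
  then show ?case by (simp add: expected_drop[OF i] expected_split_def)
qed

lemma expected_split_cong:
  assumes i: "i < length s" and u: "\<And>j. j < p i \<Longrightarrow> u j = u' j"
  shows "expected_split i u = expected_split i u'"
proof -
  have "expected (drop (Suc i) s) (split_coord (fst (s ! i)) (map \<eta> (snd (s ! i))) u x) =
      expected (drop (Suc i) s) (split_coord (fst (s ! i)) (map \<eta> (snd (s ! i))) u' x)" for \<eta> x
  proof (rule expected_cong)
    show "split_coord (fst (s ! i)) (map \<eta> (snd (s ! i))) u x j =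
      split_coord (fst (s ! i)) (map \<eta> (snd (s ! i))) u' x j" if "j < p (Suc i)" for j
      using s_valid[OF i] that p_Suc[OF i] u by (intro split_coord_cong[where p = "p i"]) auto
  qed (use i in simp)
  then show ?thesis by (simp add: expected_split_def)
qed

text \<open>Waiting does no harm: an extension followed by the extension that precedes the next
  splitting is, by idempotence, a single generic extension.\<close>

lemma expected_persistent: "i < length s \<Longrightarrow> W (\<lambda>w. expected (drop i s) (extend u w)) = expected (drop i s) u"
  using W_idem[of "\<lambda>w. expected_split i (extend u w)"] by (simp add: expected_drop extend_extend)

definition \<kappa> :: bool where "\<kappa> = expected s (\<lambda>_. [])"

text \<open>The bound \<open>i < length s\<close> leaves out complete tuples. They get their colour
  in \<open>good_step\<close>, at the stage at which they appear.\<close>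

definition good_colours :: "nat \<Rightarrow> (nat \<Rightarrow> nat list) \<Rightarrow> bool" where
  "good_colours N U \<longleftrightarrow> (\<forall>i<length s. \<forall>h. strict_mono_on {..<p i} h \<longrightarrow> h ` {..<p i} \<subseteq> {..<N} \<longrightarrow>
     has_shape (rev (take i s)) (U \<circ> h) \<longrightarrow> expected (drop i s) (U \<circ> h) = \<kappa>)"

definition good_stage :: "nat \<Rightarrow> (nat \<Rightarrow> nat list) \<Rightarrow> nat \<Rightarrow> bool" where
  "good_stage N U q \<longleftrightarrow> 0 < N \<and> (\<forall>i<N. length (U i) = q \<and> clip (U i) = U i) \<and>
     increasing_nodes N U q \<and> skew_nodes N U q \<and> good_colours N U"

lemma good_stageD:
  assumes "good_stage N U q"
  shows "0 < N" "\<And>i. i < N \<Longrightarrow> length (U i) = q" "\<And>i. i < N \<Longrightarrow> clip (U i) = U i"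
    "increasing_nodes N U q" "skew_nodes N U q" "good_colours N U"
  using assms by (simp_all add: good_stage_def)

text \<open>Here \<open>v\<close> is the node above \<open>U m\<close> at which the copies separate.
  The last conjunct is about complete tuples that are new at this stage, that is, two members of
  which were one node before.\<close>

definition good_step :: "nat \<Rightarrow> nat \<Rightarrow> nat \<Rightarrow> (nat \<Rightarrow> nat list) \<Rightarrow> nat \<Rightarrow> nat \<Rightarrow> (nat \<Rightarrow> nat list) \<Rightarrow> nat \<Rightarrow> bool" where
  "good_step m j N U q N' U' q' \<longleftrightarrow> m < N \<and> 1 \<le> j \<and> N' = N + j - 1 \<and> q < q' \<and>
     (\<forall>i<N'. prefix (U (old_index m j i)) (U' i)) \<and>
     (\<exists>v \<eta>. prefix (U m) v \<and> clip v = v \<and> partial_embedding j \<eta> \<and>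
        (\<forall>a<j. \<eta> (sorted_letters j ! a) \<le> length v \<and>
           prefix (v @ [\<eta> (sorted_letters j ! a)]) (U' (m + a)))) \<and>
     (\<forall>h. strict_mono_on {..<p (length s)} h \<longrightarrow> h ` {..<p (length s)} \<subseteq> {..<N'} \<longrightarrow>
        has_shape (rev s) (U' \<circ> h) \<longrightarrow> \<not> inj_on (old_index m j \<circ> h) {..<p (length s)} \<longrightarrow> d (U' \<circ> h) = \<kappa>)"

lemma good_stage_start: "good_stage 1 (\<lambda>_. []) 0"
proof -
  have "expected (drop i s) ((\<lambda>_. []) \<circ> h) = \<kappa>" if "i < length s" "has_shape (rev (take i s)) ((\<lambda>_. []) \<circ> h)" for i h
  proof (cases i)
    case 0
    then show ?thesis by (simp add: \<kappa>_def comp_def)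
  next
    case (Suc j)
    obtain b e where be: "s ! j = (b, e)" by fastforce
    have "rev (take i s) = (b, e) # rev (take j s)"
      using Suc that(1) be by (simp add: take_Suc_conv_app_nth)
    from has_shape_ConsD[OF that(2)[unfolded this]] obtain l where
      "b < arity (rev (take j s))" "2 \<le> length e" "\<forall>i<arity (rev (take j s)) + length e - 1. l < length ((((\<lambda>_. []) \<circ> h) :: nat \<Rightarrow> nat list) i)"
      by blast
    \<comment> \<open>A nonempty shape requires words longer than its last splitting level, and only
      the empty word is present.\<close>
    then have False by (auto dest: spec[of _ 0])
    then show ?thesis ..
  qed
  then have "good_colours 1 (\<lambda>_. [])" unfolding good_colours_def by blast
  then show ?thesis by (simp add: good_stage_def increasing_nodes_def skew_nodes_def)
qed

lemma good_stage_distinct: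
  assumes "good_stage N U q" "i < N" "j < N" "i \<noteq> j"
  shows "U i \<noteq> U j"
proof -
  have *: "U i \<noteq> U j" if ij: "i < j" "j < N" for i j
  proof -
    have "\<exists>l<q. take l (U i) = take l (U j) \<and> lt (U i ! l) (U j ! l)"
      using good_stageD(4)[OF assms(1)] ij unfolding increasing_nodes_def by blast
    then show ?thesis by auto
  qed
  show ?thesis using *[of i j] *[of j i] assms(2-4) by (cases i j rule: linorder_cases) auto
qed

text \<open>Three choices are made in succession: a word \<open>w\<close> that lengthens all nodes,
  a map \<open>\<eta>\<close> that supplies the letters, and a variable word \<open>x\<close> that
  performs the splitting. Each is subject to finitely many conditions, all of which hold for almost
  all candidates.\<close>

lemma good_step_exists:
  assumes I: "good_stage N U q" and m: "m < N" "1 \<le> j"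
  shows "\<exists>N' U' q'. good_stage N' U' q' \<and> good_step m j N U q N' U' q'"
proof -
  let ?N' = "N + j - 1" and ?\<pi> = "old_index m j"
  have Ulen: "length (U i) = q" "clip (U i) = U i" if "i < N" for i using good_stageD(2,3)[OF I that] .
  have Ucol: "expected (drop i s) (U \<circ> h) = \<kappa>"
    if "i < length s" "strict_mono_on {..<p i} h" "h ` {..<p i} \<subseteq> {..<N}" "has_shape (rev (take i s)) (U \<circ> h)" for i h
    using good_stageD(6)[OF I] that unfolding good_colours_def by blast
  note Udist = good_stage_distinct[OF I]
  \<comment> \<open>Only the values below \<open>k\<close> matter. With the others set to
    \<open>0\<close>, finitely many maps remain, as the use of ultrafilters requires.\<close>
  define H where "H k X = {h :: nat \<Rightarrow> nat. \<forall>a. (a \<in> {..<k} \<longrightarrow> h a \<in> {..<X}) \<and> (a \<notin> {..<k} \<longrightarrow> h a = 0)}" for k X :: nat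
  have finH: "finite (H k X)" for k X unfolding H_def by (rule finite_set_of_finite_funs) auto
  define norm where "norm k h = (\<lambda>a. if a < k then h a else 0)" for k :: nat and h :: "nat \<Rightarrow> nat"
  have norm: "norm k h \<in> H k X" "\<And>a. a < k \<Longrightarrow> norm k h a = h a"
    "strict_mono_on {..<k} h \<Longrightarrow> strict_mono_on {..<k} (norm k h)"
    if "h ` {..<k} \<subseteq> {..<X}" for k h X
    using that by (auto simp: H_def norm_def strict_mono_on_def)
  \<comment> \<open>The incomplete tuples of old nodes, with the number \<open>i\<close> of
    splittings they have gone through.\<close>
  define G where "G = {(i, h). i < length s \<and> h \<in> H (p i) N \<and> strict_mono_on {..<p i} h \<and> has_shape (rev (take i s)) (U \<circ> h)}"
  have finG: "finite G"
  proof -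
    have "G \<subseteq> (SIGMA i:{..<length s}. H (p i) N)" unfolding G_def by auto
    then show ?thesis by (rule finite_subset) (auto intro: finH)
  qed
  have G: "i < length s" "strict_mono_on {..<p i} h" "h ` {..<p i} \<subseteq> {..<N}" "expected (drop i s) (U \<circ> h) = \<kappa>"
    if "(i, h) \<in> G" for i h
    using that Ucol unfolding G_def H_def by auto
  \<comment> \<open>By invariance under changes of coordinates, the members chosen by
    \<open>h\<close> are extended as if they were the first coordinates.\<close>
  have extend_W: "W (\<lambda>w. Q (extend U w \<circ> h)) = W (\<lambda>w. Q (extend (U \<circ> h) w))"
    if Q: "\<And>u u'. (\<And>j. j < p i \<Longrightarrow> u j = u' j) \<Longrightarrow> Q u = Q u'" and h: "strict_mono_on {..<p i} h" for Q i h
  proof -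
    have "W (\<lambda>w. Q (extend (U \<circ> h) (wpull h w))) = W (\<lambda>w. Q (extend (U \<circ> h) w))"
      by (rule W_order[OF _ h]) (intro Q wagree_extend, auto)
    then show ?thesis by (simp add: extend_comp)
  qed
  \<comment> \<open>The first equation is for tuples that are split in this step, the second for
    tuples that are only lengthened.\<close>
  have "W (\<lambda>w. \<forall>a\<in>G. (case a of (i, h) \<Rightarrow> expected_split i (extend U w \<circ> h) = \<kappa> \<and> expected (drop i s) (extend U w \<circ> h) = \<kappa>))"
    unfolding ultra_ball[OF W finG]
  proof
    fix a assume "a \<in> G"
    then obtain i h where a: "a = (i, h)" "(i, h) \<in> G" by (cases a) auto
    note g = G[OF a(2)]
    have "W (\<lambda>w. expected_split i (extend U w \<circ> h)) = W (\<lambda>w. expected_split i (extend (U \<circ> h) w))"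
      by (rule extend_W[OF expected_split_cong[OF g(1)] g(2)])
    also have "\<dots> = \<kappa>" using g(4) expected_drop[OF g(1)] by simp
    finally have 1: "W (\<lambda>w. expected_split i (extend U w \<circ> h)) = \<kappa>" .
    have "W (\<lambda>w. expected (drop i s) (extend U w \<circ> h)) = W (\<lambda>w. expected (drop i s) (extend (U \<circ> h) w))"
      by (rule extend_W[OF expected_cong[OF less_imp_le[OF g(1)]] g(2)])
    also have "\<dots> = \<kappa>" using g(4) expected_persistent[OF g(1)] by simp
    finally have 2: "W (\<lambda>w. expected (drop i s) (extend U w \<circ> h)) = \<kappa>" .
    show "W (\<lambda>w. case a of (i, h) \<Rightarrow> expected_split i (extend U w \<circ> h) = \<kappa> \<and> expected (drop i s) (extend U w \<circ> h) = \<kappa>)"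
      using 1 2 unfolding a(1) prod.case by (simp only: ultra_conj[OF W] ultra_eq_const[OF W])
  qed
  from ultra_ex[OF W, OF this] obtain w where w0: "\<forall>a\<in>G. (case a of (i, h) \<Rightarrow> expected_split i (extend U w \<circ> h) = \<kappa> \<and> expected (drop i s) (extend U w \<circ> h) = \<kappa>)"
    by blast
  define V0 where "V0 = extend U w"
  have w: "expected_split i (V0 \<circ> h) = \<kappa>" "expected (drop i s) (V0 \<circ> h) = \<kappa>" if "(i, h) \<in> G" for i h
    using bspec[OF w0 that] by (simp_all add: V0_def)
  \<comment> \<open>All letters that the next splitting of a tuple may receive; by
    \<open>L_iso\<close> each choice is as good as the letters in the shape itself.\<close>
  define E where "E i = {e'. set e' \<subseteq> {..<j} \<and> length e' = length (snd (s ! i)) \<and> iso_letters (snd (s ! i)) e'}" for i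
  have finE: "finite (E i)" for i
    by (rule finite_subset[OF _ finite_lists_length_eq[of "{..<j}" "length (snd (s ! i))"]]) (auto simp: E_def)
  define GE where "GE = (SIGMA a:G. E (fst a))"
  have finGE: "finite GE" unfolding GE_def using finG finE by blast
  let ?C = "\<lambda>i h e' \<eta> x. expected (drop (Suc i) s) (split_coord (fst (s ! i)) (map \<eta> e') (V0 \<circ> h) x)"
  have "L (\<lambda>\<eta>. partial_embedding j \<eta> \<and> (\<forall>a\<in>GE. case a of ((i, h), e') \<Rightarrow> V (?C i h e' \<eta>) = \<kappa>))"
    unfolding ultra_conj[OF L] ultra_ball[OF L finGE]
  proof (intro conjI L_embedding ballI)
    fix a assume "a \<in> GE"
    then obtain i h e' where a: "a = ((i, h), e')" "(i, h) \<in> G" "e' \<in> E i" by (auto simp: GE_def)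
    note g = G[OF a(2)]
    have "L (\<lambda>\<eta>. V (?C i h (snd (s ! i)) \<eta>)) = L (\<lambda>\<eta>. V (?C i h e' \<eta>))"
      using L_iso[of "snd (s ! i)" e' "\<lambda>es. V (\<lambda>x. expected (drop (Suc i) s) (split_coord (fst (s ! i)) es (V0 \<circ> h) x))"]
        s_valid[OF g(1)] a(3) by (simp add: E_def)
    then show "L (\<lambda>\<eta>. case a of ((i, h), e') \<Rightarrow> V (?C i h e' \<eta>) = \<kappa>)"
      using w(1)[OF a(2)] unfolding a(1) prod.case ultra_eq_const[OF L] by (simp add: expected_split_def)
  qed
  from ultra_ex[OF L, OF this] obtain \<eta> where \<eta>0: "partial_embedding j \<eta>"
    "\<forall>a\<in>GE. case a of ((i, h), e') \<Rightarrow> V (?C i h e' \<eta>) = \<kappa>" by blast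
  have \<eta>: "V (?C i h e' \<eta>) = \<kappa>" if "(i, h) \<in> G" "e' \<in> E i" for i h e'
  proof -
    have "((i, h), e') \<in> GE" using that by (simp add: GE_def)
    from bspec[OF \<eta>0(2) this] show ?thesis by simp
  qed
  define es where "es = map \<eta> (sorted_letters j)"
  have es_len: "length es = j" by (simp add: es_def)
  define X where "X = Max (insert 0 (set es))"
  \<comment> \<open>Tuples containing at most one of the new copies: old tuples
    \<open>?\<pi> \<circ> h'\<close> whose members may get different letters at the
    variable.\<close>
  define O' where "O' = {(i, h'). i < length s \<and> h' \<in> H (p i) ?N' \<and> strict_mono_on {..<p i} (?\<pi> \<circ> h') \<and>
      has_shape (rev (take i s)) (U \<circ> (?\<pi> \<circ> h'))}"
  have finO: "finite O'"
  proof -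
    have "O' \<subseteq> (SIGMA i:{..<length s}. H (p i) ?N')" unfolding O'_def by auto
    then show ?thesis by (rule finite_subset) (auto intro: finH)
  qed
  let ?D = "\<lambda>i h' x. expected (drop i s) (extend (V0 \<circ> (?\<pi> \<circ> h')) (fill (label m es \<circ> h') (pull (?\<pi> \<circ> h') x)))"
  \<comment> \<open>The word \<open>x\<close> must have enough constant letters at its beginning for
    the letters in \<open>es\<close> to be admissible, and must give the colour
    \<open>\<kappa>\<close> both to the tuples that are split and to those that are merely
    lengthened.\<close>
  have "V (\<lambda>x. (None \<in> set x \<and> X \<le> length (vprefix x)) \<and>
      (\<forall>a\<in>GE. case a of ((i, h), e') \<Rightarrow> ?C i h e' \<eta> (pull h x) = \<kappa>) \<and>
      (\<forall>a\<in>O'. case a of (i, h') \<Rightarrow> ?D i h' x = \<kappa>))"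
    unfolding ultra_conj[of V "\<lambda>x. None \<in> set x \<and> X \<le> length (vprefix x)", OF V]
      ultra_conj[of V "\<lambda>x. \<forall>a\<in>GE. case a of ((i, h), e') \<Rightarrow> ?C i h e' \<eta> (pull h x) = \<kappa>", OF V]
      ultra_ball[OF V finGE] ultra_ball[OF V finO]
  proof (intro conjI V_prefix ballI)
    fix a assume "a \<in> GE"
    then obtain i h e' where a: "a = ((i, h), e')" "(i, h) \<in> G" "e' \<in> E i" by (auto simp: GE_def)
    note g = G[OF a(2)]
    have "supported (p i) (?C i h e' \<eta>)"
      unfolding supported_def
    proof (intro allI impI, rule expected_cong)
      fix x y k assume "vagree (p i) x y" "k < p (Suc i)"
      then show "split_coord (fst (s ! i)) (map \<eta> e') (V0 \<circ> h) x k = split_coord (fst (s ! i)) (map \<eta> e') (V0 \<circ> h) y k"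
        using s_valid[OF g(1)] p_Suc[OF g(1)] a(3) by (intro split_coord_cong[where p = "p i"]) (auto simp: E_def)
    qed (use g(1) in simp)
    from V_order[OF this g(2)] have "V (\<lambda>x. ?C i h e' \<eta> (pull h x)) = \<kappa>" using \<eta>[OF a(2,3)] by simp
    then show "V (\<lambda>x. case a of ((i, h), e') \<Rightarrow> ?C i h e' \<eta> (pull h x) = \<kappa>)"
      unfolding a(1) prod.case ultra_eq_const[OF V] .
  next
    fix a assume "a \<in> O'"
    then obtain i h' where a: "a = (i, h')" "i < length s" "h' \<in> H (p i) ?N'"
      "strict_mono_on {..<p i} (?\<pi> \<circ> h')" "has_shape (rev (take i s)) (U \<circ> (?\<pi> \<circ> h'))" by (auto simp: O'_def)
    let ?g = "?\<pi> \<circ> h'" and ?Q = "\<lambda>w. expected (drop i s) (extend (V0 \<circ> (?\<pi> \<circ> h')) w)"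
    have gN: "?g ` {..<p i} \<subseteq> {..<N}" using a(3) old_index_less[OF m] by (auto simp: H_def)
    have cong: "(V0 \<circ> norm (p i) ?g) k = (V0 \<circ> ?g) k" "(U \<circ> norm (p i) ?g) k = (U \<circ> ?g) k" if "k < p i" for k
      using norm(2)[OF gN that] by simp_all
    have "has_shape (rev (take i s)) (U \<circ> norm (p i) ?g)"
      by (rule has_shape_cong[OF _ a(5)]) (simp add: cong(2)[symmetric] del: comp_apply)
    then have "(i, norm (p i) ?g) \<in> G"
      using a(2) norm(1)[OF gN] norm(3)[OF gN a(4)] by (simp add: G_def)
    have "expected (drop i s) (V0 \<circ> norm (p i) ?g) = expected (drop i s) (V0 \<circ> ?g)"
      by (rule expected_cong[OF less_imp_le[OF a(2)] cong(1)])
    with w(2)[OF \<open>(i, norm (p i) ?g) \<in> G\<close>] have V0: "expected (drop i s) (V0 \<circ> ?g) = \<kappa>" by (simp only:)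
    have sup: "?Q w = ?Q w'" if "wagree (p i) w w'" for w w'
      by (rule expected_cong[OF less_imp_le[OF a(2)]]) (rule wagree_extend[OF that], auto)
    have "supported (p i) (\<lambda>x. ?Q (fill (label m es \<circ> h') x))"
      unfolding supported_def using sup vagree_fill by blast
    \<comment> \<open>Order invariance removes \<open>pull\<close>, then any letter may be put for
      the variable; what remains is a generic extension, covered by
      \<open>expected_persistent\<close>.\<close>
    from V_order[OF this a(4)] have "V (?D i h') = V (\<lambda>x. ?Q (fill (label m es \<circ> h') x))" .
    also have "\<dots> = W ?Q" by (rule V_fill_W)
    also have "\<dots> = \<kappa>" using expected_persistent[OF a(2), of "V0 \<circ> ?g"] V0 by simp
    finally show "V (\<lambda>x. case a of (i, h') \<Rightarrow> ?D i h' x = \<kappa>)"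
      unfolding a(1) prod.case ultra_eq_const[OF V] .
  qed
  from ultra_ex[OF V, OF this] obtain x where x1: "(None \<in> set x \<and> X \<le> length (vprefix x)) \<and>
      (\<forall>a\<in>GE. case a of ((i, h), e') \<Rightarrow> ?C i h e' \<eta> (pull h x) = \<kappa>) \<and>
      (\<forall>a\<in>O'. case a of (i, h') \<Rightarrow> ?D i h' x = \<kappa>)" .
  note x0 = x1[THEN conjunct1, THEN conjunct1] x1[THEN conjunct1, THEN conjunct2]
    x1[THEN conjunct2, THEN conjunct1] x1[THEN conjunct2, THEN conjunct2]
  have xC: "?C i h e' \<eta> (pull h x) = \<kappa>" if "(i, h) \<in> G" "e' \<in> E i" for i h e'
  proof -
    have "((i, h), e') \<in> GE" using that by (simp add: GE_def)
    from bspec[OF x0(3) this] show ?thesis by simp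
  qed
  have xD: "?D i h' x = \<kappa>" if "(i, h') \<in> O'" for i h'
    using bspec[OF x0(4) that] by simp
  obtain y z where yz: "x = map Some y @ None # z" "length y = length (vprefix x)"
    using pull_vprefix[OF x0(1)] by blast
  define U' where "U' = split_coord m es V0 x"
  define q0 where "q0 = q + length w"
  define q' where "q' = q0 + length x"
  define v where "v = clip (V0 m @ map (\<lambda>f. f m) y)"
  have V0: "length (V0 i) = q0" "prefix (U i) (V0 i)" if "i < N" for i
  proof -
    show "length (V0 i) = q0" using Ulen[OF that] by (simp add: V0_def extend_def q0_def)
    have "clip (U i @ map (\<lambda>f. f i) w) = clip (U i @ map (\<lambda>f. f i) w)" ..
    then show "prefix (U i) (V0 i)" using prefix_clip[of "U i" "map (\<lambda>f. f i) w"] Ulen(2)[OF that]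
      by (simp add: V0_def extend_def)
  qed
  have cV0: "clip (V0 i) = V0 i" for i by (simp add: V0_def extend_def)
  have U'eq: "U' i = clip (V0 (?\<pi> i) @ map (\<lambda>f. case f of None \<Rightarrow> label m es i | Some f \<Rightarrow> f (?\<pi> i)) x)" for i
    unfolding U'_def split_coord_def extend_fill_pull es_len by simp
  have \<pi>N: "?\<pi> i < N" if "i < ?N'" for i using old_index_less[OF m that] .
  have U'V0: "prefix (V0 (?\<pi> i)) (U' i)" for i
    using prefix_clip[of "V0 (?\<pi> i)"] cV0 unfolding U'eq by metis
  have U'U: "prefix (U (?\<pi> i)) (U' i)" if "i < ?N'" for i
    using prefix_order.trans[OF V0(2)[OF \<pi>N[OF that]] U'V0] .
  have U'len: "length (U' i) = q'" if "i < ?N'" for i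
    using V0(1)[OF \<pi>N[OF that]] unfolding U'eq q'_def by simp
  have U'clip: "clip (U' i) = U' i" for i unfolding U'eq by simp
  have vlen: "length v = q0 + length y" using V0(1)[OF m(1)] by (simp add: v_def)
  have Uv: "prefix (U m) v"
    using prefix_order.trans[OF V0(2)[OF m(1)]] prefix_clip[of "V0 m" "map (\<lambda>f. f m) y"] cV0[of m] unfolding v_def by metis
  \<comment> \<open>The prefix of \<open>x\<close> has at least \<open>X\<close> letters, so
    clipping leaves the letters of \<open>es\<close> unchanged at the splitting.\<close>
  have es_le: "es ! a \<le> length v" if "a < j" for a
  proof -
    have "es ! a \<le> X" unfolding X_def using that es_len by (intro Max_ge) auto
    then show ?thesis using x0(2) yz(2) vlen by simp
  qed
  have blk: "prefix (v @ [es ! a]) (U' (m + a))" if a: "a < j" for a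
  proof -
    have pm: "?\<pi> (m + a) = m" "label m es (m + a) = es ! a" using a by (auto simp: old_index_def label_def es_len)
    have "U' (m + a) = clip ((V0 m @ map (\<lambda>f. f m) y @ [es ! a]) @
        map (\<lambda>f. case f of None \<Rightarrow> es ! a | Some f \<Rightarrow> f m) z)"
      unfolding U'eq pm yz(1) by (simp add: comp_def)
    moreover have "clip (V0 m @ map (\<lambda>f. f m) y @ [es ! a]) = v @ [es ! a]"
      using clip_snoc[of "V0 m @ map (\<lambda>f. f m) y" "es ! a"] es_le[OF a] vlen V0(1)[OF m(1)]
      by (simp add: v_def)
    ultimately show ?thesis using prefix_clip[of "V0 m @ map (\<lambda>f. f m) y @ [es ! a]"] by metis
  qed
  have blk': "prefix (v @ [es ! (i - m)]) (U' i)" if "m \<le> i" "i < m + j" for i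
    using blk[of "i - m"] that by simp
  have qq: "q \<le> length v" "length v < q'" "q < q'"
    using vlen yz(1) by (auto simp: q0_def q'_def)
  have es_sorted: "sorted_wrt lt es"
    using sorted_letters[of j] iso_letters_map(2)[OF \<eta>0(1), of "sorted_letters j"]
    unfolding es_def sorted_wrt_iff_nth_less by simp
  have tq: "take q (U' i) = U (?\<pi> i)" if "i < ?N'" for i
    using U'U[OF that] Ulen(1)[OF \<pi>N[OF that]] by (auto simp: prefix_def)
  have tv: "take (length v) (U' i) = v \<and> U' i ! length v = es ! (i - m)" if "m \<le> i" "i < m + j" for i
    using blk'[OF that] by (auto simp: prefix_def nth_append)
  \<comment> \<open>For tuples with two copies of the split node, \<open>new_tuple\<close> recovers
    the tuple before the splitting and its letters, so that \<open>xC\<close> applies.\<close>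
  have new: "expected (drop (Suc i) s) (U' \<circ> h') = \<kappa>"
    if i: "i < length s" and h': "strict_mono_on {..<p (Suc i)} h'" "h' ` {..<p (Suc i)} \<subseteq> {..<?N'}"
      and sh: "has_shape (rev (take (Suc i) s)) (U' \<circ> h')" and ni: "\<not> inj_on (?\<pi> \<circ> h') {..<p (Suc i)}" for i h'
  proof -
    obtain b e where be: "s ! i = (b, e)" by fastforce
    have rv: "rev (take (Suc i) s) = (b, e) # rev (take i s)"
      using i be by (simp add: take_Suc_conv_app_nth)
    obtain h e'' where h: "strict_mono_on {..<p i} h" "h ` {..<p i} \<subseteq> {..<N}" "has_shape (rev (take i s)) (U \<circ> h)"
      "set e'' \<subseteq> {..<j}" "iso_letters e e''"
      "\<And>k. k < arity ((b, e) # rev (take i s)) \<Longrightarrow> old_index m j (h' k) = h (old_index b (length e) k)"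
      "\<And>k. k < arity ((b, e) # rev (take i s)) \<Longrightarrow> label m es (h' k) = label b (map \<eta> e'') k"
      by (rule new_tuple[where N = N and U = U and q = q and m = m and j = j and U' = U' and v = v and es = es
            and \<eta> = \<eta> and b = b and e = e and s = "rev (take i s)" and h' = h', OF _ _ m _ Uv _ es_def \<eta>0(1)
            h'[unfolded rv] sh[unfolded rv] ni[unfolded rv]]) (rule Ulen(1) Udist U'U blk' that; assumption)+
    have n2: "norm (p i) h k = h k" if "k < p i" for k using norm(2)[OF h(2) that] .
    have "has_shape (rev (take i s)) (U \<circ> norm (p i) h)"
      by (rule has_shape_cong[OF _ h(3)]) (simp add: n2)
    then have inG: "(i, norm (p i) h) \<in> G"
      using i norm(1)[OF h(2)] norm(3)[OF h(2,1)] by (simp add: G_def)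
    have len: "length e'' = length e" using h(5) by (simp add: iso_letters_def)
    have inE: "e'' \<in> E i" using h(4,5) len be by (simp add: E_def)
    have "(U' \<circ> h') k = split_coord b (map \<eta> e'') (V0 \<circ> norm (p i) h) (pull (norm (p i) h) x) k" if k: "k < p (Suc i)" for k
    proof -
      have "old_index b (length e) k < p i"
        using s_valid[OF i] p_Suc[OF i] k be by (intro old_index_less) auto
      then have "old_index m (length es) (h' k) = norm (p i) h (old_index b (length (map \<eta> e'')) k)"
        using h(6)[of k] k n2 by (simp add: rv es_len len)
      moreover have "label m es (h' k) = label b (map \<eta> e'') k" using h(7)[of k] k by (simp add: rv)
      ultimately show ?thesis unfolding U'_def comp_apply[of _ h'] by (rule split_coord_eqI)
    qed
    then have "expected (drop (Suc i) s) (U' \<circ> h') =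
        expected (drop (Suc i) s) (split_coord b (map \<eta> e'') (V0 \<circ> norm (p i) h) (pull (norm (p i) h) x))"
      using i by (intro expected_cong) auto
    then show ?thesis using xC[OF inG inE] be by simp
  qed
  \<comment> \<open>Without two copies of the split node, the truncations at \<open>q\<close> have
    the shape already, and \<open>xD\<close> applies.\<close>
  have old: "expected (drop i s) (U' \<circ> h') = \<kappa>"
    if i: "i < length s" and h': "strict_mono_on {..<p i} h'" "h' ` {..<p i} \<subseteq> {..<?N'}"
      and sh: "has_shape (rev (take i s)) (U' \<circ> h')" and inj: "inj_on (?\<pi> \<circ> h') {..<p i}" for i h'
  proof -
    have g_eq: "take q ((U' \<circ> h') k) = (U \<circ> (?\<pi> \<circ> h')) k" if "k < p i" for k
      using tq[of "h' k"] h'(2) that by auto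
    have gN: "(?\<pi> \<circ> h') k < N" if "k < p i" for k using \<pi>N[of "h' k"] h'(2) that by auto
    have "has_shape (rev (take i s)) (\<lambda>k. take q ((U' \<circ> h') k))"
    proof (rule has_shape_take[OF sh])
      fix k k' assume k: "k < p i" "k' < p i" "k \<noteq> k'"
      then have "(?\<pi> \<circ> h') k \<noteq> (?\<pi> \<circ> h') k'" using inj by (auto simp: inj_on_def)
      then show "take q ((U' \<circ> h') k) \<noteq> take q ((U' \<circ> h') k')"
        using Udist[OF gN[OF k(1)] gN[OF k(2)]] g_eq k by simp
    qed
    then have shU: "has_shape (rev (take i s)) (U \<circ> (?\<pi> \<circ> h'))" by (rule has_shape_cong[rotated]) (rule g_eq)
    have sm: "strict_mono_on {..<p i} (?\<pi> \<circ> h')"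
    proof (rule strict_mono_onI)
      fix k k' assume k: "k \<in> {..<p i}" "k' \<in> {..<p i}" "k < k'"
      then have "h' k < h' k'" using h'(1) by (auto simp: strict_mono_on_def)
      then have "(?\<pi> \<circ> h') k \<le> (?\<pi> \<circ> h') k'" using old_index_mono[OF m(2)] by simp
      moreover have "(?\<pi> \<circ> h') k \<noteq> (?\<pi> \<circ> h') k'" using inj k by (auto simp: inj_on_def)
      ultimately show "(?\<pi> \<circ> h') k < (?\<pi> \<circ> h') k'" by simp
    qed
    let ?n = "norm (p i) h'"
    have n2: "?n k = h' k" if "k < p i" for k using norm(2)[OF h'(2) that] .
    have "has_shape (rev (take i s)) (U \<circ> (?\<pi> \<circ> ?n))" by (rule has_shape_cong[OF _ shU]) (simp add: n2)
    moreover have "strict_mono_on {..<p i} (?\<pi> \<circ> ?n)" using sm by (auto simp: strict_mono_on_def n2)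
    ultimately have "(i, ?n) \<in> O'" using i norm(1)[OF h'(2)] by (simp add: O'_def)
    from xD[OF this] have "expected (drop i s) (U' \<circ> ?n) = \<kappa>"
      unfolding U'_def split_coord_comp es_len .
    moreover have "expected (drop i s) (U' \<circ> h') = expected (drop i s) (U' \<circ> ?n)"
      by (rule expected_cong) (use i n2 in auto)
    ultimately show ?thesis by simp
  qed
  have "good_stage ?N' U' q'"
    unfolding good_stage_def increasing_nodes_def skew_nodes_def good_colours_def
  proof (intro conjI allI impI)
    show "0 < ?N'" using m by simp
  next
    fix i assume "i < ?N'" then show "length (U' i) = q'" "clip (U' i) = U' i" using U'len U'clip by auto
  next
    fix i i' assume i: "i' < ?N'" "i < i'"
    show "\<exists>l<q'. take l (U' i) = take l (U' i') \<and> lt (U' i ! l) (U' i' ! l)"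
    proof (cases "?\<pi> i = ?\<pi> i'")
      case True
      then have "m \<le> i" "i < m + j" "m \<le> i'" "i' < m + j"
        using old_index_eqD[OF m(2) True] old_index_eq_iff[OF m(2), of m i] old_index_eq_iff[OF m(2), of m i'] True i(2) by simp_all
      then show ?thesis
        using tv[of i] tv[of i'] es_sorted i(2) qq(2) es_len
        by (intro exI[of _ "length v"]) (auto simp: sorted_wrt_iff_nth_less)
    next
      case False
      then have "?\<pi> i < ?\<pi> i'" using old_index_mono[OF m(2), of i i' m] i(2) by simp
      then obtain l where l: "l < q" "take l (U (?\<pi> i)) = take l (U (?\<pi> i'))" "lt (U (?\<pi> i) ! l) (U (?\<pi> i') ! l)"
        using good_stageD(4)[OF I] \<pi>N[OF i(1)] unfolding increasing_nodes_def by blast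
      have "i < ?N'" using i by simp
      note t = tq[OF this, symmetric] tq[OF i(1), symmetric]
      show ?thesis using l qq(3) unfolding t by (intro exI[of _ l]) (simp add: min_def)
    qed
  next
    fix i k i' k' l
    assume N: "i < ?N'" "k < ?N'" "i' < ?N'" "k' < ?N'" and lq: "l < q'"
      and eq: "take l (U' i) = take l (U' k) \<and> U' i ! l \<noteq> U' k ! l \<and>
        take l (U' i') = take l (U' k') \<and> U' i' ! l \<noteq> U' k' ! l"
    \<comment> \<open>Two nodes of the new stage separate either below \<open>q\<close>, as their
      ancestors do, or at \<open>v\<close>.\<close>
    have cases: "(l < q) \<or> (l = length v \<and> take l (U' a) = v)"
      if "a < ?N'" "c < ?N'" "take l (U' a) = take l (U' c)" "U' a ! l \<noteq> U' c ! l" for a c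
    proof (cases "l < q")
      case False
      then have "take q (U' a) = take q (U' c)" using that(3) take_eq_mono by (metis not_less)
      then have pe: "?\<pi> a = ?\<pi> c" using tq that(1,2) Udist \<pi>N by metis
      have "a \<noteq> c" using that(4) by auto
      then have ac: "m \<le> a" "a < m + j" "m \<le> c" "c < m + j"
        using old_index_eqD[OF m(2) pe] old_index_eq_iff[OF m(2), of m a] old_index_eq_iff[OF m(2), of m c] pe by simp_all
      have "es ! (a - m) \<noteq> es ! (c - m)"
        using sorted_lt_distinct[OF es_sorted] ac \<open>a \<noteq> c\<close> es_len by (simp add: nth_eq_iff_index_eq)
      then have tvn: "U' a ! length v \<noteq> U' c ! length v" using tv ac by metis
      have "l = length v"
      proof (rule linorder_cases[of l "length v"])
        assume "l < length v"
        then show ?thesis using take_eq_nth[of "length v" "U' a" "U' c" l] tv ac that(4) by metis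
      next
        assume "length v < l"
        then show ?thesis using take_eq_nth[OF that(3)] tvn by metis
      qed
      then show ?thesis using tv ac by simp
    qed simp
    have c1: "(l < q) \<or> (l = length v \<and> take l (U' i) = v)" using cases[OF N(1,2)] eq by blast
    have c2: "(l < q) \<or> (l = length v \<and> take l (U' i') = v)" using cases[OF N(3,4)] eq by blast
    show "take l (U' i) = take l (U' i')"
    proof (cases "l < q")
      case True
      have tl: "take l (U' a) = take l (U (?\<pi> a))" "U' a ! l = U (?\<pi> a) ! l" if "a < ?N'" for a
        using tq[OF that, symmetric] True by (simp_all add: min_def)
      have "take l (U (?\<pi> i)) = take l (U (?\<pi> i'))"
        using good_stageD(5)[OF I, unfolded skew_nodes_def, rule_format, OF \<pi>N[OF N(1)] \<pi>N[OF N(2)]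
            \<pi>N[OF N(3)] \<pi>N[OF N(4)] True] eq unfolding tl[OF N(1)] tl[OF N(2)] tl[OF N(3)] tl[OF N(4)] by blast
      then show ?thesis by (simp only: tl[OF N(1)] tl[OF N(3)])
    qed (use c1 c2 in auto)
  next
    fix i h assume i: "i < length s" and h: "strict_mono_on {..<p i} h" "h ` {..<p i} \<subseteq> {..<?N'}"
      "has_shape (rev (take i s)) (U' \<circ> h)"
    show "expected (drop i s) (U' \<circ> h) = \<kappa>"
    proof (cases "inj_on (?\<pi> \<circ> h) {..<p i}")
      case False
      then have "i \<noteq> 0" by (cases i) (auto simp: inj_on_def)
      then obtain i0 where "i = Suc i0" by (cases i) auto
      then show ?thesis using new[of i0 h] i h False by simp
    qed (use old[OF i h] in simp)
  qed
  moreover have "good_step m j N U q ?N' U' q'"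
    unfolding good_step_def
  proof (intro conjI m refl qq(3) allI impI exI[of _ v] exI[of _ \<eta>] Uv \<eta>0(1))
    show "clip v = v" by (simp add: v_def)
    show "prefix (U (old_index m j i)) (U' i)" if "i < ?N'" for i by (rule U'U[OF that])
    fix a assume a: "a < j"
    have "es ! a = \<eta> (sorted_letters j ! a)" using a by (simp add: es_def)
    then show "\<eta> (sorted_letters j ! a) \<le> length v" "prefix (v @ [\<eta> (sorted_letters j ! a)]) (U' (m + a))"
      using es_le[OF a] blk[OF a] by simp_all
  next
    fix h assume h: "strict_mono_on {..<p (length s)} h" "h ` {..<p (length s)} \<subseteq> {..<?N'}"
      "has_shape (rev s) (U' \<circ> h)" "\<not> inj_on (old_index m j \<circ> h) {..<p (length s)}"
    have "s \<noteq> []" using h(4) by (auto simp: inj_on_def)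
    then obtain i0 where i0: "length s = Suc i0" by (cases s) auto
    have "expected (drop (Suc i0) s) (U' \<circ> h) = \<kappa>"
      by (rule new) (use h i0 in simp_all)
    then show "d (U' \<circ> h) = \<kappa>" using i0 by simp
  qed
  ultimately show ?thesis by blast
qed

end

section \<open>Scheduling the splittings\<close>

definition task :: "nat \<Rightarrow> nat list \<times> nat" where
  "task t = (case (from_nat t :: nat list \<times> nat \<times> nat) of (v, j, _) \<Rightarrow> (v, j))"

text \<open>The third component of the decoded triple is discarded, which gives each pair infinitely
  many indices.\<close>

lemma task_infinitely_often: "\<exists>t\<ge>t0. task t = (v, j)"
proof -
  define f where "f n = to_nat (v, j, n)" for n :: nat
  have "inj f" unfolding f_def by (auto simp: inj_on_def)
  then have "infinite (range f)" using range_inj_infinite by blast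
  then obtain t where "t \<in> range f" "t0 \<le> t" by (meson infinite_nat_iff_unbounded_le)
  then show ?thesis by (auto simp: task_def f_def)
qed

context colouring
begin

text \<open>Dependent choice driven by \<open>task\<close>: whenever some current node extends the
  requested one, such a node is split, into at least the requested number of copies.\<close>

lemma good_step_sequence:
  obtains N U q m j where "\<And>t. good_stage (N t) (U t) (q t)" "N 0 = 1" "U 0 = (\<lambda>_. [])" "q 0 = 0"
    "\<And>t. good_step (m t) (j t) (N t) (U t) (q t) (N (Suc t)) (U (Suc t)) (q (Suc t))"
    "\<And>t0 i a. i < N t0 \<Longrightarrow> \<exists>t\<ge>t0. a \<le> j t \<and> prefix (U t0 i) (U t (m t))"
proof -
  define P where "P t x = (case x of (N, U, q) \<Rightarrow> good_stage N U q \<and> (t = 0 \<longrightarrow> N = 1 \<and> U = (\<lambda>_. []) \<and> q = 0))"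
    for t :: nat and x :: "nat \<times> (nat \<Rightarrow> nat list) \<times> nat"
  define R where "R t m j x y = (case x of (N, U, q) \<Rightarrow> case y of (N', U', q') \<Rightarrow>
      good_step m j N U q N' U' q' \<and>
      ((\<exists>i<N. prefix (fst (task t)) (U i)) \<longrightarrow> prefix (fst (task t)) (U m) \<and> snd (task t) \<le> j))"
    for t m j and x y :: "nat \<times> (nat \<Rightarrow> nat list) \<times> nat"
  have "\<exists>f. \<forall>t. P t (f t) \<and> (\<exists>m j. R t m j (f t) (f (Suc t)))"
  proof (rule dependent_nat_choice)
    show "\<exists>x. P 0 x" using good_stage_start by (auto simp: P_def)
  next
    fix x t assume "P t x"
    then obtain N U q where x: "x = (N, U, q)" "good_stage N U q" by (auto simp: P_def)
    have "\<exists>m<N. (\<exists>i<N. prefix (fst (task t)) (U i)) \<longrightarrow> prefix (fst (task t)) (U m)"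
      using good_stageD(1)[OF x(2)] by blast
    then obtain m where m: "m < N" "(\<exists>i<N. prefix (fst (task t)) (U i)) \<longrightarrow> prefix (fst (task t)) (U m)" by blast
    \<comment> \<open>\<open>Suc\<close> provides at least one copy even when the task asks for
      none.\<close>
    obtain N' U' q' where "good_stage N' U' q'" "good_step m (Suc (snd (task t))) N U q N' U' q'"
      using good_step_exists[OF x(2) m(1), of "Suc (snd (task t))"] by auto
    then show "\<exists>y. P (Suc t) y \<and> (\<exists>m j. R t m j x y)"
      using m(2) x(1) by (intro exI[of _ "(N', U', q')"] conjI exI[of _ m] exI[of _ "Suc (snd (task t))"])
        (auto simp: P_def R_def)
  qed
  then obtain f where f: "\<And>t. P t (f t)" "\<And>t. \<exists>m j. R t m j (f t) (f (Suc t))" by blast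
  from f(2) obtain m where "\<And>t. \<exists>j. R t (m t) j (f t) (f (Suc t))" by metis
  then obtain j where mj: "\<And>t. R t (m t) (j t) (f t) (f (Suc t))" by metis
  define N where "N t = fst (f t)" for t
  define U where "U t = fst (snd (f t))" for t
  define q where "q t = snd (snd (f t))" for t
  have ft: "f t = (N t, U t, q t)" for t by (simp add: N_def U_def q_def)
  have I: "good_stage (N t) (U t) (q t)" for t using f(1)[of t] by (simp add: P_def ft)
  have S: "good_step (m t) (j t) (N t) (U t) (q t) (N (Suc t)) (U (Suc t)) (q (Suc t))"
    and T: "(\<exists>i<N t. prefix (fst (task t)) (U t i)) \<Longrightarrow> prefix (fst (task t)) (U t (m t)) \<and> snd (task t) \<le> j t" for t
    using mj[of t] by (auto simp: R_def ft)
  \<comment> \<open>Every node has extensions at all later stages and can therefore wait for its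
    task.\<close>
  have extend: "\<exists>i'<N (t0 + n). prefix (U t0 i) (U (t0 + n) i')" if i: "i < N t0" for t0 i n
  proof (induction n)
    case 0
    then show ?case using i by auto
  next
    case (Suc n)
    then obtain i' where i': "i' < N (t0 + n)" "prefix (U t0 i) (U (t0 + n) i')" by blast
    note S' = S[of "t0 + n", unfolded good_step_def]
    let ?k = "new_index (m (t0 + n)) (j (t0 + n)) i'"
    have k: "?k < N (Suc (t0 + n))" "old_index (m (t0 + n)) (j (t0 + n)) ?k = i'"
      using S' i'(1) new_index_less[of "m (t0 + n)" "N (t0 + n)" "j (t0 + n)" i'] old_index_new_index[of "j (t0 + n)" "m (t0 + n)" i'] by auto
    then have "prefix (U (t0 + n) i') (U (Suc (t0 + n)) ?k)" using S' by metis
    then show ?case using i'(2) k(1) prefix_order.trans by (intro exI[of _ ?k]) auto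
  qed
  have "\<exists>t\<ge>t0. a \<le> j t \<and> prefix (U t0 i) (U t (m t))" if i: "i < N t0" for t0 i a
  proof -
    obtain t where t: "t0 \<le> t" "task t = (U t0 i, a)" using task_infinitely_often by blast
    then have "\<exists>i'<N t. prefix (fst (task t)) (U t i')" using extend[OF i, of "t - t0"] by simp
    from T[OF this] show ?thesis using t by auto
  qed
  moreover have "N 0 = 1" "U 0 = (\<lambda>_. [])" "q 0 = 0" using f(1)[of 0] by (auto simp: P_def ft)
  ultimately show ?thesis using that[of N U q m j] I S by blast
qed

end

section \<open>Shapes and splitting levels\<close>

definition splits_at :: "nat \<Rightarrow> nat list \<Rightarrow> nat list \<Rightarrow> bool" where
  "splits_at l u v \<longleftrightarrow> l < length u \<and> l < length v \<and> take l u = take l v \<and> u ! l \<noteq> v ! l"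

lemma splits_at_unique: "splits_at l u v \<Longrightarrow> splits_at l' u v \<Longrightarrow> l = l'"
  unfolding splits_at_def using take_eq_nth linorder_neqE_nat by metis

lemma splits_at_less: "splits_at l u v \<Longrightarrow> take l' u \<noteq> take l' v \<Longrightarrow> l < l'"
  unfolding splits_at_def using take_eq_mono[of l u v l'] by (metis not_less)

lemma splits_at_take: "splits_at l u v \<Longrightarrow> l < l' \<Longrightarrow> splits_at l (take l' u) (take l' v)"
  unfolding splits_at_def by (simp add: min_def)

lemma exists_splits_at:
  assumes "length u = length v" "u \<noteq> v"
  shows "\<exists>l. splits_at l u v"
proof -
  have "\<exists>i. i < length u \<and> u ! i \<noteq> v ! i" using assms nth_equalityI by blast
  then obtain l where l: "l < length u \<and> u ! l \<noteq> v ! l" "\<And>i. i < l \<Longrightarrow> \<not> (i < length u \<and> u ! i \<noteq> v ! i)"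
    using exists_least_iff[of "\<lambda>i. i < length u \<and> u ! i \<noteq> v ! i"] by blast
  then have "take l u = take l v" using assms(1) by (intro nth_equalityI) auto
  then show ?thesis using l assms(1) unfolding splits_at_def by auto
qed

context ramsey_limit
begin

lemma has_shape_valid:
  "has_shape S u \<Longrightarrow> i < length S \<Longrightarrow> fst (S ! i) < arity (drop (Suc i) S) \<and> 2 \<le> length (snd (S ! i)) \<and>
    sorted_wrt lt (snd (S ! i))"
proof (induction S arbitrary: u i)
  case (Cons c S)
  obtain b e where c: "c = (b, e)" by fastforce
  note D = has_shape_ConsD[OF Cons.prems(1)[unfolded c]]
  show ?case
  proof (cases i)
    case (Suc k)
    obtain l where "has_shape S (\<lambda>i. take l (u (new_index b (length e) i)))" using D(4) by blast
    from Cons.IH[OF this, of k] show ?thesis using Suc Cons.prems(2) by simp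
  qed (use D c in simp)
qed simp

lemma has_shape_valid_rev:
  assumes "has_shape (rev s) u" "i < length s"
  shows "fst (s ! i) < arity (rev (take i s)) \<and> 2 \<le> length (snd (s ! i)) \<and> sorted_wrt lt (snd (s ! i))"
proof -
  have "rev s ! (length s - Suc i) = s ! i" using assms(2) by (simp add: rev_nth)
  moreover have "drop (Suc (length s - Suc i)) (rev s) = rev (take i s)"
    using assms(2) by (simp add: drop_rev)
  ultimately show ?thesis using has_shape_valid[OF assms(1), of "length s - Suc i"] assms(2) by simp
qed

text \<open>The construction with the ultrafilters removed: what is left is the growing tree and the
  colour \<open>c\<close> of the tuples completed at each stage. The tuple \<open>u0\<close>
  witnesses that the entries of the shape are legitimate.\<close>

theorem colour_tree:
  fixes d :: "(nat \<Rightarrow> nat list) \<Rightarrow> bool" and s :: "(nat \<times> nat list) list"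
  assumes d: "\<And>u u'. (\<And>i. i < arity (rev s) \<Longrightarrow> u i = u' i) \<Longrightarrow> d u = d u'"
    and s: "has_shape (rev s) u0"
  obtains N U q m j c where "N 0 = 1" "q 0 = 0" "\<And>t. 0 < N t"
    "\<And>t i. i < N t \<Longrightarrow> length (U t i) = q t" "\<And>t i. i < N t \<Longrightarrow> U t i \<in> T_max"
    "\<And>t. increasing_nodes (N t) (U t) (q t)" "\<And>t. skew_nodes (N t) (U t) (q t)"
    "\<And>t. m t < N t" "\<And>t. 1 \<le> j t" "\<And>t. N (Suc t) = N t + j t - 1" "\<And>t. q t < q (Suc t)"
    "\<And>t i. i < N (Suc t) \<Longrightarrow> prefix (U t (old_index (m t) (j t) i)) (U (Suc t) i)"
    "\<And>t. \<exists>v \<eta>. prefix (U t (m t)) v \<and> v \<in> T_max \<and> partial_embedding (j t) \<eta> \<and>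
      (\<forall>a<j t. \<eta> (sorted_letters (j t) ! a) \<le> length v \<and>
         prefix (v @ [\<eta> (sorted_letters (j t) ! a)]) (U (Suc t) (m t + a)))"
    "\<And>t h. strict_mono_on {..<arity (rev s)} h \<Longrightarrow> h ` {..<arity (rev s)} \<subseteq> {..<N (Suc t)} \<Longrightarrow>
      has_shape (rev s) (U (Suc t) \<circ> h) \<Longrightarrow> \<not> inj_on (old_index (m t) (j t) \<circ> h) {..<arity (rev s)} \<Longrightarrow>
      d (U (Suc t) \<circ> h) = c"
    "\<And>t0 i a. i < N t0 \<Longrightarrow> \<exists>t\<ge>t0. a \<le> j t \<and> prefix (U t0 i) (U t (m t))"
proof -
  obtain V :: "(vword \<Rightarrow> bool) \<Rightarrow> bool" where V: "ultra V" "conv V V = V"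
    "\<And>P a b. V (\<lambda>x. P (fill a x)) = V (\<lambda>x. P (fill b x))"
    "\<And>l. V (\<lambda>x. None \<in> set x \<and> l \<le> length (vprefix x))"
    "\<And>p P h. supported p P \<Longrightarrow> strict_mono_on {..<p} h \<Longrightarrow> V (\<lambda>x. P (pull h x)) = V P"
    by (rule invariant_idempotent) (rule that; assumption)
  obtain L :: "((nat \<Rightarrow> nat) \<Rightarrow> bool) \<Rightarrow> bool" where L: "ultra L" "\<And>j. L (partial_embedding j)"
    "\<And>P e e'. sorted_wrt lt e \<Longrightarrow> iso_letters e e' \<Longrightarrow> L (\<lambda>\<eta>. P (map \<eta> e)) = L (\<lambda>\<eta>. P (map \<eta> e'))"
    by (rule letter_ultrafilter) (rule that; assumption)
  interpret C: colouring k K M V L d s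
    by unfold_locales (rule V L d has_shape_valid_rev[OF s]; assumption?)+
  obtain N U q m j where S: "\<And>t. C.good_stage (N t) (U t) (q t)" "N 0 = 1" "U 0 = (\<lambda>_. [])" "q 0 = 0"
    "\<And>t. C.good_step (m t) (j t) (N t) (U t) (q t) (N (Suc t)) (U (Suc t)) (q (Suc t))"
    "\<And>t0 i a. i < N t0 \<Longrightarrow> \<exists>t\<ge>t0. a \<le> j t \<and> prefix (U t0 i) (U t (m t))"
    by (rule C.good_step_sequence) (rule that; assumption)
  note I = C.good_stageD[OF S(1)]
  have clip: "clip v = v \<Longrightarrow> v \<in> T_max" for v using clip_in_T_max[of v] by simp
  have St: "m t < N t" "1 \<le> j t" "N (Suc t) = N t + j t - 1" "q t < q (Suc t)"
    "\<And>i. i < N (Suc t) \<Longrightarrow> prefix (U t (old_index (m t) (j t) i)) (U (Suc t) i)" for t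
    using S(5)[of t] unfolding C.good_step_def by simp_all
  have Sv: "\<exists>v \<eta>. prefix (U t (m t)) v \<and> v \<in> T_max \<and> partial_embedding (j t) \<eta> \<and>
      (\<forall>a<j t. \<eta> (sorted_letters (j t) ! a) \<le> length v \<and>
         prefix (v @ [\<eta> (sorted_letters (j t) ! a)]) (U (Suc t) (m t + a)))" for t
    using S(5)[of t] clip unfolding C.good_step_def by blast
  have Sc: "d (U (Suc t) \<circ> h) = C.\<kappa>" if "strict_mono_on {..<arity (rev s)} h" "h ` {..<arity (rev s)} \<subseteq> {..<N (Suc t)}"
      "has_shape (rev s) (U (Suc t) \<circ> h)" "\<not> inj_on (old_index (m t) (j t) \<circ> h) {..<arity (rev s)}" for t h
    using S(5)[of t] that unfolding C.good_step_def by simp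
  show ?thesis
    by (rule that[of N q U m j C.\<kappa>, OF S(2,4) I(1,2) clip[OF I(3)] I(4,5) St Sv Sc S(6)])
qed

text \<open>A shape depends only on the order in which splitting levels follow each other and on the
  relative positions of the letters there. Any two members of the last block separate at one level
  and all other pairs below it; comparing \<open>D\<close> with \<open>D'\<close> carries both facts
  over. The number of relations is called \<open>k'\<close> because \<open>k\<close> is bound as a
  coordinate.\<close>

lemma has_shape_transfer:
  assumes "has_shape s u" "\<And>i. i < arity s \<Longrightarrow> length (v i) = Q"
    "\<And>i k. i < arity s \<Longrightarrow> k < arity s \<Longrightarrow> i \<noteq> k \<Longrightarrow> splits_at (D i k) (u i) (u k) \<and> splits_at (D' i k) (v i) (v k) \<and>
       (lt (u i ! D i k) (u k ! D i k) \<longleftrightarrow> lt (v i ! D' i k) (v k ! D' i k)) \<and>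
       (\<forall>l<k'. rel M l (u i ! D i k) (u k ! D i k) \<longleftrightarrow> rel M l (v i ! D' i k) (v k ! D' i k))"
    "\<And>i k i' k'. i < arity s \<Longrightarrow> k < arity s \<Longrightarrow> i \<noteq> k \<Longrightarrow> i' < arity s \<Longrightarrow> k' < arity s \<Longrightarrow> i' \<noteq> k' \<Longrightarrow>
       D i k \<le> D i' k' \<longleftrightarrow> D' i k \<le> D' i' k'"
    and k': "k' = k"
  shows "has_shape s v"
  using assms(1-4)
proof (induction s arbitrary: u v Q D D')
  case (Cons c s)
  obtain b e where c: "c = (b, e)" by fastforce
  let ?r = "length e" and ?p = "arity s + length e - 1"
  have p: "arity (c # s) = ?p" by (simp add: c)
  note sp = Cons.prems(3)[unfolded p] and le = Cons.prems(4)[unfolded p]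
  note E = has_shape_ConsD[OF Cons.prems(1)[unfolded c]]
  obtain l where "\<forall>i<?p. l < length (u i)"
    "\<forall>i<?p. take l (u i) = take l (u (new_index b ?r (old_index b ?r i)))"
    "has_shape s (\<lambda>i. take l (u (new_index b ?r i)))" "iso_letters e (map (\<lambda>i. u (b + i) ! l) [0..<?r])"
    using E(4) by (elim exE conjE)
  then have l: "\<And>i. i < ?p \<Longrightarrow> l < length (u i)"
    "\<And>i. i < ?p \<Longrightarrow> take l (u i) = take l (u (new_index b ?r (old_index b ?r i)))"
    "has_shape s (\<lambda>i. take l (u (new_index b ?r i)))" "iso_letters e (map (\<lambda>i. u (b + i) ! l) [0..<?r])"
    by blast+
  have r: "1 \<le> ?r" using E(2) by simp
  have bb: "b < ?p" "Suc b < ?p" "old_index b ?r b = b" "old_index b ?r (Suc b) = b" "new_index b ?r b = b"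
    using E(1,2) by (auto simp: old_index_def new_index_def)
  have Dl: "D i i' = l" if "i < ?p" "i' < ?p" "i \<noteq> i'" "old_index b ?r i = b" "old_index b ?r i' = b" for i i'
  proof -
    have bi: "b \<le> i" "i < b + ?r" "b \<le> i'" "i' < b + ?r" using that(4,5) by (simp_all add: old_index_eq_iff[OF r])
    have "u (b + (i - b)) ! l \<noteq> u (b + (i' - b)) ! l"
      using iso_letters_nth_neq[OF E(3) l(4), of "i - b" "i' - b"] bi that(3) by simp
    moreover have "take l (u i) = take l (u i')" using l(2)[OF that(1)] l(2)[OF that(2)] that by simp
    ultimately have "splits_at l (u i) (u i')" using bi l(1) that by (simp add: splits_at_def)
    then show ?thesis using splits_at_unique sp[OF that(1-3)] by blast
  qed
  \<comment> \<open>The level of the last splitting of \<open>v\<close>, read off from the first two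
    members of the block.\<close>
  define l' where "l' = D' b (Suc b)"
  have D'l: "D' i i' = l'" if "i < ?p" "i' < ?p" "i \<noteq> i'" "old_index b ?r i = b" "old_index b ?r i' = b" for i i'
    using le[OF that(1-3) bb(1,2)] le[OF bb(1,2) _ that(1-3)] Dl[OF that] Dl[OF bb(1,2) _ bb(3,4)]
    unfolding l'_def by auto
  have pjl: "old_index b ?r i < arity s" if "i < ?p" for i using old_index_less[OF E(1) r that] .
  have Dless: "D i i' < l" "D' i i' < l'" if "i < ?p" "i' < ?p" "old_index b ?r i \<noteq> old_index b ?r i'" for i i'
  proof -
    have ne: "i \<noteq> i'" using that(3) by auto
    have "take l (u i) \<noteq> take l (u i')"
      using has_shape_distinct[OF l(3) pjl[OF that(1)] pjl[OF that(2)] that(3)] l(2)[OF that(1)] l(2)[OF that(2)] by simp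
    then show "D i i' < l" using splits_at_less sp[OF that(1,2) ne] by blast
    then show "D' i i' < l'"
      using le[OF bb(1,2) _ that(1,2) ne] Dl[OF bb(1,2) _ bb(3,4)] unfolding l'_def by auto
  qed
  have Q: "length (v i) = Q" if "i < ?p" for i using Cons.prems(2) that p by simp
  have l'Q: "l' < Q" using sp[OF bb(1,2)] Q[OF bb(1)] unfolding l'_def splits_at_def by simp
  show ?case
    unfolding c
  proof (rule has_shape_ConsI[OF E(1-3), where l = l'])
    show "l' < length (v i)" if "i < ?p" for i using l'Q Q[OF that] by simp
    show "take l' (v i) = take l' (v (new_index b ?r (old_index b ?r i)))" if i: "i < ?p" for i
    proof (cases "old_index b ?r i = b \<and> i \<noteq> b")
      case True
      then have "D' i b = l'" using D'l[OF i bb(1)] bb(3) by simp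
      then show ?thesis using sp[OF i bb(1)] True bb(5) by (auto simp: splits_at_def)
    next
      case False
      then show ?thesis using new_index_old_index[OF r, of b i] bb(3,5) by (cases "i = b") auto
    qed
    show "has_shape s (\<lambda>i. take l' (v (new_index b ?r i)))"
    proof (rule Cons.IH[OF l(3), where Q = l' and D = "\<lambda>i k. D (new_index b ?r i) (new_index b ?r k)"
          and D' = "\<lambda>i k. D' (new_index b ?r i) (new_index b ?r k)"])
      have sgp: "new_index b ?r i < ?p" if "i < arity s" for i using new_index_less[OF E(1) r that] .
      show "length (take l' (v (new_index b ?r i))) = l'" if "i < arity s" for i
        using Q[OF sgp[OF that]] l'Q by simp
      fix i i' assume i: "i < arity s" "i' < arity s" "i \<noteq> i'"
      then have ne: "new_index b ?r i \<noteq> new_index b ?r i'" "old_index b ?r (new_index b ?r i) \<noteq> old_index b ?r (new_index b ?r i')"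
        using old_index_new_index[OF r] by metis+
      note S = sp[OF sgp[OF i(1)] sgp[OF i(2)] ne(1)] and Ls = Dless[OF sgp[OF i(1)] sgp[OF i(2)] ne(2)]
      show "splits_at (D (new_index b ?r i) (new_index b ?r i')) (take l (u (new_index b ?r i))) (take l (u (new_index b ?r i'))) \<and>
        splits_at (D' (new_index b ?r i) (new_index b ?r i')) (take l' (v (new_index b ?r i))) (take l' (v (new_index b ?r i'))) \<and>
        (lt (take l (u (new_index b ?r i)) ! D (new_index b ?r i) (new_index b ?r i')) (take l (u (new_index b ?r i')) ! D (new_index b ?r i) (new_index b ?r i')) \<longleftrightarrow>
         lt (take l' (v (new_index b ?r i)) ! D' (new_index b ?r i) (new_index b ?r i')) (take l' (v (new_index b ?r i')) ! D' (new_index b ?r i) (new_index b ?r i'))) \<and>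
        (\<forall>m<k'. rel M m (take l (u (new_index b ?r i)) ! D (new_index b ?r i) (new_index b ?r i')) (take l (u (new_index b ?r i')) ! D (new_index b ?r i) (new_index b ?r i')) \<longleftrightarrow>
         rel M m (take l' (v (new_index b ?r i)) ! D' (new_index b ?r i) (new_index b ?r i')) (take l' (v (new_index b ?r i')) ! D' (new_index b ?r i) (new_index b ?r i')))"
        using S Ls splits_at_take by simp
      fix a a' assume a: "a < arity s" "a' < arity s" "a \<noteq> a'"
      then have ane: "new_index b ?r a \<noteq> new_index b ?r a'" using old_index_new_index[OF r] by metis
      show "D (new_index b ?r i) (new_index b ?r i') \<le> D (new_index b ?r a) (new_index b ?r a') \<longleftrightarrow>
          D' (new_index b ?r i) (new_index b ?r i') \<le> D' (new_index b ?r a) (new_index b ?r a')"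
        by (rule le[OF sgp[OF i(1)] sgp[OF i(2)] ne(1) sgp[OF a(1)] sgp[OF a(2)] ane])
    qed
    show "iso_letters e (map (\<lambda>i. v (b + i) ! l') [0..<?r])"
      unfolding iso_letters_def
    proof (intro conjI allI impI)
      fix i i' assume i: "i < ?r" "i' < ?r" "i \<noteq> i'"
      then have p': "b + i < ?p" "b + i' < ?p" "b + i \<noteq> b + i'" "old_index b ?r (b + i) = b" "old_index b ?r (b + i') = b"
        using E(1) by (auto simp: old_index_def)
      note S = sp[OF p'(1-3)] and I = l(4)[unfolded iso_letters_def]
      show "lt (e ! i) (e ! i') \<longleftrightarrow> lt (map (\<lambda>i. v (b + i) ! l') [0..<?r] ! i) (map (\<lambda>i. v (b + i) ! l') [0..<?r] ! i')"
        using I S i Dl[OF p'] D'l[OF p'] by simp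
      show "rel M m (e ! i) (e ! i') \<longleftrightarrow> rel M m (map (\<lambda>i. v (b + i) ! l') [0..<?r] ! i) (map (\<lambda>i. v (b + i) ! l') [0..<?r] ! i')"
        if "m < k" for m
        using I S i Dl[OF p'] D'l[OF p'] that k' by simp
    qed simp
  qed
qed simp

text \<open>The highest splitting is undone. Skewness puts it at a single node, and the coordinates
  through this node form an interval because the tuple is increasing; replacing them by one
  coordinate gives a shorter tuple.\<close>

lemma has_shape_exists:
  assumes "1 \<le> n"
    "\<And>i k. i < n \<Longrightarrow> k < n \<Longrightarrow> i \<noteq> k \<Longrightarrow> splits_at (D i k) (u i) (u k)"
    "\<And>i k. i < k \<Longrightarrow> k < n \<Longrightarrow> lt (u i ! D i k) (u k ! D i k)"
    "\<And>i k i' k'. i < n \<Longrightarrow> k < n \<Longrightarrow> i \<noteq> k \<Longrightarrow> i' < n \<Longrightarrow> k' < n \<Longrightarrow> i' \<noteq> k' \<Longrightarrow> D i k = D i' k' \<Longrightarrow>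
       take (D i k) (u i) = take (D i k) (u i')"
    "\<And>i. i < n \<Longrightarrow> length (u i) = Q"
  shows "\<exists>s. arity s = n \<and> has_shape s u"
  using assms
proof (induction n arbitrary: u D Q rule: less_induct)
  case (less n)
  note sp = less.prems(2) and lt = less.prems(3) and skew = less.prems(4) and len = less.prems(5)
  show ?case
  proof (cases "n = 1")
    case True
    then show ?thesis by (intro exI[of _ "[]"]) simp
  next
    case False
    then have n2: "2 \<le> n" using less.prems(1) by simp
    let ?P = "{(i, k). i < n \<and> k < n \<and> i \<noteq> k}"
    have "?P \<subseteq> {..<n} \<times> {..<n}" by auto
    then have finP: "finite ?P" by (rule finite_subset) simp
    have "(0, 1) \<in> ?P" using n2 by simp
    define l where "l = Max ((\<lambda>(i, k). D i k) ` ?P)"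
    have Dle: "D i k \<le> l" if "i < n" "k < n" "i \<noteq> k" for i k
      unfolding l_def using finP that by (intro Max_ge) auto
    have "l \<in> (\<lambda>(i, k). D i k) ` ?P"
      unfolding l_def using finP \<open>(0, 1) \<in> ?P\<close> by (intro Max_in) auto
    then obtain i0 k0 where i0: "i0 < n" "k0 < n" "i0 \<noteq> k0" "D i0 k0 = l" by auto
    define B where "B = {i. i < n \<and> take l (u i) = take l (u i0)}"
    have finB: "finite B" unfolding B_def by simp
    have i0B: "i0 \<in> B" using i0(1) by (simp add: B_def)
    have k0B: "k0 \<in> B" using sp[OF i0(1-3)] i0 by (simp add: B_def splits_at_def)
    define b where "b = Min B"
    define r where "r = Suc (Max B) - b"
    have bB: "b \<in> B" "Max B \<in> B" unfolding b_def using finB i0B by (auto intro: Min_in Max_in)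
    have bMax: "b \<le> i" "i \<le> Max B" if "i \<in> B" for i unfolding b_def using finB that by auto
    \<comment> \<open>An outsider \<open>i\<close> between \<open>b\<close> and \<open>Max B\<close>
      would separate from both at the same level below \<open>l\<close>, where the two have the same
      letter; then it would lie on the same side of both.\<close>
    have conv: "i \<in> B" if "b \<le> i" "i \<le> Max B" for i
    proof (rule ccontr)
      assume "i \<notin> B"
      have lts: "b < i" "i < Max B" using that bB \<open>i \<notin> B\<close> by (metis le_neq_implies_less)+
      have bn: "b < n" "Max B < n" "i < n" using bB lts by (auto simp: B_def)
      have tl: "take l (u b) = take l (u (Max B))" "take l (u b) \<noteq> take l (u i)"
        using bB \<open>i \<notin> B\<close> bn by (auto simp: B_def)
      have s1: "splits_at (D b i) (u b) (u i)" using sp bn lts by simp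
      have dl: "D b i < l" using splits_at_less[OF s1 tl(2)] .
      have same: "take (D b i) (u b) = take (D b i) (u (Max B))" "u b ! D b i = u (Max B) ! D b i"
        using take_eq_mono[OF tl(1)] take_eq_nth[OF tl(1) dl] dl by auto
      have "splits_at (D b i) (u i) (u (Max B))"
        using s1 same len[OF bn(2)] len[OF bn(1)] by (auto simp: splits_at_def)
      then have "D i (Max B) = D b i" using splits_at_unique sp[of i "Max B"] bn lts by blast
      then have "lt (u i ! D b i) (u b ! D b i)" using lt[of i "Max B"] lts bn same by simp
      then show False using lt[of b i] lts bn lt_asym by blast
    qed
    have br: "b + r = Suc (Max B)" using bMax(1)[OF bB(2)] by (simp add: r_def)
    have Beq: "i \<in> B \<longleftrightarrow> b \<le> i \<and> i < b + r" for i
      using conv[of i] bMax[of i] unfolding br less_Suc_eq_le by blast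
    have r2: "2 \<le> r"
    proof -
      have "i0 \<noteq> k0" "b \<le> i0" "i0 < b + r" "b \<le> k0" "k0 < b + r" using i0 i0B k0B Beq by auto
      then show ?thesis by linarith
    qed
    then have r1: "1 \<le> r" by simp
    have bn: "b + r \<le> n" using bB(2) bMax(1)[OF bB(2)] by (auto simp: r_def B_def)
    define n' where "n' = n + 1 - r"
    have n': "n' + r - 1 = n" "b < n'" "1 \<le> n'" "n' < n" using bn r2 by (auto simp: n'_def)
    have pjB: "old_index b r i = b \<longleftrightarrow> i \<in> B" for i by (simp add: old_index_eq_iff[OF r1] Beq)
    have Dblk: "D i i' = l" if "i \<in> B" "i' \<in> B" "i \<noteq> i'" for i i'
    proof -
      have "i < n" "i' < n" "take l (u i) = take l (u i')" using that by (auto simp: B_def)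
      then have S: "splits_at (D i i') (u i) (u i')" "D i i' \<le> l" "take l (u i) = take l (u i')"
        using sp Dle that(3) by simp_all
      have "\<not> D i i' < l" using S(1) take_eq_nth[OF S(3), of "D i i'"] by (auto simp: splits_at_def)
      then show ?thesis using S(2) by simp
    qed
    have Dfar: "D i i' < l" if "i < n" "i' < n" "old_index b r i \<noteq> old_index b r i'" for i i'
    proof -
      have ne: "i \<noteq> i'" using that(3) by auto
      have "D i i' \<noteq> l"
      proof
        assume eq: "D i i' = l"
        have "take l (u i) = take l (u i0)" using skew[OF that(1,2) ne i0(1-3)] eq i0(4) by simp
        moreover have "take l (u i) = take l (u i')" using sp[OF that(1,2) ne] eq by (simp add: splits_at_def)
        ultimately have "i \<in> B" "i' \<in> B" using that by (auto simp: B_def)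
        then show False using pjB that(3) by metis
      qed
      then show ?thesis using Dle[OF that(1,2) ne] by simp
    qed
    have sgn: "new_index b r i < n" if "i < n'" for i using new_index_less[OF n'(2) r1 that] n'(1) by simp
    have sgne: "new_index b r i \<noteq> new_index b r k" "old_index b r (new_index b r i) \<noteq> old_index b r (new_index b r k)" if "i \<noteq> k" for i k
      using old_index_new_index[OF r1, of b i] old_index_new_index[OF r1, of b k] that by auto
    let ?u = "\<lambda>i. take l (u (new_index b r i))" and ?D = "\<lambda>i k. D (new_index b r i) (new_index b r k)"
    have lQ: "l < Q" using sp[OF i0(1-3)] i0(4) len[OF i0(1)] by (simp add: splits_at_def)
    have "\<exists>s. arity s = n' \<and> has_shape s ?u"
    proof (rule less.IH[OF n'(4,3), where D = ?D and Q = l])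
      fix i k assume ik: "i < n'" "k < n'" "i \<noteq> k"
      note D = Dfar[OF sgn[OF ik(1)] sgn[OF ik(2)] sgne(2)[OF ik(3)]]
      show "splits_at (?D i k) (?u i) (?u k)"
        by (rule splits_at_take[OF sp[OF sgn[OF ik(1)] sgn[OF ik(2)] sgne(1)[OF ik(3)]] D])
      fix i' k' assume ik': "i' < n'" "k' < n'" "i' \<noteq> k'" and eq: "?D i k = ?D i' k'"
      show "take (?D i k) (?u i) = take (?D i k) (?u i')"
        using skew[OF sgn[OF ik(1)] sgn[OF ik(2)] sgne(1)[OF ik(3)] sgn[OF ik'(1)] sgn[OF ik'(2)] sgne(1)[OF ik'(3)] eq]
          D by (simp add: min_def)
    next
      fix i k assume ik: "i < k" "k < n'"
      then have D: "?D i k < l" using Dfar sgn sgne(2) by simp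
      show "lt (?u i ! ?D i k) (?u k ! ?D i k)"
        using lt[OF new_index_strict_mono[OF r1 ik(1)] sgn[OF ik(2)]] D by simp
    next
      show "length (?u i) = l" if "i < n'" for i using len[OF sgn[OF that]] lQ by simp
    qed
    then obtain s where s: "arity s = n'" "has_shape s ?u" by blast
    define e where "e = map (\<lambda>i. u (b + i) ! l) [0..<r]"
    have er: "length e = r" by (simp add: e_def)
    have blkn: "b + i < n" "b + i \<in> B" if "i < r" for i using that bn Beq by auto
    have es: "sorted_wrt lt e"
      unfolding sorted_wrt_iff_nth_less er
    proof (intro allI impI)
      fix i k assume ik: "i < k" "k < r"
      then show "lt (e ! i) (e ! k)"
        using lt[of "b + i" "b + k"] blkn Dblk[of "b + i" "b + k"] by (simp add: e_def)
    qed
    have "has_shape ((b, e) # s) u"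
    proof (rule has_shape_ConsI[where l = l])
      show "b < arity s" "2 \<le> length e" "sorted_wrt lt e" using s n' r2 er es by simp_all
      show "l < length (u i)" if "i < arity s + length e - 1" for i
        using that len lQ n'(1) by (simp add: s er)
      show "take l (u i) = take l (u (new_index b (length e) (old_index b (length e) i)))" if "i < arity s + length e - 1" for i
      proof (cases "old_index b r i = b")
        case True
        have "new_index b r b = b" by (simp add: new_index_def)
        then show ?thesis using True bB(1) pjB[of i] by (simp add: er B_def)
      qed (use new_index_old_index[OF r1] er in simp)
      show "has_shape s (\<lambda>i. take l (u (new_index b (length e) i)))" using s(2) by (simp add: er)
      show "iso_letters e (map (\<lambda>i. u (b + i) ! l) [0..<length e])"
        unfolding er e_def[symmetric] by (simp add: iso_letters_def)
    qed
    moreover have "arity ((b, e) # s) = n" using n'(1) s(1) er by simp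
    ultimately show ?thesis by blast
  qed
qed

end

section \<open>Baire measurable colourings\<close>

lemma length_restr [simp]: "length (restr x n) = n"
  by (simp add: restr_def)

lemma nth_restr [simp]: "i < n \<Longrightarrow> restr x n ! i = x i"
  by (simp add: restr_def)

lemma take_restr: "m \<le> n \<Longrightarrow> take m (restr x n) = restr x m"
  by (simp add: list_eq_iff_nth_eq)

lemma prefix_restr: "m \<le> n \<Longrightarrow> prefix (restr x m) (restr x n)"
  using take_is_prefix[of m "restr x n"] by (simp add: take_restr)

lemma restr_eq_iff: "restr x n = restr y n \<longleftrightarrow> (\<forall>i<n. x i = y i)"
  by (auto simp: list_eq_iff_nth_eq)

definition through :: "(nat \<Rightarrow> nat) \<Rightarrow> nat list \<Rightarrow> bool" where
  "through y t \<longleftrightarrow> restr y (length t) = t"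

lemma through_restr [simp]: "through y (restr y n)"
  by (simp add: through_def)

lemma through_prefix: "through y t \<Longrightarrow> prefix s t \<Longrightarrow> through y s"
  unfolding through_def prefix_def by (auto simp: list_eq_iff_nth_eq nth_append)

lemma through_comparable: "through y s \<Longrightarrow> through y t \<Longrightarrow> prefix s t \<or> prefix t s"
  unfolding through_def using prefix_restr nle_le by metis

lemma open_contains_cylinder:
  assumes "open O'" "y \<in> O'"
  obtains m where "\<And>x :: nat \<Rightarrow> nat. restr x m = restr y m \<Longrightarrow> x \<in> O'"
proof -
  have "openin (product_topology (\<lambda>_ :: nat. euclidean :: nat topology) UNIV) O'"
    using assms(1) by (simp add: euclidean_product_topology)
  from product_topology_open_contains_basis[OF this assms(2)]
  obtain X where X: "y \<in> (\<Pi>\<^sub>E i\<in>UNIV. X i)" "finite {i. X i \<noteq> (UNIV :: nat set)}" "(\<Pi>\<^sub>E i\<in>UNIV. X i) \<subseteq> O'"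
    by auto
  define m where "m = Suc (Max (insert 0 {i. X i \<noteq> (UNIV :: nat set)}))"
  have m: "i < m" if "X i \<noteq> UNIV" for i
    unfolding m_def using X(2) that by (intro le_imp_less_Suc Max_ge) auto
  show ?thesis
  proof (rule that[of m])
    fix x assume x: "restr x m = restr y m"
    have "x i \<in> X i" for i
    proof (cases "X i = UNIV")
      case False
      then have "x i = y i" using m x by (simp add: restr_eq_iff)
      then show ?thesis using X(1) by (auto simp: PiE_iff)
    qed simp
    then show "x \<in> O'" using X(3) by (auto simp: PiE_iff)
  qed
qed

lemma open_through: "open {x. through x t}"
proof -
  have "open ((\<lambda>x :: nat \<Rightarrow> nat. x m) -` {a})" for m a
    by (rule open_vimage[OF open_discrete continuous_on_product_coordinates])
  then have "open (\<Inter>m\<in>{..<length t}. (\<lambda>x :: nat \<Rightarrow> nat. x m) -` {t ! m})"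
    by (intro open_INT) auto
  moreover have "(\<Inter>m\<in>{..<length t}. (\<lambda>x. x m) -` {t ! m}) = {x. through x t}"
    by (auto simp: through_def list_eq_iff_nth_eq)
  ultimately show ?thesis by simp
qed

lemma nowhere_dense_in_empty: "nowhere_dense_in X {}"
  by (simp add: nowhere_dense_in_def)

definition incomparable :: "'w set \<Rightarrow> ('w \<Rightarrow> nat list) \<Rightarrow> bool" where
  "incomparable V g \<longleftrightarrow> (\<forall>v\<in>V. \<forall>w\<in>V. v \<noteq> w \<longrightarrow> \<not> prefix (g v) (g w))"

lemma incomparableD:
  assumes "incomparable V g" "v \<in> V" "w \<in> V" "prefix (g v) (g w) \<or> prefix (g w) (g v)"
  shows "v = w"
  using assms unfolding incomparable_def by metis

lemma incomparable_extend:
  assumes "incomparable V g" "\<And>v. v \<in> V \<Longrightarrow> prefix (g v) (g' v)"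
  shows "incomparable V g'"
  unfolding incomparable_def
proof (intro ballI impI notI)
  fix v w assume vw: "v \<in> V" "w \<in> V" "v \<noteq> w" "prefix (g' v) (g' w)"
  then have "prefix (g v) (g' w)" "prefix (g w) (g' w)" using assms(2) prefix_order.trans by blast+
  then have "prefix (g v) (g w) \<or> prefix (g w) (g v)" by (rule prefix_same_cases)
  then show False using incomparableD[OF assms(1) vw(1,2)] vw(3) by simp
qed

section \<open>The space of sets of \<open>n\<close> branches\<close>

locale subset_space =
  fixes T :: "nat list set" and n :: nat and \<S> :: "(nat \<Rightarrow> nat) set set"
  assumes T: "T \<subseteq> T_max"
    and \<S>: "\<And>B. B \<in> \<S> \<Longrightarrow> B \<subseteq> branches T \<and> finite B \<and> card B = n"
begin

definition X :: "(nat \<Rightarrow> nat) set topology" where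
  "X = subtopology (n_subsets_topology n) \<S>"

lemma branches_T: "branches T \<subseteq> branches T_max"
  using T by (auto simp: branches_def)

lemma topspace_X: "topspace X = \<S>"
proof -
  have "\<S> \<subseteq> {B. B \<subseteq> branches T_max \<and> finite B \<and> card B = n}" using \<S> branches_T by blast
  then show ?thesis by (auto simp: X_def topspace_n_subsets_topology)
qed

text \<open>For \<open>n\<close> incomparable nodes these serve as basic open sets of the
  space.\<close>

definition transversals :: "('w \<Rightarrow> nat list) \<Rightarrow> 'w set \<Rightarrow> (nat \<Rightarrow> nat) set set" where
  "transversals g V = {B \<in> \<S>. \<forall>v\<in>V. \<exists>!y. y \<in> B \<and> through y (g v)}"

text \<open>There are as many incomparable nodes as members of \<open>B\<close>, so choosing the
  member through each node is a bijection from \<open>V\<close> to \<open>B\<close>.\<close>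

lemma representatives:
  assumes B: "finite B" "card B = n" "\<And>v. v \<in> V \<Longrightarrow> \<exists>!y. y \<in> B \<and> through y (g v)"
    and V: "incomparable V g" "finite V" "card V = n"
  obtains f where "f ` V = B" "\<And>v. v \<in> V \<Longrightarrow> f v \<in> B" "\<And>v. v \<in> V \<Longrightarrow> through (f v) (g v)"
    "\<And>v w. v \<in> V \<Longrightarrow> w \<in> V \<Longrightarrow> through (f w) (g v) \<Longrightarrow> v = w"
    "\<And>v y. v \<in> V \<Longrightarrow> y \<in> B \<Longrightarrow> through y (g v) \<Longrightarrow> y = f v"
proof -
  define f where "f v = (THE y. y \<in> B \<and> through y (g v))" for v
  have f: "f v \<in> B" "through (f v) (g v)" if "v \<in> V" for v
    using theI'[OF B(3)[OF that]] by (simp_all add: f_def)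
  have u: "y = f v" if "v \<in> V" "y \<in> B" "through y (g v)" for v y
    using B(3)[OF that(1)] f[OF that(1)] that(2,3) by metis
  have i: "v = w" if "v \<in> V" "w \<in> V" "through (f w) (g v)" for v w
    by (rule incomparableD[OF V(1) that(1,2) through_comparable[OF that(3) f(2)[OF that(2)]]])
  have "inj_on f V"
  proof (rule inj_onI)
    fix v w assume vw: "v \<in> V" "w \<in> V" "f v = f w"
    then show "v = w" using i[OF vw(1,2)] f(2)[OF vw(1)] by simp
  qed
  then have fV: "f ` V = B" using B(1,2) V(3) f(1) by (intro card_subset_eq) (auto simp: card_image)
  show ?thesis by (rule that[OF fV f i u])
qed

lemma open_transversals:
  assumes V: "incomparable V g" "finite V" "card V = n"
  shows "openin X (transversals g V)"
proof -
  define \<U> where "\<U> = {B. B \<subseteq> branches T_max \<and> finite B \<and> card B = n \<and> (\<forall>v\<in>V. \<exists>!y. y \<in> B \<and> through y (g v))}"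
  have "n_subsets_open n \<U>"
    unfolding n_subsets_open_def
  proof (intro conjI ballI)
    show "\<U> \<subseteq> {A. A \<subseteq> branches T_max \<and> finite A \<and> card A = n}" by (auto simp: \<U>_def)
    fix B assume "B \<in> \<U>"
    then have B: "B \<subseteq> branches T_max" "finite B" "card B = n"
      "\<And>v. v \<in> V \<Longrightarrow> \<exists>!y. y \<in> B \<and> through y (g v)" by (simp_all add: \<U>_def)
    obtain f where f: "f ` V = B" "\<And>v. v \<in> V \<Longrightarrow> f v \<in> B" "\<And>v. v \<in> V \<Longrightarrow> through (f v) (g v)"
      "\<And>v w. v \<in> V \<Longrightarrow> w \<in> V \<Longrightarrow> through (f w) (g v) \<Longrightarrow> v = w"
      "\<And>v y. v \<in> V \<Longrightarrow> y \<in> B \<Longrightarrow> through y (g v) \<Longrightarrow> y = f v"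
      by (rule representatives[OF B(2-4) V]) (assumption | rule that; assumption)+
    define U where "U a = {x \<in> branches T_max. \<exists>v\<in>V. a = f v \<and> through x (g v)}" for a
    have Uf: "U (f v) = {x \<in> branches T_max. through x (g v)}" if "v \<in> V" for v
      unfolding U_def using that f(3,4) by fastforce
    show "\<exists>U. (\<forall>a\<in>B. openin (top_of_set (branches T_max)) (U a) \<and> a \<in> U a) \<and> disjoint_family_on U B \<and>
      (\<forall>B'. B' \<subseteq> branches T_max \<and> finite B' \<and> card B' = n \<and> (\<forall>a\<in>B. \<exists>!b. b \<in> B' \<and> b \<in> U a) \<longrightarrow> B' \<in> \<U>)"
    proof (intro exI[of _ U] conjI ballI allI impI)
      fix a assume "a \<in> B"
      then obtain v where v: "v \<in> V" "a = f v" using f(1) by blast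
      have "U a = branches T_max \<inter> {x. through x (g v)}" using Uf v by auto
      then show "openin (top_of_set (branches T_max)) (U a)" using open_through by (simp add: openin_open_Int)
      show "a \<in> U a" using v f(3) \<open>a \<in> B\<close> B(1) Uf[OF v(1)] by auto
    next
      show "disjoint_family_on U B"
        unfolding disjoint_family_on_def
      proof (intro ballI impI, rule ccontr)
        fix a a' assume a: "a \<in> B" "a' \<in> B" "a \<noteq> a'" "U a \<inter> U a' \<noteq> {}"
        then obtain v v' where v: "v \<in> V" "a = f v" "v' \<in> V" "a' = f v'" using f(1) by blast
        then obtain x where "through x (g v)" "through x (g v')" using a(4) Uf by auto
        then have "prefix (g v) (g v') \<or> prefix (g v') (g v)" by (rule through_comparable)
        then show False using incomparableD[OF V(1) v(1,3)] v(2,4) a(3) by simp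
      qed
    next
      fix B' assume B': "B' \<subseteq> branches T_max \<and> finite B' \<and> card B' = n \<and> (\<forall>a\<in>B. \<exists>!b. b \<in> B' \<and> b \<in> U a)"
      have "\<exists>!y. y \<in> B' \<and> through y (g v)" if v: "v \<in> V" for v
      proof -
        have "\<exists>!b. b \<in> B' \<and> b \<in> U (f v)" using B' f(2)[OF v] by blast
        then show ?thesis using Uf[OF v] B' by (metis (no_types, lifting) mem_Collect_eq subsetD)
      qed
      then show "B' \<in> \<U>" using B' by (simp add: \<U>_def)
    qed
  qed
  moreover have "transversals g V = \<U> \<inter> \<S>" unfolding transversals_def \<U>_def using \<S> branches_T by fastforce
  ultimately show ?thesis
    unfolding X_def openin_subtopology openin_n_subsets_topology by blast
qed

text \<open>Whatever has been decided or avoided for some nodes stays so when the nodes are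
  extended.\<close>

lemma transversals_mono:
  assumes V: "incomparable V g" "finite V" "card V = n" and extend: "\<And>v. v \<in> V \<Longrightarrow> prefix (g v) (g' v)"
  shows "transversals g' V \<subseteq> transversals g V"
proof
  fix B assume "B \<in> transversals g' V"
  then have B: "B \<in> \<S>" "\<And>v. v \<in> V \<Longrightarrow> \<exists>!y. y \<in> B \<and> through y (g' v)" by (auto simp: transversals_def)
  have fin: "finite B" "card B = n" using \<S>[OF B(1)] by auto
  obtain f where f: "f ` V = B" "\<And>v. v \<in> V \<Longrightarrow> f v \<in> B" "\<And>v. v \<in> V \<Longrightarrow> through (f v) (g' v)"
    "\<And>v w. v \<in> V \<Longrightarrow> w \<in> V \<Longrightarrow> through (f w) (g' v) \<Longrightarrow> v = w"
    "\<And>v y. v \<in> V \<Longrightarrow> y \<in> B \<Longrightarrow> through y (g' v) \<Longrightarrow> y = f v"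
    by (rule representatives[OF fin B(2) incomparable_extend[OF V(1) extend] V(2,3)])
      (assumption | rule that; assumption)+
  have "\<exists>!y. y \<in> B \<and> through y (g v)" if v: "v \<in> V" for v
  proof (rule ex1I[of _ "f v"])
    show "f v \<in> B \<and> through (f v) (g v)"
      using f(2)[OF v] through_prefix[OF f(3)[OF v] extend[OF v]] by simp
    fix y assume y: "y \<in> B \<and> through y (g v)"
    then obtain w where w: "w \<in> V" "y = f w" using f(1) by blast
    then have "through y (g w)" using through_prefix[OF f(3)[OF w(1)] extend[OF w(1)]] by simp
    then have "prefix (g v) (g w) \<or> prefix (g w) (g v)" using through_comparable[of y "g v" "g w"] y by simp
    then show "y = f v" using incomparableD[OF V(1) v w(1)] w(2) by simp
  qed
  then show "B \<in> transversals g V" using B(1) by (simp add: transversals_def)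
qed

text \<open>The open set contains all sets that meet certain disjoint neighbourhoods of the members
  of \<open>B\<close>. Initial segments of these members, long enough to lie inside the
  neighbourhoods, are the new nodes, and they belong to \<open>T\<close>.\<close>

lemma refine:
  assumes V: "incomparable V g" "finite V" "card V = n" and W: "openin X \<W>" "B \<in> transversals g V" "B \<in> \<W>"
  obtains g' where "\<And>v. v \<in> V \<Longrightarrow> g' v \<in> T \<and> prefix (g v) (g' v)" "transversals g' V \<subseteq> \<W>"
proof -
  obtain \<U> where \<U>: "n_subsets_open n \<U>" "\<W> = \<U> \<inter> \<S>"
    using W(1) unfolding X_def openin_subtopology openin_n_subsets_topology by blast
  have B: "B \<in> \<S>" "\<And>v. v \<in> V \<Longrightarrow> \<exists>!y. y \<in> B \<and> through y (g v)" using W(2) by (auto simp: transversals_def)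
  have fin: "B \<subseteq> branches T" "finite B" "card B = n" using \<S>[OF B(1)] by auto
  obtain f where f: "f ` V = B" "\<And>v. v \<in> V \<Longrightarrow> f v \<in> B" "\<And>v. v \<in> V \<Longrightarrow> through (f v) (g v)"
    "\<And>v w. v \<in> V \<Longrightarrow> w \<in> V \<Longrightarrow> through (f w) (g v) \<Longrightarrow> v = w"
    "\<And>v y. v \<in> V \<Longrightarrow> y \<in> B \<Longrightarrow> through y (g v) \<Longrightarrow> y = f v"
    by (rule representatives[OF fin(2,3) B(2) V]) (assumption | rule that; assumption)+
  have "B \<in> \<U>" using W(3) \<U>(2) by simp
  from bspec[OF conjunct2[OF \<U>(1)[unfolded n_subsets_open_def]] this] obtain U where
    "\<forall>a\<in>B. openin (top_of_set (branches T_max)) (U a) \<and> a \<in> U a" "disjoint_family_on U B"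
    "\<forall>B'. B' \<subseteq> branches T_max \<and> finite B' \<and> card B' = n \<and> (\<forall>a\<in>B. \<exists>!b. b \<in> B' \<and> b \<in> U a) \<longrightarrow> B' \<in> \<U>"
    by (elim exE conjE)
  then have U: "\<And>a. a \<in> B \<Longrightarrow> openin (top_of_set (branches T_max)) (U a) \<and> a \<in> U a"
    "disjoint_family_on U B"
    "\<And>B'. B' \<subseteq> branches T_max \<Longrightarrow> finite B' \<Longrightarrow> card B' = n \<Longrightarrow> \<forall>a\<in>B. \<exists>!b. b \<in> B' \<and> b \<in> U a \<Longrightarrow> B' \<in> \<U>"
    by simp_all
  have "\<exists>m. \<forall>x\<in>branches T_max. restr x m = restr a m \<longrightarrow> x \<in> U a" if a: "a \<in> B" for a
  proof -
    obtain O' where O': "open O'" "U a = branches T_max \<inter> O'" using U(1)[OF a] openin_open by metis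
    then obtain m where "\<And>x. restr x m = restr a m \<Longrightarrow> x \<in> O'"
      using U(1)[OF a] open_contains_cylinder[of O' a] by blast
    then show ?thesis using O'(2) by blast
  qed
  then obtain m where m: "\<And>a x. a \<in> B \<Longrightarrow> x \<in> branches T_max \<Longrightarrow> restr x (m a) = restr a (m a) \<Longrightarrow> x \<in> U a"
    by metis
  define g' where "g' v = restr (f v) (max (m (f v)) (length (g v)))" for v
  have g': "g' v \<in> T" "prefix (g v) (g' v)" if "v \<in> V" for v
  proof -
    show "g' v \<in> T" using f(2)[OF that] fin(1) by (auto simp: g'_def branches_def)
    have "prefix (restr (f v) (length (g v))) (g' v)" unfolding g'_def by (rule prefix_restr) simp
    then show "prefix (g v) (g' v)" using f(3)[OF that] by (simp add: through_def)
  qed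
  have inU: "x \<in> U (f v)" if "v \<in> V" "x \<in> branches T_max" "through x (g' v)" for x v
  proof (rule m[OF f(2)[OF that(1)] that(2)])
    have "prefix (restr (f v) (m (f v))) (g' v)" unfolding g'_def by (rule prefix_restr) simp
    from through_prefix[OF that(3) this] show "restr x (m (f v)) = restr (f v) (m (f v))"
      by (simp add: through_def)
  qed
  have "transversals g' V \<subseteq> \<W>"
  proof
    fix B' assume "B' \<in> transversals g' V"
    then have B': "B' \<in> \<S>" "\<And>v. v \<in> V \<Longrightarrow> \<exists>!y. y \<in> B' \<and> through y (g' v)" by (auto simp: transversals_def)
    have fin': "B' \<subseteq> branches T" "finite B'" "card B' = n" using \<S>[OF B'(1)] by auto
    obtain f' where f': "f' ` V = B'" "\<And>v. v \<in> V \<Longrightarrow> f' v \<in> B'" "\<And>v. v \<in> V \<Longrightarrow> through (f' v) (g' v)"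
      "\<And>v w. v \<in> V \<Longrightarrow> w \<in> V \<Longrightarrow> through (f' w) (g' v) \<Longrightarrow> v = w"
      "\<And>v y. v \<in> V \<Longrightarrow> y \<in> B' \<Longrightarrow> through y (g' v) \<Longrightarrow> y = f' v"
      by (rule representatives[OF fin'(2,3) B'(2) incomparable_extend[OF V(1) g'(2)] V(2,3)])
        (assumption | rule that; assumption)+
    have br: "f' v \<in> branches T_max" if "v \<in> V" for v using f'(2)[OF that] fin'(1) branches_T by blast
    have "\<exists>!b. b \<in> B' \<and> b \<in> U a" if a: "a \<in> B" for a
    proof -
      obtain v where v: "v \<in> V" "a = f v" using a f(1) by blast
      show ?thesis
      proof (rule ex1I[of _ "f' v"])
        show "f' v \<in> B' \<and> f' v \<in> U a" using inU[OF v(1) br[OF v(1)] f'(3)[OF v(1)]] f'(2)[OF v(1)] v(2) by simp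
        fix b assume b: "b \<in> B' \<and> b \<in> U a"
        then obtain w where w: "w \<in> V" "b = f' w" using f'(1) by blast
        then have "b \<in> U (f w)" using inU[OF w(1) br[OF w(1)] f'(3)[OF w(1)]] by simp
        then have "f w = a" using U(2) b f(2)[OF w(1)] a unfolding disjoint_family_on_def by blast
        then have "w = v" using f(4)[OF w(1) v(1)] f(3)[OF w(1)] v(2) by simp
        then show "b = f' v" using w(2) by simp
      qed
    qed
    then have "B' \<in> \<U>" using U(3)[of B'] fin' branches_T by blast
    then show "B' \<in> \<W>" using \<U>(2) B'(1) by simp
  qed
  then show ?thesis using that g' by blast
qed

lemma avoid_nowhere_dense:
  assumes V: "incomparable V g" "finite V" "card V = n" and g: "\<And>v. v \<in> V \<Longrightarrow> g v \<in> T" and Z: "nowhere_dense_in X Z"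
  shows "\<exists>g'. (\<forall>v\<in>V. g' v \<in> T \<and> prefix (g v) (g' v)) \<and> transversals g' V \<inter> Z = {}"
proof (cases "transversals g V = {}")
  case True
  then show ?thesis using g by (intro exI[of _ g]) auto
next
  case False
  have Z': "Z \<subseteq> X closure_of Z" "X interior_of (X closure_of Z) = {}"
    using Z closure_of_subset[of Z X] by (auto simp: nowhere_dense_in_def)
  \<comment> \<open>Otherwise this nonempty open set would lie in the empty interior of the
    closure.\<close>
  have "\<not> transversals g V \<subseteq> X closure_of Z"
    using interior_of_maximal[OF _ open_transversals[OF V]] Z'(2) False by blast
  then obtain B where B: "B \<in> transversals g V" "B \<in> transversals g V - X closure_of Z" by blast
  have "openin X (transversals g V - X closure_of Z)"
    by (rule openin_diff[OF open_transversals[OF V] closedin_closure_of])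
  then obtain g' where "\<And>v. v \<in> V \<Longrightarrow> g' v \<in> T \<and> prefix (g v) (g' v)" "transversals g' V \<subseteq> transversals g V - X closure_of Z"
    using refine[OF V _ B] by metis
  then show ?thesis using Z'(1) by (intro exI[of _ g']) blast
qed

lemma decide_open:
  assumes V: "incomparable V g" "finite V" "card V = n" and g: "\<And>v. v \<in> V \<Longrightarrow> g v \<in> T" and W: "openin X \<W>"
  shows "\<exists>g'. (\<forall>v\<in>V. g' v \<in> T \<and> prefix (g v) (g' v)) \<and> (transversals g' V \<subseteq> \<W> \<or> transversals g' V \<inter> \<W> = {})"
proof (cases "transversals g V \<inter> \<W> = {}")
  case True
  then show ?thesis using g by (intro exI[of _ g]) auto
next
  case False
  then obtain B where "B \<in> transversals g V" "B \<in> \<W>" by blast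
  then obtain g' where "\<And>v. v \<in> V \<Longrightarrow> g' v \<in> T \<and> prefix (g v) (g' v)" "transversals g' V \<subseteq> \<W>"
    using refine[OF V W] by metis
  then show ?thesis by blast
qed

text \<open>Requirements that can always be met by extending nodes, and persist under further
  extension, can be met one after the other.\<close>

lemma meet_requirements:
  assumes "finite \<R>" "finite I" and g: "\<And>v. v \<in> I \<Longrightarrow> g v \<in> T" "incomparable I g"
    and \<R>: "\<And>R g. R \<in> \<R> \<Longrightarrow> incomparable I g \<Longrightarrow> (\<And>v. v \<in> I \<Longrightarrow> g v \<in> T) \<Longrightarrow>
      \<exists>g'. (\<forall>v\<in>I. g' v \<in> T \<and> prefix (g v) (g' v)) \<and> R g'"
    and mono: "\<And>R g g'. R \<in> \<R> \<Longrightarrow> R g \<Longrightarrow> incomparable I g \<Longrightarrow> (\<And>v. v \<in> I \<Longrightarrow> prefix (g v) (g' v)) \<Longrightarrow> R g'"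
  shows "\<exists>g'. (\<forall>v\<in>I. g' v \<in> T \<and> prefix (g v) (g' v)) \<and> (\<forall>R\<in>\<R>. R g')"
  using assms(1) \<R> mono
proof (induction \<R>)
  case empty
  then show ?case using g by (intro exI[of _ g]) auto
next
  case (insert R \<R>)
  have "\<exists>g'. (\<forall>v\<in>I. g' v \<in> T \<and> prefix (g v) (g' v)) \<and> (\<forall>R\<in>\<R>. R g')"
    by (rule insert.IH) (rule insert.prems; (assumption | simp))+
  then obtain g1 where g1: "\<forall>v\<in>I. g1 v \<in> T \<and> prefix (g v) (g1 v)" "\<forall>R\<in>\<R>. R g1" by (elim exE conjE)
  have inc1: "incomparable I g1" using incomparable_extend[OF g(2)] g1(1) by blast
  obtain g2 where g2: "\<forall>v\<in>I. g2 v \<in> T \<and> prefix (g1 v) (g2 v)" "R g2"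
  proof -
    have "\<exists>g2. (\<forall>v\<in>I. g2 v \<in> T \<and> prefix (g1 v) (g2 v)) \<and> R g2"
      by (rule insert.prems(1)) (use inc1 g1(1) in auto)
    then show thesis using that by (elim exE conjE)
  qed
  have 1: "\<forall>v\<in>I. g2 v \<in> T \<and> prefix (g v) (g2 v)"
    using g1(1) g2(1) prefix_order.trans by blast
  have "R' g2" if "R' \<in> \<R>" for R'
    by (rule insert.prems(2)[of R' g1 g2]) (use that g1(2) inc1 g2(1) in auto)
  then have 2: "\<forall>R\<in>insert R \<R>. R g2" using g2(2) by (intro ballI) (elim insertE, simp_all)
  show ?case by (rule exI[of _ g2], rule conjI[OF 1 2])
qed

end

section \<open>Deciding the colour level by level\<close>

definition words :: "nat \<Rightarrow> nat list set" where
  "words q = {w \<in> T_max. length w = q}"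

lemma finite_words: "finite (words q)"
proof (rule finite_subset)
  show "words q \<subseteq> {w. set w \<subseteq> {..q} \<and> length w = q}"
    by (auto simp: words_def T_max_iff in_set_conv_nth) (meson le_trans less_imp_le)
qed (rule finite_lists_length_eq, simp)

lemma T_max_take: "w \<in> T_max \<Longrightarrow> take q w \<in> T_max"
  by (simp add: T_max_iff)

lemma T_max_snoc_iff: "w @ [a] \<in> T_max \<longleftrightarrow> w \<in> T_max \<and> a \<le> length w"
  by (auto simp: T_max_iff nth_append less_Suc_eq)

lemma words_Suc: "u \<in> words (Suc q) \<longleftrightarrow> (\<exists>w\<in>words q. \<exists>a\<le>q. u = w @ [a])"
proof
  assume u: "u \<in> words (Suc q)"
  then obtain w a where "u = w @ [a]" by (cases u rule: rev_cases) (auto simp: words_def)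
  then show "\<exists>w\<in>words q. \<exists>a\<le>q. u = w @ [a]" using u by (auto simp: words_def T_max_snoc_iff)
qed (auto simp: words_def T_max_snoc_iff)

locale tree_colouring = ramsey_limit + subset_space +
  fixes F :: "nat list \<Rightarrow> nat list struct" and c :: "(nat \<Rightarrow> nat) set \<Rightarrow> bool"
  assumes tree: "F_max_tree k K F T"
    and baire: "baire_measurable_coloring X c"
begin

lemma T_prefix: "t \<in> T \<Longrightarrow> prefix s t \<Longrightarrow> s \<in> T"
  using tree by (auto simp: F_max_tree_def is_tree_def)

text \<open>Words of length \<open>q\<close> may be continued by the letters \<open>0\<close> to
  \<open>q\<close>, so \<open>{..q}\<close> is the part of the limit that has to be found among the
  successors of a node.\<close>

lemma T_embedding:
  assumes "t \<in> T"
  obtains s e where "s \<in> T" "prefix t s" "embedding k e (induced M {..q}) (induced (F s) (succs T s))"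
  using tree assms induced_in_K[of "{..q}"] unfolding F_max_tree_def embeds_def by blast

lemma T_long:
  assumes "t \<in> T"
  shows "\<exists>s\<in>T. prefix t s \<and> l < length s"
proof (induction l)
  case (Suc l)
  then obtain s where s: "s \<in> T" "prefix t s" "l < length s" by blast
  obtain s' e where s': "s' \<in> T" "prefix s s'" "embedding k e (induced M {..0}) (induced (F s') (succs T s'))"
    by (rule T_embedding[OF s(1), where q = 0])
  then have "e 0 \<in> succs T s'" by (auto simp: embedding_def)
  then have "e 0 \<in> T" "prefix s' (e 0)" "length (e 0) = Suc (length s')" by (auto simp: succs_def)
  then show ?case using s s' prefix_length_le[OF s'(2)] prefix_order.trans
    by (intro bexI[of _ "e 0"]) (auto intro: prefix_order.trans)
next
  case 0
  obtain s' e where s': "s' \<in> T" "prefix t s'" "embedding k e (induced M {..0}) (induced (F s') (succs T s'))"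
    by (rule T_embedding[OF assms, where q = 0])
  then have "e 0 \<in> succs T s'" by (auto simp: embedding_def)
  then have "e 0 \<in> T" "prefix s' (e 0)" "length (e 0) = Suc (length s')" by (auto simp: succs_def)
  then show ?case using s' by (intro bexI[of _ "e 0"]) (auto intro: prefix_order.trans)
qed

text \<open>At level \<open>q\<close> only finitely many \<open>Z i\<close> are avoided. This
  suffices, because a set of branches can be examined at arbitrarily high levels.\<close>

definition decided :: "(nat \<Rightarrow> nat) set set \<Rightarrow> (nat \<Rightarrow> (nat \<Rightarrow> nat) set set) \<Rightarrow> nat \<Rightarrow> (nat list \<Rightarrow> nat list) \<Rightarrow> bool" where
  "decided \<W> Z q g \<longleftrightarrow> (\<forall>V\<subseteq>words q. card V = n \<longrightarrow>
     (transversals g V \<subseteq> \<W> \<or> transversals g V \<inter> \<W> = {}) \<and> (\<forall>i\<le>q. transversals g V \<inter> Z i = {}))"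

lemma extend_on:
  assumes "\<exists>g'. (\<forall>v\<in>V. g' v \<in> T \<and> prefix (g v) (g' v)) \<and> P (transversals g' V)" "\<And>v. v \<in> I \<Longrightarrow> g v \<in> T"
  shows "\<exists>g'. (\<forall>v\<in>I. g' v \<in> T \<and> prefix (g v) (g' v)) \<and> P (transversals g' V)"
proof -
  obtain g' where g': "\<forall>v\<in>V. g' v \<in> T \<and> prefix (g v) (g' v)" "P (transversals g' V)" using assms(1) by blast
  have "transversals (\<lambda>v. if v \<in> V then g' v else g v) V = transversals g' V" by (simp add: transversals_def)
  then show ?thesis using g' assms(2) by (intro exI[of _ "\<lambda>v. if v \<in> V then g' v else g v"]) auto
qed

lemma decide_level:
  assumes W: "openin X \<W>" and Z: "\<And>i. nowhere_dense_in X (Z i)"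
    and g: "\<And>w. w \<in> words q \<Longrightarrow> g w \<in> T" "incomparable (words q) g"
  shows "\<exists>g'. (\<forall>w\<in>words q. g' w \<in> T \<and> prefix (g w) (g' w) \<and> l < length (g' w)) \<and> decided \<W> Z q g'"
proof -
  define \<V> where "\<V> = {V. V \<subseteq> words q \<and> card V = n}"
  have fin\<V>: "finite \<V>" unfolding \<V>_def by (rule finite_subset[of _ "Pow (words q)"]) (auto simp: finite_words)
  define \<R>1 where "\<R>1 = (\<lambda>V g. transversals g V \<subseteq> \<W> \<or> transversals g V \<inter> \<W> = {}) ` \<V>"
  define \<R>2 where "\<R>2 = (\<lambda>(V, i) g. transversals g V \<inter> Z i = {}) ` (\<V> \<times> {..q})"
  define \<R>3 where "\<R>3 = (\<lambda>v g. l < length (g v :: nat list)) ` words q"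
  have V: "incomparable V g" "finite V" "card V = n" "V \<subseteq> words q" if "incomparable (words q) g" "V \<in> \<V>" for V and g :: "nat list \<Rightarrow> nat list"
  proof -
    show "card V = n" and *: "V \<subseteq> words q" using that(2) by (simp_all add: \<V>_def)
    show "finite V" using * by (rule finite_subset[OF _ finite_words])
    show "incomparable V g" using that(1) * unfolding incomparable_def by blast
  qed
  have "\<exists>g'. (\<forall>w\<in>words q. g' w \<in> T \<and> prefix (g w) (g' w)) \<and> (\<forall>R\<in>\<R>1 \<union> \<R>2 \<union> \<R>3. R g')"
  proof (rule meet_requirements)
    show "finite (\<R>1 \<union> \<R>2 \<union> \<R>3)" unfolding \<R>1_def \<R>2_def \<R>3_def using fin\<V> finite_words by auto
    show "finite (words q)" by (rule finite_words)
    fix R and g :: "nat list \<Rightarrow> nat list"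
    assume R: "R \<in> \<R>1 \<union> \<R>2 \<union> \<R>3" and inc: "incomparable (words q) g" and gT: "\<And>v. v \<in> words q \<Longrightarrow> g v \<in> T"
    from R consider V where "V \<in> \<V>" "R = (\<lambda>g. transversals g V \<subseteq> \<W> \<or> transversals g V \<inter> \<W> = {})"
      | V i where "V \<in> \<V>" "R = (\<lambda>g. transversals g V \<inter> Z i = {})" | v where "v \<in> words q" "R = (\<lambda>g. l < length (g v))"
      unfolding \<R>1_def \<R>2_def \<R>3_def by auto
    then show "\<exists>g'. (\<forall>v\<in>words q. g' v \<in> T \<and> prefix (g v) (g' v)) \<and> R g'"
    proof cases
      case (1 V)
      note V = V[OF inc 1(1)]
      show ?thesis unfolding 1(2)
        by (rule extend_on[OF decide_open[OF V(1-3) _ W] gT]) (use gT V(4) in auto)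
    next
      case (2 V i)
      note V = V[OF inc 2(1)]
      show ?thesis unfolding 2(2)
        by (rule extend_on[OF avoid_nowhere_dense[OF V(1-3) _ Z] gT]) (use gT V(4) in auto)
    next
      case (3 v)
      obtain s where "s \<in> T" "prefix (g v) s" "l < length s" using T_long[OF gT[OF 3(1)]] by blast
      then show ?thesis unfolding 3(2) using gT by (intro exI[of _ "g(v := s)"]) auto
    qed
  next
    fix R and g g' :: "nat list \<Rightarrow> nat list"
    assume R: "R \<in> \<R>1 \<union> \<R>2 \<union> \<R>3" and Rg: "R g" and inc: "incomparable (words q) g"
      and extend: "\<And>v. v \<in> words q \<Longrightarrow> prefix (g v) (g' v)"
    from R consider V where "V \<in> \<V>" "R = (\<lambda>g. transversals g V \<subseteq> \<W> \<or> transversals g V \<inter> \<W> = {})"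
      | V i where "V \<in> \<V>" "R = (\<lambda>g. transversals g V \<inter> Z i = {})" | v where "v \<in> words q" "R = (\<lambda>g. l < length (g v))"
      unfolding \<R>1_def \<R>2_def \<R>3_def by auto
    then show "R g'"
    proof cases
      case (1 V)
      note V = V[OF inc 1(1)]
      have "transversals g' V \<subseteq> transversals g V" by (rule transversals_mono[OF V(1-3)]) (use extend V(4) in auto)
      then show ?thesis using Rg unfolding 1(2) by blast
    next
      case (2 V i)
      note V = V[OF inc 2(1)]
      have "transversals g' V \<subseteq> transversals g V" by (rule transversals_mono[OF V(1-3)]) (use extend V(4) in auto)
      then show ?thesis using Rg unfolding 2(2) by blast
    next
      case (3 v)
      then show ?thesis using Rg prefix_length_le[OF extend[OF 3(1)]] by simp
    qed
  qed (use g in auto)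
  then obtain g' where g': "\<forall>w\<in>words q. g' w \<in> T \<and> prefix (g w) (g' w)" "\<forall>R\<in>\<R>1 \<union> \<R>2 \<union> \<R>3. R g'"
    by (elim exE conjE)
  have "l < length (g' w)" if "w \<in> words q" for w
    using bspec[OF g'(2), of "\<lambda>g. l < length (g w)"] that by (auto simp: \<R>3_def)
  moreover have "decided \<W> Z q g'"
    unfolding decided_def
  proof (intro allI impI conjI)
    fix V assume "V \<subseteq> words q" "card V = n"
    then have V: "V \<in> \<V>" by (simp add: \<V>_def)
    show "transversals g' V \<subseteq> \<W> \<or> transversals g' V \<inter> \<W> = {}"
      using bspec[OF g'(2), of "\<lambda>g. transversals g V \<subseteq> \<W> \<or> transversals g V \<inter> \<W> = {}"] V by (auto simp: \<R>1_def)
    fix i assume "i \<le> q"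
    then have "(\<lambda>g. transversals g V \<inter> Z i = {}) \<in> \<R>2"
      unfolding \<R>2_def using V by (intro image_eqI[where x = "(V, i)"]) auto
    then show "transversals g' V \<inter> Z i = {}" using bspec[OF g'(2), of "\<lambda>g. transversals g V \<inter> Z i = {}"] by simp
  qed
  ultimately show ?thesis using g'(1) by blast
qed

text \<open>Letters stand for successors of a splitting node \<open>sp w\<close> above
  \<open>g w\<close>. All splitting nodes of one level are made shorter than all nodes of the next,
  so that lengths of words compare like levels in \<open>T\<close>.\<close>

lemma next_level:
  assumes W: "openin X \<W>" and Z: "\<And>i. nowhere_dense_in X (Z i)"
    and g: "\<And>w. w \<in> words q \<Longrightarrow> g w \<in> T" "incomparable (words q) g"
  shows "\<exists>g' sp e. (\<forall>u\<in>words (Suc q). g' u \<in> T) \<and> incomparable (words (Suc q)) g' \<and> decided \<W> Z (Suc q) g' \<and>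
    (\<forall>w\<in>words q. sp w \<in> T \<and> prefix (g w) (sp w) \<and>
       embedding k (e w) (induced M {..q}) (induced (F (sp w)) (succs T (sp w))) \<and>
       (\<forall>a\<le>q. prefix (e w a) (g' (w @ [a]))) \<and> (\<forall>u\<in>words (Suc q). length (sp w) < length (g' u)))"
proof -
  have "\<exists>s e. s \<in> T \<and> prefix (g w) s \<and> embedding k e (induced M {..q}) (induced (F s) (succs T s))" if "w \<in> words q" for w
    using T_embedding[OF g(1)[OF that], where q = q] by metis
  then have "\<exists>sp. \<forall>w\<in>words q. \<exists>e. sp w \<in> T \<and> prefix (g w) (sp w) \<and>
      embedding k e (induced M {..q}) (induced (F (sp w)) (succs T (sp w)))"
    by (intro bchoice) blast
  then obtain sp where sp0: "\<forall>w\<in>words q. \<exists>e. sp w \<in> T \<and> prefix (g w) (sp w) \<and>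
      embedding k e (induced M {..q}) (induced (F (sp w)) (succs T (sp w)))" ..
  from bchoice[OF sp0] obtain e where "\<forall>w\<in>words q. sp w \<in> T \<and> prefix (g w) (sp w) \<and>
      embedding k (e w) (induced M {..q}) (induced (F (sp w)) (succs T (sp w)))" ..
  then have sp: "\<And>w. w \<in> words q \<Longrightarrow> sp w \<in> T" "\<And>w. w \<in> words q \<Longrightarrow> prefix (g w) (sp w)"
    "\<And>w. w \<in> words q \<Longrightarrow> embedding k (e w) (induced M {..q}) (induced (F (sp w)) (succs T (sp w)))" by blast+
  have eS: "e w a \<in> succs T (sp w)" if "w \<in> words q" "a \<le> q" for w a
    using sp(3)[OF that(1)] that(2) by (auto simp: embedding_def)
  have eT: "e w a \<in> T" "prefix (sp w) (e w a)" "length (e w a) = Suc (length (sp w))" if "w \<in> words q" "a \<le> q" for w a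
    using eS[OF that] by (auto simp: succs_def)
  define g0 where "g0 u = e (butlast u) (last u)" for u
  have g0T: "g0 u \<in> T" if "u \<in> words (Suc q)" for u
    using that eT(1) unfolding words_Suc g0_def by auto
  have inc: "incomparable (words (Suc q)) g0"
    unfolding incomparable_def
  proof (intro ballI impI notI)
    fix u u' assume u: "u \<in> words (Suc q)" "u' \<in> words (Suc q)" "u \<noteq> u'" "prefix (g0 u) (g0 u')"
    obtain w a where w: "w \<in> words q" "a \<le> q" "u = w @ [a]" using u(1) words_Suc by blast
    obtain w' a' where w': "w' \<in> words q" "a' \<le> q" "u' = w' @ [a']" using u(2) words_Suc by blast
    have pr: "prefix (e w a) (e w' a')" using u(4) w w' by (simp add: g0_def)
    have "prefix (g w) (e w' a')" "prefix (g w') (e w' a')"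
      using prefix_order.trans[OF sp(2)[OF w(1)] prefix_order.trans[OF eT(2)[OF w(1,2)] pr]]
        prefix_order.trans[OF sp(2)[OF w'(1)] eT(2)[OF w'(1,2)]] by simp_all
    then have "prefix (g w) (g w') \<or> prefix (g w') (g w)" by (rule prefix_same_cases)
    then have ww: "w = w'" using incomparableD[OF g(2) w(1) w'(1)] by simp
    then have "e w a = e w a'" using pr eT(3)[OF w(1,2)] eT(3)[OF w'(1,2)] by (auto simp: prefix_def)
    moreover have "inj_on (e w) {..q}" using sp(3)[OF w(1)] by (simp add: embedding_def)
    ultimately have "a = a'" using w(2) w'(2) by (simp add: inj_on_eq_iff)
    then show False using u(3) w w' ww by simp
  qed
  define l where "l = Max (insert 0 ((\<lambda>w. length (sp w)) ` words q))"
  have l: "length (sp w) \<le> l" if "w \<in> words q" for w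
    unfolding l_def using that finite_words by (intro Max_ge) auto
  have "\<exists>g'. (\<forall>u\<in>words (Suc q). g' u \<in> T \<and> prefix (g0 u) (g' u) \<and> l < length (g' u)) \<and> decided \<W> Z (Suc q) g'"
    by (rule decide_level[OF W Z g0T inc])
  then obtain g' where g': "\<forall>u\<in>words (Suc q). g' u \<in> T \<and> prefix (g0 u) (g' u) \<and> l < length (g' u)" "decided \<W> Z (Suc q) g'"
    by (elim exE conjE)
  have "incomparable (words (Suc q)) g'" by (rule incomparable_extend[OF inc]) (use g'(1) in blast)
  moreover have "prefix (e w a) (g' (w @ [a]))" if "w \<in> words q" "a \<le> q" for w a
  proof -
    have "w @ [a] \<in> words (Suc q)" using that words_Suc by blast
    then have "prefix (g0 (w @ [a])) (g' (w @ [a]))" using g'(1) by blast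
    then show ?thesis by (simp add: g0_def)
  qed
  moreover have "length (sp w) < length (g' u)" if "w \<in> words q" "u \<in> words (Suc q)" for w u
  proof -
    have "l < length (g' u)" using g'(1) that(2) by blast
    then show ?thesis using l[OF that(1)] by simp
  qed
  moreover have "\<forall>u\<in>words (Suc q). g' u \<in> T" using g'(1) by blast
  ultimately show ?thesis using g'(2) sp
    by (intro exI[of _ g'] exI[of _ sp] exI[of _ e] conjI ballI allI impI) simp_all
qed

text \<open>A set of branches through the chosen nodes lies in no \<open>Z i\<close>, as at level
  \<open>max q i\<close> it still meets \<open>n\<close> different nodes. Outside the union of the
  \<open>Z i\<close>, the colour agrees with membership in the open set \<open>\<W>\<close>, and
  this is decided at the level \<open>q\<close> of \<open>V\<close>.\<close>

theorem tree_embedding: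
  obtains g sp e dd where "\<And>w. w \<in> T_max \<Longrightarrow> g w \<in> T" "\<And>w. w \<in> T_max \<Longrightarrow> sp w \<in> T"
    "\<And>w. w \<in> T_max \<Longrightarrow> prefix (g w) (sp w)"
    "\<And>w. w \<in> T_max \<Longrightarrow> embedding k (e w) (induced M {..length w}) (induced (F (sp w)) (succs T (sp w)))"
    "\<And>w a. w \<in> T_max \<Longrightarrow> a \<le> length w \<Longrightarrow> prefix (e w a) (g (w @ [a]))"
    "\<And>w w'. w \<in> T_max \<Longrightarrow> w' \<in> T_max \<Longrightarrow> length w < length w' \<Longrightarrow> length (sp w) < length (g w')"
    "\<And>q. incomparable (words q) g"
    "\<And>B V q. B \<in> \<S> \<Longrightarrow> (\<And>y q. y \<in> B \<Longrightarrow> \<exists>w\<in>words q. through y (g w)) \<Longrightarrow> V \<subseteq> words q \<Longrightarrow> card V = n \<Longrightarrow>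
      (\<And>v. v \<in> V \<Longrightarrow> \<exists>y\<in>B. through y (g v)) \<Longrightarrow> c B = dd V"
proof -
  let ?A = "{x \<in> topspace X. c x}"
  have "baire_property_in X ?A"
    using baire[unfolded baire_measurable_coloring_def, THEN spec, of True] by simp
  then obtain \<W> \<N> where W: "openin X \<W>" and N: "countable \<N>" "\<And>N. N \<in> \<N> \<Longrightarrow> nowhere_dense_in X N"
      "(?A - \<W>) \<union> (\<W> - ?A) = \<Union>\<N>"
    unfolding baire_property_in_def meager_in_def by (elim exE conjE) (rule that; blast)
  obtain Z where Z: "\<And>i. nowhere_dense_in X (Z i)" "\<Union>\<N> = (\<Union>i :: nat. Z i)"
  proof (cases "\<N> = {}")
    case True
    then show ?thesis using that[of "\<lambda>_. {}"] by (simp add: nowhere_dense_in_empty)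
  next
    case False
    then show ?thesis using that[of "from_nat_into \<N>"] N from_nat_into[OF False]
      by (simp add: range_from_nat_into[OF False N(1)])
  qed
  define P where "P q g \<longleftrightarrow> (\<forall>w\<in>words q. g w \<in> T) \<and> incomparable (words q) g \<and> decided \<W> Z q g"
    for q and g :: "nat list \<Rightarrow> nat list"
  define R where "R q g g' sp e \<longleftrightarrow> (\<forall>w\<in>words q. sp w \<in> T \<and> prefix (g w) (sp w) \<and>
       embedding k (e w) (induced M {..q}) (induced (F (sp w)) (succs T (sp w))) \<and>
       (\<forall>a\<le>q. prefix (e w a) (g' (w @ [a]))) \<and> (\<forall>u\<in>words (Suc q). length (sp w) < length (g' u)))"
    for q and g g' sp :: "nat list \<Rightarrow> nat list" and e
  have "\<exists>f. \<forall>q. P q (f q) \<and> (\<exists>sp e. R q (f q) (f (Suc q)) sp e)"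
  proof (rule dependent_nat_choice)
    have "[] \<in> T" using tree T_prefix by (auto simp: F_max_tree_def is_tree_def)
    moreover have "words 0 = {[]}" by (auto simp: words_def intro: T_max.intros)
    ultimately have "\<exists>g'. (\<forall>w\<in>words 0. g' w \<in> T \<and> prefix ((\<lambda>_. []) w) (g' w) \<and> 0 < length (g' w)) \<and> decided \<W> Z 0 g'"
      by (intro decide_level[OF W Z(1)]) (auto simp: incomparable_def)
    then show "\<exists>g. P 0 g" using \<open>words 0 = {[]}\<close> by (auto simp: P_def incomparable_def)
  next
    fix g q assume Pg: "P q g"
    show "\<exists>g'. P (Suc q) g' \<and> (\<exists>sp e. R q g g' sp e)"
    proof -
      have "\<exists>g' sp e. (\<forall>u\<in>words (Suc q). g' u \<in> T) \<and> incomparable (words (Suc q)) g' \<and>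
          decided \<W> Z (Suc q) g' \<and> R q g g' sp e"
        unfolding R_def by (intro next_level[OF W Z(1)]) (use Pg in \<open>simp_all add: P_def\<close>)
      then show ?thesis unfolding P_def by blast
    qed
  qed
  then obtain gs where gs: "\<And>q. P q (gs q)" "\<And>q. \<exists>sp e. R q (gs q) (gs (Suc q)) sp e" by blast
  from gs(2) obtain sps where "\<And>q. \<exists>e. R q (gs q) (gs (Suc q)) (sps q) e" by metis
  then obtain es where R: "\<And>q. R q (gs q) (gs (Suc q)) (sps q) (es q)" by metis
  define g where "g w = gs (length w) w" for w
  define sp where "sp w = sps (length w) w" for w
  define e where "e w = es (length w) w" for w
  have gq: "g w = gs q w" if "w \<in> words q" for w q using that by (simp add: g_def words_def)
  have self: "w \<in> words (length w)" if "w \<in> T_max" for w using that by (simp add: words_def)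
  have 1: "g w \<in> T" if "w \<in> T_max" for w using gs(1)[of "length w"] self[OF that] by (simp add: P_def g_def)
  have Rw: "sp w \<in> T" "prefix (g w) (sp w)"
    "embedding k (e w) (induced M {..length w}) (induced (F (sp w)) (succs T (sp w)))"
    "\<And>a. a \<le> length w \<Longrightarrow> prefix (e w a) (g (w @ [a]))"
    "\<And>u. u \<in> words (Suc (length w)) \<Longrightarrow> length (sp w) < length (g u)" if w: "w \<in> T_max" for w
  proof -
    note r = bspec[OF R[of "length w", unfolded R_def] self[OF w], folded g_def sp_def e_def]
    show "sp w \<in> T" "prefix (g w) (sp w)"
      "embedding k (e w) (induced M {..length w}) (induced (F (sp w)) (succs T (sp w)))" using r by auto
    show "prefix (e w a) (g (w @ [a]))" if "a \<le> length w" for a using r that by (simp add: g_def)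
    show "length (sp w) < length (g u)" if "u \<in> words (Suc (length w))" for u using r that by (simp add: gq)
  qed
  have step: "prefix (g w) (g (w @ [a]))" if "w @ [a] \<in> T_max" for w a
  proof -
    have w: "w \<in> T_max" "a \<le> length w" using that by (simp_all add: T_max_snoc_iff)
    have "e w a \<in> succs T (sp w)" using Rw(3)[OF w(1)] w(2) by (auto simp: embedding_def)
    then have "prefix (sp w) (e w a)" by (auto simp: succs_def)
    then show ?thesis using Rw(2)[OF w(1)] Rw(4)[OF w] prefix_order.trans by blast
  qed
  have mono: "w' \<in> T_max \<Longrightarrow> prefix (g (take m w')) (g w')" for w' m
  proof (induction w' rule: rev_induct)
    case (snoc a w')
    then show ?case
      using step[OF snoc.prems] by (cases "m \<le> length w'") (auto simp: T_max_snoc_iff intro: prefix_order.trans)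
  qed simp
  have 6: "length (sp w) < length (g w')" if w: "w \<in> T_max" "w' \<in> T_max" "length w < length w'" for w w'
  proof -
    have "take (Suc (length w)) w' \<in> words (Suc (length w))" using w(2,3) T_max_take by (simp add: words_def)
    then show ?thesis using Rw(5)[OF w(1)] prefix_length_le[OF mono[OF w(2)]] by (meson less_le_trans)
  qed
  have 7: "incomparable (words q) g" for q
    using gs(1)[of q] gq unfolding P_def incomparable_def by simp
  have Nbg: "transversals g V = transversals (gs q) V" if "V \<subseteq> words q" for V q
  proof -
    have "g v = gs q v" if "v \<in> V" for v using gq \<open>V \<subseteq> words q\<close> that by blast
    then show ?thesis unfolding transversals_def by simp
  qed
  have dec: "decided \<W> Z q g" for q
    using gs(1)[of q] Nbg unfolding P_def decided_def by simp
  have NbI: "B \<in> transversals g V" if B: "B \<in> \<S>" and V: "V \<subseteq> words q" "card V = n" "\<And>v. v \<in> V \<Longrightarrow> \<exists>y\<in>B. through y (g v)" for B V q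
  proof -
    have "\<forall>v\<in>V. \<exists>y. y \<in> B \<and> through y (g v)" using V(3) by blast
    from bchoice[OF this] obtain f where "\<forall>v\<in>V. f v \<in> B \<and> through (f v) (g v)" ..
    then have f: "\<And>v. v \<in> V \<Longrightarrow> f v \<in> B \<and> through (f v) (g v)" by blast
    have i: "v = w" if vw: "v \<in> V" "w \<in> V" "through (f v) (g w)" for v w
    proof -
      have "prefix (g v) (g w) \<or> prefix (g w) (g v)"
        using through_comparable[OF _ vw(3), of "g v"] f[OF vw(1)] by blast
      moreover have "v \<in> words q" "w \<in> words q" using vw V(1) by blast+
      ultimately show ?thesis using incomparableD[OF 7] by blast
    qed
    have "inj_on f V"
    proof (rule inj_onI)
      fix v w assume "v \<in> V" "w \<in> V" "f v = f w"
      then show "v = w" using i[of v w] f[of w] by simp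
    qed
    then have fV: "f ` V = B" using \<S>[OF B] V(2) f by (intro card_subset_eq) (auto simp: card_image)
    have "\<exists>!y. y \<in> B \<and> through y (g v)" if v: "v \<in> V" for v
    proof (rule ex1I[of _ "f v"])
      show "f v \<in> B \<and> through (f v) (g v)" by (rule f[OF v])
      fix y assume y: "y \<in> B \<and> through y (g v)"
      then obtain w where "w \<in> V" "y = f w" using fV by blast
      then show "y = f v" using i[OF _ v, of w] y by simp
    qed
    then show ?thesis using B by (simp add: transversals_def)
  qed
  define dd where "dd V \<longleftrightarrow> transversals g V \<subseteq> \<W>" for V
  have 8: "c B = dd V"
    if B: "B \<in> \<S>" and br: "\<And>y q. y \<in> B \<Longrightarrow> \<exists>w\<in>words q. through y (g w)" and V: "V \<subseteq> words q" "card V = n"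
      "\<And>v. v \<in> V \<Longrightarrow> \<exists>y\<in>B. through y (g v)" for B V q
  proof -
    have BV: "B \<in> transversals g V" by (rule NbI[OF B V])
    have "B \<notin> Z i" for i
    proof -
      \<comment> \<open>Separation is known at level \<open>q\<close>, but \<open>Z i\<close> is
        avoided only from level \<open>i\<close> on.\<close>
      define q' where "q' = max q i"
      have "\<forall>y\<in>B. \<exists>w. w \<in> words q' \<and> through y (g w)" using br by blast
      from bchoice[OF this] obtain h where "\<forall>y\<in>B. h y \<in> words q' \<and> through y (g (h y))" ..
      then have h: "\<And>y. y \<in> B \<Longrightarrow> h y \<in> words q' \<and> through y (g (h y))" by blast
      have th: "through y (g (take q (h y)))" "take q (h y) \<in> words q" if "y \<in> B" for y
        using h[OF that] mono[of "h y" q] through_prefix[of y "g (h y)"] T_max_take[of "h y" q]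
        by (simp_all add: words_def q'_def)
      have "\<exists>y\<in>B. take q (h y) = v" if v: "v \<in> V" for v
      proof -
        obtain y where y: "y \<in> B" "through y (g v)" using V(3)[OF v] by blast
        have "v \<in> words q" using v V(1) by blast
        from incomparableD[OF 7 th(2)[OF y(1)] this through_comparable[OF th(1)[OF y(1)] y(2)]]
        have "take q (h y) = v" .
        then show ?thesis using y(1) by blast
      qed
      \<comment> \<open>Truncation to length \<open>q\<close> maps the words of \<open>B\<close>
        onto \<open>V\<close>, so there are at least \<open>n\<close> of them.\<close>
      then have "V \<subseteq> take q ` (h ` B)" by blast
      then have "card V \<le> card (h ` B)"
        using \<S>[OF B] card_mono[of "take q ` (h ` B)" V] card_image_le[of "h ` B" "take q"] by auto
      then have "card (h ` B) = n" using V(2) \<S>[OF B] card_image_le[of B h] by auto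
      moreover have "h ` B \<subseteq> words q'" using h by blast
      moreover have "\<exists>y\<in>B. through y (g v)" if "v \<in> h ` B" for v using h that by blast
      ultimately have "B \<in> transversals g (h ` B)" "transversals g (h ` B) \<inter> Z i = {}"
        using NbI[OF B] dec[of q'] unfolding decided_def by (auto simp: q'_def)
      then show ?thesis by blast
    qed
    then have "B \<notin> \<Union>\<N>" using Z(2) by simp
    then have "c B \<longleftrightarrow> B \<in> \<W>" using N(3) B topspace_X by blast
    moreover have "transversals g V \<subseteq> \<W> \<or> transversals g V \<inter> \<W> = {}" using dec[of q] V(1,2) unfolding decided_def by blast
    ultimately show ?thesis using BV unfolding dd_def by blast
  qed
  show ?thesis by (rule that[of g sp e dd, OF 1 Rw(1,2,3,4) 6 7 8])
qed

end

section \<open>Subtrees from words\<close>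

text \<open>The word \<open>w\<close> has the node \<open>g w\<close> in \<open>T\<close>. Its extensions by one letter go through the successors
  \<open>e w a\<close> of the splitting node \<open>sp w\<close> above \<open>g w\<close>.\<close>

locale embedded_tree = ramsey_limit +
  fixes F :: "nat list \<Rightarrow> nat list struct" and T :: "nat list set"
    and g sp :: "nat list \<Rightarrow> nat list" and e :: "nat list \<Rightarrow> nat \<Rightarrow> nat list"
  assumes nodes: "node_structures k M F" and tree: "F_max_tree k K F T"
    and g_T: "\<And>w. w \<in> T_max \<Longrightarrow> g w \<in> T" and sp_T: "\<And>w. w \<in> T_max \<Longrightarrow> sp w \<in> T"
    and g_sp: "\<And>w. w \<in> T_max \<Longrightarrow> prefix (g w) (sp w)"
    and e: "\<And>w. w \<in> T_max \<Longrightarrow> embedding k (e w) (induced M {..length w}) (induced (F (sp w)) (succs T (sp w)))"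
    and e_g: "\<And>w a. w \<in> T_max \<Longrightarrow> a \<le> length w \<Longrightarrow> prefix (e w a) (g (w @ [a]))"
    and sp_g: "\<And>w w'. w \<in> T_max \<Longrightarrow> w' \<in> T_max \<Longrightarrow> length w < length w' \<Longrightarrow> length (sp w) < length (g w')"
    and g_inc: "\<And>q. incomparable (words q) g"
begin

lemma T: "T \<subseteq> T_max"
  using tree by (simp add: F_max_tree_def)

lemma e_succ:
  assumes "w \<in> T_max" "a \<le> length w"
  obtains i where "e w a = sp w @ [i]" "e w a \<in> T"
proof -
  have "e w a \<in> succs T (sp w)" using e[OF assms(1)] assms(2) by (auto simp: embedding_def induced_def)
  then show ?thesis using that by (auto simp: succs_def)
qed

lemma sp_e: "w \<in> T_max \<Longrightarrow> a \<le> length w \<Longrightarrow> prefix (sp w) (e w a)"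
  by (metis e_succ prefixI)

lemma sp_g_snoc: "w @ [a] \<in> T_max \<Longrightarrow> prefix (sp w) (g (w @ [a]))"
  using sp_e e_g prefix_order.trans by (metis T_max_snoc_iff)

lemma g_take: "w \<in> T_max \<Longrightarrow> prefix (g (take m w)) (g w)"
proof (induction w rule: rev_induct)
  case (snoc a w)
  show ?case
  proof (cases "m \<le> length w")
    case True
    have "w \<in> T_max" using snoc.prems by (simp add: T_max_snoc_iff)
    then have "prefix (g (take m w)) (sp w)" using snoc.IH g_sp prefix_order.trans by blast
    then show ?thesis using True sp_g_snoc[OF snoc.prems] prefix_order.trans by auto
  qed simp
qed simp

lemma length_g: "w \<in> T_max \<Longrightarrow> length w \<le> length (g w)"
proof (induction w rule: rev_induct)
  case (snoc a w)
  have w: "w \<in> T_max" using snoc.prems by (simp add: T_max_snoc_iff)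
  have "length (g w) \<le> length (sp w)" by (rule prefix_length_le[OF g_sp[OF w]])
  then show ?case using snoc.IH[OF w] sp_g[OF w snoc.prems] by simp
qed simp

section \<open>Branches and their words\<close>

definition threaded :: "(nat \<Rightarrow> nat) \<Rightarrow> bool" where
  "threaded y \<longleftrightarrow> (\<forall>q. \<exists>w\<in>words q. through y (g w))"

definition word :: "(nat \<Rightarrow> nat) \<Rightarrow> nat \<Rightarrow> nat list" where
  "word y q = (THE w. w \<in> words q \<and> through y (g w))"

lemma word_eqI: "w \<in> words q \<Longrightarrow> through y (g w) \<Longrightarrow> word y q = w"
  unfolding word_def using incomparableD[OF g_inc] through_comparable by (intro the_equality) blast+

lemma word:
  assumes "threaded y"
  shows "word y q \<in> words q" "through y (g (word y q))" "word y q \<in> T_max" "length (word y q) = q"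
proof -
  obtain w where w: "w \<in> words q" "through y (g w)" using assms unfolding threaded_def by blast
  then show "word y q \<in> words q" "through y (g (word y q))" using word_eqI by simp_all
  then show "word y q \<in> T_max" "length (word y q) = q" by (simp_all add: words_def)
qed

lemma take_word:
  assumes "threaded y" "q \<le> q'"
  shows "take q (word y q') = word y q"
proof (rule word_eqI[symmetric])
  show "take q (word y q') \<in> words q" using word[OF assms(1), of q'] assms(2) T_max_take by (simp add: words_def)
  show "through y (g (take q (word y q')))"
    by (rule through_prefix[OF word(2)[OF assms(1)] g_take[OF word(3)[OF assms(1)]]])
qed

lemma word_cofinal:
  assumes y: "threaded y" "threaded y'" and eq: "\<And>q. word y q = word y' q"
  shows "y = y'"
proof
  fix n
  let ?t = "g (word y (Suc n))"
  have "through y ?t" "through y' ?t" using word(2)[OF y(1)] word(2)[OF y(2), of "Suc n"] eq by simp_all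
  then have "restr y (length ?t) = restr y' (length ?t)" by (simp add: through_def)
  moreover have "n < length ?t" using length_g[OF word(3)[OF y(1)], of "Suc n"] word(4)[OF y(1)] by simp
  ultimately show "y n = y' n" by (simp add: restr_eq_iff)
qed

lemma words_separate:
  assumes y: "threaded y" "threaded y'" "y \<noteq> y'"
  obtains q where "\<And>q'. q \<le> q' \<Longrightarrow> word y q' \<noteq> word y' q'"
proof -
  obtain q where "word y q \<noteq> word y' q" using word_cofinal[OF y(1,2)] y(3) by blast
  then have "word y q' \<noteq> word y' q'" if "q \<le> q'" for q' using take_word[OF _ that] y by metis
  then show ?thesis by (rule that)
qed

lemma through_e:
  assumes y: "threaded y" and "L < Q"
  shows "through y (e (take L (word y Q)) (word y Q ! L))" "word y Q ! L \<le> L" "take L (word y Q) \<in> T_max"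
proof -
  let ?w = "take L (word y Q)" and ?a = "word y Q ! L"
  have Sw: "word y (Suc L) = ?w @ [?a]"
    using take_word[OF y, of "Suc L" Q] assms(2) word(4)[OF y, of Q] by (simp add: take_Suc_conv_app_nth)
  then have "?w @ [?a] \<in> T_max" using word(3)[OF y, of "Suc L"] by simp
  then show w: "?w \<in> T_max" and a: "?a \<le> L"
    using assms(2) word(4)[OF y, of Q] by (auto simp: T_max_snoc_iff)
  have "prefix (e ?w ?a) (g (word y (Suc L)))"
    unfolding Sw using a assms(2) word(4)[OF y, of Q] by (intro e_g[OF w]) simp
  then show "through y (e ?w ?a)" by (rule through_prefix[OF word(2)[OF y]])
qed

text \<open>Branches whose words separate after \<open>w\<close> leave \<open>sp w\<close> through
  different successors, so they meet exactly there. Their order and relations are those of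
  \<open>F (sp w)\<close> on these successors, which \<open>e w\<close> has copied from the
  limit.\<close>

lemma word_split:
  assumes y: "threaded y" "threaded y'" and L: "splits_at L (word y Q) (word y' Q)"
  shows "meet_length y y' = length (sp (take L (word y Q)))"
    and "less_fun y y' \<longleftrightarrow> lt (word y Q ! L) (word y' Q ! L)"
    and "l < k \<Longrightarrow> rel (F_max F) l y y' \<longleftrightarrow> rel M l (word y Q ! L) (word y' Q ! L)"
proof -
  let ?w = "take L (word y Q)" and ?a = "word y Q ! L" and ?b = "word y' Q ! L"
  have LQ: "L < Q" and w': "take L (word y' Q) = ?w" and ab: "?a \<noteq> ?b"
    using L word(4)[OF y(1), of Q] unfolding splits_at_def by auto
  have ty: "through y (e ?w ?a)" "?a \<le> L" "?w \<in> T_max" by (rule through_e[OF y(1) LQ])+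
  have ty': "through y' (e ?w ?b)" "?b \<le> L" using through_e[OF y(2) LQ] unfolding w' by blast+
  have lw: "length ?w = L" using LQ word(4)[OF y(1), of Q] by simp
  obtain i where i: "e ?w ?a = sp ?w @ [i]" "e ?w ?a \<in> T" by (rule e_succ[OF ty(3)]) (use ty(2) lw in simp)+
  obtain j where j: "e ?w ?b = sp ?w @ [j]" "e ?w ?b \<in> T" by (rule e_succ[OF ty(3)]) (use ty'(2) lw in simp)+
  note emb = e[OF ty(3), unfolded lw embedding_def induced_simps]
  have "e ?w ?a \<noteq> e ?w ?b" using emb ty(2) ty'(2) ab by (auto simp: inj_on_def)
  then have ij: "i \<noteq> j" using i(1) j(1) by simp
  let ?n = "length (sp ?w)"
  have r: "restr y (Suc ?n) = e ?w ?a" "restr y' (Suc ?n) = e ?w ?b"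
    using ty(1) ty'(1) i(1) j(1) unfolding through_def by simp_all
  then have "restr y (Suc ?n) ! ?n = i" "restr y' (Suc ?n) ! ?n = j" using i(1) j(1) by simp_all
  then have yn: "y ?n = i" "y' ?n = j" by simp_all
  have "take ?n (restr y (Suc ?n)) = take ?n (restr y' (Suc ?n))" unfolding r using i(1) j(1) by simp
  then have sm: "restr y ?n = restr y' ?n" by (simp add: take_restr)
  then have below: "\<And>m. m < ?n \<Longrightarrow> y m = y' m" by (simp add: restr_eq_iff)
  show ml: "meet_length y y' = ?n"
    unfolding meet_length_def
    by (rule Least_equality) (use yn ij below in \<open>auto simp: not_less[symmetric]\<close>)
  have mt: "meet y y' = sp ?w"
    unfolding meet_def ml using r(1) i(1) take_restr[of ?n "Suc ?n" y] by simp
  have "less_fun y y' \<longleftrightarrow> i < j"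
  proof
    assume "less_fun y y'"
    then obtain m where m: "y m < y' m" "\<And>m'. m' < m \<Longrightarrow> y m' = y' m'" by (auto simp: less_fun_def)
    then have "m = ?n" using below yn ij by (metis less_irrefl linorder_neqE_nat)
    then show "i < j" using m yn by simp
  next
    assume "i < j"
    then show "less_fun y y'" using yn below unfolding less_fun_def by (intro exI[of _ ?n]) auto
  qed
  also have "\<dots> \<longleftrightarrow> (e ?w ?a, e ?w ?b) \<in> lexord less_than"
    unfolding i(1) j(1) by (simp add: lexord_same_pref_iff)
  also have "\<dots> \<longleftrightarrow> ordr (F (sp ?w)) (e ?w ?a) (e ?w ?b)"
  proof -
    have "e ?w ?a \<in> succs T_max (sp ?w)" "e ?w ?b \<in> succs T_max (sp ?w)"
      using i j T by (auto simp: succs_def)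
    moreover have "sp ?w \<in> T_max" using sp_T[OF ty(3)] T by blast
    ultimately show ?thesis using nodes unfolding node_structures_def by blast
  qed
  also have "\<dots> \<longleftrightarrow> lt ?a ?b" using emb ty(2) ty'(2) by simp
  finally show "less_fun y y' \<longleftrightarrow> lt ?a ?b" .
  have "y \<noteq> y'" using yn ij by auto
  then show "rel (F_max F) l y y' \<longleftrightarrow> rel M l ?a ?b" if "l < k"
    unfolding F_max_def using emb ty(2) ty'(2) that by (simp add: ml mt r)
qed

definition skew_words :: "(nat \<Rightarrow> nat) set \<Rightarrow> nat \<Rightarrow> bool" where
  "skew_words B Q \<longleftrightarrow> inj_on (\<lambda>y. word y Q) B \<and> (\<forall>y\<in>B. \<forall>y'\<in>B. \<forall>z\<in>B. \<forall>z'\<in>B. \<forall>L.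
     splits_at L (word y Q) (word y' Q) \<and> splits_at L (word z Q) (word z' Q) \<longrightarrow>
     take L (word y Q) = take L (word z Q))"

text \<open>By \<open>sp_g\<close>, splitting nodes of words of different lengths have lengths in
  the same order. For equal levels \<open>skew_words\<close> leaves a single splitting node, hence
  equal meets.\<close>

lemma split_le_iff:
  assumes B: "\<And>y. y \<in> B \<Longrightarrow> threaded y" "skew_words B Q"
    and y: "y \<in> B" "y' \<in> B" "z \<in> B" "z' \<in> B"
    and L: "splits_at L (word y Q) (word y' Q)" "splits_at L' (word z Q) (word z' Q)"
  shows "L \<le> L' \<longleftrightarrow> meet_length y y' \<le> meet_length z z'"
proof -
  let ?w = "take L (word y Q)" and ?w' = "take L' (word z Q)"
  have ml: "meet_length y y' = length (sp ?w)" "meet_length z z' = length (sp ?w')"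
    using word_split(1) B(1) y L by blast+
  have l: "length ?w = L" "length ?w' = L'" using L unfolding splits_at_def by simp_all
  have w: "?w \<in> T_max" "?w' \<in> T_max" using word(3)[OF B(1)] y T_max_take by blast+
  have "length (sp u) < length (sp v)" if "length u < length v" "u \<in> T_max" "v \<in> T_max" for u v
    using sp_g[OF that(2,3,1)] prefix_length_le[OF g_sp[OF that(3)]] by simp
  from this[of ?w ?w'] this[of ?w' ?w] have "L < L' \<Longrightarrow> length (sp ?w) < length (sp ?w')"
    "L' < L \<Longrightarrow> length (sp ?w') < length (sp ?w)"
    using w unfolding l by blast+
  moreover have "?w = ?w'" if "L = L'" using B(2) y L that unfolding skew_words_def by blast
  ultimately show ?thesis unfolding ml by (metis linorder_neqE_nat nle_le not_less)
qed

lemma less_fun_total_threaded: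
  assumes "threaded y" "threaded y'" "y \<noteq> y'"
  shows "less_fun y y' \<or> less_fun y' y"
proof -
  obtain Q where "word y Q \<noteq> word y' Q" using words_separate[OF assms] by blast
  then obtain L where L: "splits_at L (word y Q) (word y' Q)" using exists_splits_at word(4) assms(1,2) by metis
  then have L': "splits_at L (word y' Q) (word y Q)" by (auto simp: splits_at_def)
  have "word y Q ! L \<noteq> word y' Q ! L" using L by (simp add: splits_at_def)
  from lt_total[OF this] show ?thesis
    using word_split(2)[OF assms(1,2) L] word_split(2)[OF assms(2,1) L'] by simp
qed

lemma sorted_enumeration:
  assumes B: "finite B" "\<And>y. y \<in> B \<Longrightarrow> threaded y"
  obtains y where "bij_betw y {..<card B} B" "\<And>i l. i < l \<Longrightarrow> l < card B \<Longrightarrow> less_fun (y i) (y l)"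
proof -
  obtain ys where ys: "sorted_wrt less_fun ys" "set ys = B"
    using exists_sorted_list[of less_fun B] less_fun_trans less_fun_total_threaded B by metis
  have s: "less_fun (ys ! i) (ys ! l)" if "i < l" "l < length ys" for i l
    using ys(1) that by (simp add: sorted_wrt_iff_nth_less)
  have d: "distinct ys"
    unfolding distinct_conv_nth using s less_fun_irrefl by (metis linorder_neqE_nat)
  then have "bij_betw ((!) ys) {..<card B} B" using ys(2) bij_betw_nth distinct_card by blast
  then show ?thesis using that[of "(!) ys"] s distinct_card[OF d] ys(2) by simp
qed

lemma reference_shape:
  assumes B: "1 \<le> card B" "\<And>x. x \<in> B \<Longrightarrow> threaded x" "skew_words B Q"
    and y: "bij_betw y {..<card B} B" "\<And>i l. i < l \<Longrightarrow> l < card B \<Longrightarrow> less_fun (y i) (y l)"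
  shows "\<exists>s. arity s = card B \<and> has_shape s (\<lambda>i. word (y i) Q)"
proof -
  let ?u = "\<lambda>i. word (y i) Q"
  have inB: "y i \<in> B" if "i < card B" for i using y(1) that by (auto simp: bij_betw_def)
  have "\<exists>L. splits_at L (?u i) (?u l)" if "i < card B" "l < card B" "i \<noteq> l" for i l
  proof (rule exists_splits_at)
    show "length (?u i) = length (?u l)" using word(4) B(2) inB that by metis
    have "y i \<noteq> y l" using y(1) that by (auto simp: bij_betw_def inj_on_def)
    then show "?u i \<noteq> ?u l" using B(3) inB that unfolding skew_words_def inj_on_def by blast
  qed
  then obtain D where D: "\<And>i l. i < card B \<Longrightarrow> l < card B \<Longrightarrow> i \<noteq> l \<Longrightarrow> splits_at (D i l) (?u i) (?u l)" by metis
  show ?thesis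
  proof (rule has_shape_exists[where D = D and Q = Q])
    show "1 \<le> card B" by (rule B(1))
    show "splits_at (D i l) (?u i) (?u l)" if "i < card B" "l < card B" "i \<noteq> l" for i l using D that .
    show "lt (?u i ! D i l) (?u l ! D i l)" if "i < l" "l < card B" for i l
      using word_split(2)[of "y i" "y l" "D i l" Q] D[of i l] y(2)[of i l] that B(2) inB by simp
    show "take (D i l) (?u i) = take (D i l) (?u i')" if "i < card B" "l < card B" "i \<noteq> l"
      "i' < card B" "l' < card B" "i' \<noteq> l'" "D i l = D i' l'" for i l i' l'
    proof -
      have "splits_at (D i l) (?u i) (?u l)" "splits_at (D i l) (?u i') (?u l')"
        using D[OF that(1-3)] D[OF that(4-6)] that(7) by simp_all
      then show ?thesis
        using B(3) inB[OF that(1)] inB[OF that(2)] inB[OF that(4)] inB[OF that(5)]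
        unfolding skew_words_def by blast
    qed
    show "length (?u i) = Q" if "i < card B" for i using word(4) B(2) inB that by blast
  qed
qed

text \<open>A strong isomorphism preserves order, relations and the comparison of meets; translated
  by \<open>word_split\<close> and \<open>split_le_iff\<close>, these are the data needed in
  \<open>has_shape_transfer\<close>.\<close>

lemma transport_shape:
  assumes B: "\<And>y. y \<in> B \<Longrightarrow> threaded y" "skew_words B Q"
    and B': "\<And>y. y \<in> B' \<Longrightarrow> threaded y" "skew_words B' Q'"
    and \<phi>: "strong_isomorphism k F \<phi> B B'"
    and y: "bij_betw y {..<arity s} B" and s: "has_shape s (\<lambda>i. word (y i) Q)"
  shows "has_shape s (\<lambda>i. word (\<phi> (y i)) Q')"
proof -
  have iso: "inj_on \<phi> B" "\<phi> ` B = B'" "\<And>x z. x \<in> B \<Longrightarrow> z \<in> B \<Longrightarrow> less_fun x z \<longleftrightarrow> less_fun (\<phi> x) (\<phi> z)"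
    "\<And>x z l. x \<in> B \<Longrightarrow> z \<in> B \<Longrightarrow> l < k \<Longrightarrow> rel (F_max F) l x z \<longleftrightarrow> rel (F_max F) l (\<phi> x) (\<phi> z)"
    using \<phi> unfolding strong_isomorphism_def isomorphism_def embedding_def
    by (simp_all add: F_max_def induced_def)
  have ml: "meet_length x0 z0 \<le> meet_length x1 z1 \<longleftrightarrow> meet_length (\<phi> x0) (\<phi> z0) \<le> meet_length (\<phi> x1) (\<phi> z1)"
    if "x0 \<in> B" "z0 \<in> B" "x1 \<in> B" "z1 \<in> B" "x0 \<noteq> z0" "x1 \<noteq> z1" for x0 z0 x1 z1
    using \<phi> that unfolding strong_isomorphism_def by blast
  have inB: "y i \<in> B" if "i < arity s" for i using y that by (auto simp: bij_betw_def)
  have inB': "\<phi> (y i) \<in> B'" if "i < arity s" for i using iso(2) inB[OF that] by blast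
  have ne: "y i \<noteq> y l" if "i < arity s" "l < arity s" "i \<noteq> l" for i l
    using y that by (auto simp: bij_betw_def inj_on_def)
  have ne': "\<phi> (y i) \<noteq> \<phi> (y l)" if "i < arity s" "l < arity s" "i \<noteq> l" for i l
    using iso(1) inB ne that by (meson inj_onD)
  have "\<exists>L. splits_at L (word x Q) (word z Q)" if "x \<in> B" "z \<in> B" "x \<noteq> z" for x z
  proof (rule exists_splits_at)
    show "length (word x Q) = length (word z Q)" using word(4) B(1) that by metis
    show "word x Q \<noteq> word z Q" using B(2) that unfolding skew_words_def inj_on_def by blast
  qed
  then have "\<forall>i l. \<exists>L. i < arity s \<longrightarrow> l < arity s \<longrightarrow> i \<noteq> l \<longrightarrow> splits_at L (word (y i) Q) (word (y l) Q)"
    using inB ne by meson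
  then obtain D where D: "\<And>i l. i < arity s \<Longrightarrow> l < arity s \<Longrightarrow> i \<noteq> l \<Longrightarrow> splits_at (D i l) (word (y i) Q) (word (y l) Q)"
    by metis
  have "\<exists>L. splits_at L (word x Q') (word z Q')" if "x \<in> B'" "z \<in> B'" "x \<noteq> z" for x z
  proof (rule exists_splits_at)
    show "length (word x Q') = length (word z Q')" using word(4) B'(1) that by metis
    show "word x Q' \<noteq> word z Q'" using B'(2) that unfolding skew_words_def inj_on_def by blast
  qed
  then have "\<forall>i l. \<exists>L. i < arity s \<longrightarrow> l < arity s \<longrightarrow> i \<noteq> l \<longrightarrow> splits_at L (word (\<phi> (y i)) Q') (word (\<phi> (y l)) Q')"
    using inB' ne' by meson
  then obtain D' where D': "\<And>i l. i < arity s \<Longrightarrow> l < arity s \<Longrightarrow> i \<noteq> l \<Longrightarrow>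
      splits_at (D' i l) (word (\<phi> (y i)) Q') (word (\<phi> (y l)) Q')"
    by metis
  show ?thesis
  proof (rule has_shape_transfer[where D = D and D' = D' and Q = Q' and k' = k, OF s])
    show "length (word (\<phi> (y i)) Q') = Q'" if "i < arity s" for i using word(4) B'(1) inB'[OF that] by blast
    show "splits_at (D i l) (word (y i) Q) (word (y l) Q) \<and> splits_at (D' i l) (word (\<phi> (y i)) Q') (word (\<phi> (y l)) Q') \<and>
       (lt (word (y i) Q ! D i l) (word (y l) Q ! D i l) \<longleftrightarrow>
        lt (word (\<phi> (y i)) Q' ! D' i l) (word (\<phi> (y l)) Q' ! D' i l)) \<and>
       (\<forall>r<k. rel M r (word (y i) Q ! D i l) (word (y l) Q ! D i l) \<longleftrightarrow>
        rel M r (word (\<phi> (y i)) Q' ! D' i l) (word (\<phi> (y l)) Q' ! D' i l))"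
      if "i < arity s" "l < arity s" "i \<noteq> l" for i l
    proof -
      note b = inB[OF that(1)] inB[OF that(2)] and b' = inB'[OF that(1)] inB'[OF that(2)]
      note W = word_split(2,3)[OF B(1)[OF b(1)] B(1)[OF b(2)] D[OF that]]
      note W' = word_split(2,3)[OF B'(1)[OF b'(1)] B'(1)[OF b'(2)] D'[OF that]]
      show ?thesis
        using D[OF that] D'[OF that] iso(3)[OF b] iso(4)[OF b] W W' by simp
    qed
    show "D i l \<le> D i' l' \<longleftrightarrow> D' i l \<le> D' i' l'" if "i < arity s" "l < arity s" "i \<noteq> l" "i' < arity s" "l' < arity s" "i' \<noteq> l'"
      for i l i' l'
    proof -
      note b = inB[OF that(1)] inB[OF that(2)] inB[OF that(4)] inB[OF that(5)]
      note b' = inB'[OF that(1)] inB'[OF that(2)] inB'[OF that(4)] inB'[OF that(5)]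
      show ?thesis
        using split_le_iff[OF B b D[OF that(1-3)] D[OF that(4-6)]]
          split_le_iff[OF B' b' D'[OF that(1-3)] D'[OF that(4-6)]]
          ml[OF b ne[OF that(1-3)] ne[OF that(4-6)]] by simp
    qed
  qed simp
qed

end

section \<open>The fusion subtree and its branches\<close>

locale fusion = embedded_tree +
  fixes N q m j :: "nat \<Rightarrow> nat" and U :: "nat \<Rightarrow> nat \<Rightarrow> nat list"
  assumes N_0: "N 0 = 1" and q_0: "q 0 = 0"
    and N_pos: "\<And>t. 0 < N t"
    and length_U: "\<And>t i. i < N t \<Longrightarrow> length (U t i) = q t"
    and U_T_max: "\<And>t i. i < N t \<Longrightarrow> U t i \<in> T_max"
    and U_increasing: "\<And>t. increasing_nodes (N t) (U t) (q t)"
    and U_skew: "\<And>t. skew_nodes (N t) (U t) (q t)"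
    and m: "\<And>t. m t < N t" and j: "\<And>t. 1 \<le> j t"
    and N_Suc: "\<And>t. N (Suc t) = N t + j t - 1" and q_Suc: "\<And>t. q t < q (Suc t)"
    and U_Suc: "\<And>t i. i < N (Suc t) \<Longrightarrow> prefix (U t (old_index (m t) (j t) i)) (U (Suc t) i)"
    and split: "\<And>t. \<exists>v \<eta>. prefix (U t (m t)) v \<and> v \<in> T_max \<and> partial_embedding (j t) \<eta> \<and>
      (\<forall>a<j t. \<eta> (sorted_letters (j t) ! a) \<le> length v \<and>
         prefix (v @ [\<eta> (sorted_letters (j t) ! a)]) (U (Suc t) (m t + a)))"
    and dense: "\<And>t0 i a. i < N t0 \<Longrightarrow> \<exists>t\<ge>t0. a \<le> j t \<and> prefix (U t0 i) (U t (m t))"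
begin

definition S :: "nat list set" where
  "S = {p. \<exists>t i. i < N t \<and> prefix p (g (U t i))}"

lemma U_in_words: "i < N t \<Longrightarrow> U t i \<in> words (q t)"
  using length_U U_T_max by (simp add: words_def)

lemma U_splits:
  assumes "i < l" "l < N t"
  obtains L where "splits_at L (U t i) (U t l)" "lt (U t i ! L) (U t l ! L)"
proof -
  obtain L where L: "L < q t" "take L (U t i) = take L (U t l)" "lt (U t i ! L) (U t l ! L)"
    using U_increasing[of t] assms unfolding increasing_nodes_def by blast
  then have "splits_at L (U t i) (U t l)" unfolding splits_at_def using length_U[of _ t] assms by auto
  then show ?thesis using L(3) by (rule that)
qed

lemma inj_U: "inj_on (U t) {..<N t}"
proof (rule linorder_inj_onI)
  fix i l assume "i < l" "i \<in> {..<N t}" "l \<in> {..<N t}"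
  then obtain L where "splits_at L (U t i) (U t l)" using U_splits by (metis lessThan_iff)
  then show "U t i \<noteq> U t l" by (auto simp: splits_at_def)
qed auto

lemma old_index_N: "i < N (Suc t) \<Longrightarrow> old_index (m t) (j t) i < N t"
  using old_index_less[OF m j] N_Suc by simp

lemma U_descend: "t \<le> t' \<Longrightarrow> i < N t' \<Longrightarrow> \<exists>i'<N t. prefix (U t i') (U t' i)"
proof (induction t' arbitrary: i rule: dec_induct)
  case (step t')
  then obtain i' where "i' < N t" "prefix (U t i') (U t' (old_index (m t') (j t') i))" using old_index_N by blast
  then show ?case using U_Suc[OF step.prems] prefix_order.trans by blast
qed blast

lemma U_ascend: "t \<le> t' \<Longrightarrow> i < N t \<Longrightarrow> \<exists>i'<N t'. prefix (U t i) (U t' i')"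
proof (induction t' rule: dec_induct)
  case (step t')
  then obtain i' where i': "i' < N t'" "prefix (U t i) (U t' i')" by blast
  let ?l = "new_index (m t') (j t') i'"
  have "?l < N (Suc t')" using new_index_less[OF m j i'(1)] N_Suc by simp
  then show ?case using U_Suc[of ?l t'] i'(2) prefix_order.trans by (auto simp: old_index_new_index[OF j])
qed blast

lemma g_mono: "w' \<in> T_max \<Longrightarrow> prefix w w' \<Longrightarrow> prefix (g w) (g w')"
  using g_take[of w' "length w"] by (auto simp: prefix_def)

lemma is_tree_S: "is_tree S"
proof -
  have "[] \<in> S" unfolding S_def using N_pos[of 0] by auto
  then show ?thesis unfolding is_tree_def S_def by (blast intro: prefix_order.trans)
qed

lemma S_subset: "S \<subseteq> T"
proof
  fix p assume "p \<in> S"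
  then obtain t i where "i < N t" "prefix p (g (U t i))" unfolding S_def by blast
  then show "p \<in> T" using g_T[OF U_T_max] tree by (auto simp: F_max_tree_def is_tree_def)
qed

text \<open>A finite structure has a copy in \<open>M\<close> below some \<open>b\<close>. By
  \<open>dense\<close> a node above the given one is split at some stage into at least
  \<open>b\<close> copies, and \<open>e v \<circ> \<eta>\<close> carries the structure to successors
  of \<open>sp v\<close> that are kept in \<open>S\<close>.\<close>

lemma F_max_tree_S: "F_max_tree k K F S"
  unfolding F_max_tree_def
proof (intro conjI ballI)
  show "is_tree S" by (rule is_tree_S)
  show "S \<subseteq> T_max" using S_subset T by blast
  fix A p assume A: "A \<in> K" and p: "p \<in> S"
  obtain t i where ti: "i < N t" "prefix p (g (U t i))" using p unfolding S_def by blast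
  obtain f where f: "embedding k f A M" using A K_iff unfolding embeds_def by blast
  have "finite (f ` universe A)" using A K_iff by simp
  then obtain b where b: "f ` universe A \<subseteq> {..<b}" using finite_nat_bounded by blast
  obtain t1 where t1: "b \<le> j t1" "prefix (U t i) (U t1 (m t1))" using dense[OF ti(1)] by blast
  obtain v \<eta> where v: "prefix (U t1 (m t1)) v" "v \<in> T_max" and \<eta>: "partial_embedding (j t1) \<eta>"
    and a: "\<And>a. a < j t1 \<Longrightarrow> \<eta> (sorted_letters (j t1) ! a) \<le> length v"
      "\<And>a. a < j t1 \<Longrightarrow> prefix (v @ [\<eta> (sorted_letters (j t1) ! a)]) (U (Suc t1) (m t1 + a))"
    using split[of t1] by (elim exE conjE) blast
  have x: "\<eta> x \<le> length v" "e v (\<eta> x) \<in> S" if x: "x < j t1" for x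
  proof -
    have "x \<in> set (sorted_letters (j t1))" using sorted_letters(2) x by simp
    then obtain c where c: "c < j t1" "x = sorted_letters (j t1) ! c" by (auto simp: in_set_conv_nth)
    show 1: "\<eta> x \<le> length v" using a(1)[OF c(1)] c(2) by simp
    have N: "m t1 + c < N (Suc t1)" using m[of t1] c(1) N_Suc by simp
    have "prefix (g (v @ [\<eta> x])) (g (U (Suc t1) (m t1 + c)))"
      using g_mono[OF U_T_max[OF N]] a(2)[OF c(1)] c(2) by simp
    then have "prefix (e v (\<eta> x)) (g (U (Suc t1) (m t1 + c)))"
      using e_g[OF v(2) 1] prefix_order.trans by blast
    then show "e v (\<eta> x) \<in> S" unfolding S_def using N by blast
  qed
  have S_prefix: "r \<in> S" if "r' \<in> S" "prefix r r'" for r r'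
    using is_tree_S that unfolding is_tree_def by blast
  show "\<exists>s\<in>S. prefix p s \<and> embeds k A (induced (F s) (succs S s))"
  proof (intro bexI conjI)
    have "0 < j t1" using j[of t1] by simp
    then show "sp v \<in> S" using x[of 0] S_prefix sp_e[OF v(2)] by blast
    have "prefix (g (U t i)) (g v)" using g_mono[OF v(2)] t1(2) v(1) prefix_order.trans by blast
    then show "prefix p (sp v)" using ti(2) g_sp[OF v(2)] prefix_order.trans by blast
    have "f y < j t1" if "y \<in> universe A" for y
    proof -
      have "f y < b" using b that by blast
      then show ?thesis using t1(1) by simp
    qed
    moreover have "e v (\<eta> x) \<in> succs S (sp v)" if "x < j t1" for x
      using e_succ[OF v(2) x(1)[OF that]] x(2)[OF that] by (auto simp: succs_def)
    ultimately have "embedding k (e v \<circ> (\<eta> \<circ> f)) A (induced (F (sp v)) (succs S (sp v)))"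
      using f \<eta> e[OF v(2)] x(1) unfolding embedding_def inj_on_def by auto
    then show "embeds k A (induced (F (sp v)) (succs S (sp v)))" unfolding embeds_def by blast
  qed
qed

lemma q_mono: "t \<le> q t"
proof (induction t)
  case (Suc t)
  then show ?case using q_Suc[of t] by simp
qed simp

text \<open>A sufficiently long initial segment of \<open>y\<close> lies below some
  \<open>g (U t'' l')\<close> with \<open>t \<le> t''\<close>, and that node has an ancestor at
  stage \<open>t\<close>.\<close>

lemma branch_S:
  assumes y: "y \<in> branches S"
  shows "\<exists>i<N t. through y (g (U t i))"
proof -
  define n where "n = Max ((length \<circ> g \<circ> U t) ` {..<N t})"
  have n: "length (g (U t i)) \<le> n" if "i < N t" for i
    unfolding n_def using that by (intro Max_ge) auto
  obtain t' l where l: "l < N t'" "prefix (restr y n) (g (U t' l))"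
    using y unfolding branches_def S_def by blast
  obtain t'' l' where l': "t \<le> t''" "l' < N t''" "prefix (restr y n) (g (U t'' l'))"
  proof -
    obtain l' where "l' < N (max t t')" "prefix (U t' l) (U (max t t') l')" using U_ascend[of t' "max t t'", OF _ l(1)] by auto
    moreover from this have "prefix (restr y n) (g (U (max t t') l'))"
      using l(2) g_mono[OF U_T_max] prefix_order.trans by blast
    ultimately show ?thesis by (intro that[of "max t t'" l']) simp_all
  qed
  obtain i where i: "i < N t" "prefix (U t i) (U t'' l')" using U_descend[OF l'(1,2)] by blast
  have "prefix (g (U t i)) (g (U t'' l'))" by (rule g_mono[OF U_T_max[OF l'(2)] i(2)])
  from prefix_length_prefix[OF this l'(3)] have "prefix (g (U t i)) (restr y n)" using n[OF i(1)] by simp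
  then show ?thesis using i(1) through_prefix[OF through_restr[of y n]] by blast
qed

lemma threaded_S: "y \<in> branches S \<Longrightarrow> threaded y"
  unfolding threaded_def
proof
  fix Q assume "y \<in> branches S"
  then obtain i where i: "i < N Q" "through y (g (U Q i))" using branch_S by blast
  have "take Q (U Q i) \<in> words Q"
    using T_max_take U_T_max[OF i(1)] length_U[OF i(1)] q_mono[of Q] by (simp add: words_def)
  then show "\<exists>w\<in>words Q. through y (g w)" using through_prefix[OF i(2) g_take[OF U_T_max[OF i(1)]]] by blast
qed

lemma word_S: "y \<in> branches S \<Longrightarrow> \<exists>i<N t. word y (q t) = U t i"
  using branch_S[of y t] word_eqI[OF U_in_words] by blast

lemma skew_words_S:
  assumes "B \<subseteq> branches S" "inj_on (\<lambda>y. word y (q t)) B"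
  shows "skew_words B (q t)"
proof -
  have "take L (word y (q t)) = take L (word z (q t))"
    if B: "y \<in> B" "y' \<in> B" "z \<in> B" "z' \<in> B" and L: "splits_at L (word y (q t)) (word y' (q t))"
      "splits_at L (word z (q t)) (word z' (q t))" for y y' z z' L
  proof -
    obtain i i' where i: "i < N t" "i' < N t" "word y (q t) = U t i" "word y' (q t) = U t i'"
      using word_S B(1,2) assms(1) by (meson subsetD)
    obtain l l' where l: "l < N t" "l' < N t" "word z (q t) = U t l" "word z' (q t) = U t l'"
      using word_S B(3,4) assms(1) by (meson subsetD)
    have "L < q t" using L(1) i length_U by (simp add: splits_at_def)
    then show ?thesis
      using U_skew[of t] L i(1,2) l(1,2) unfolding i(3,4) l(3,4) skew_nodes_def splits_at_def by blast
  qed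
  then show ?thesis using assms(2) unfolding skew_words_def by blast
qed

text \<open>A tuple of branches of \<open>S\<close> is coloured at the first stage at which its members are separated.\<close>

lemma first_separation:
  fixes y :: "nat \<Rightarrow> nat \<Rightarrow> nat" and n :: nat
  assumes y: "\<And>i. i < n \<Longrightarrow> y i \<in> branches S" "\<And>i l. i < l \<Longrightarrow> l < n \<Longrightarrow> less_fun (y i) (y l)" "2 \<le> n"
  obtains t h where "strict_mono_on {..<n} h" "h ` {..<n} \<subseteq> {..<N (Suc t)}"
    "\<And>i. i < n \<Longrightarrow> word (y i) (q (Suc t)) = U (Suc t) (h i)" "\<not> inj_on (old_index (m t) (j t) \<circ> h) {..<n}"
    "skew_words (y ` {..<n}) (q (Suc t))"
proof -
  have "\<forall>t i. \<exists>l. i < n \<longrightarrow> l < N t \<and> word (y i) (q t) = U t l" using word_S y(1) by blast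
  then obtain h where h: "\<And>t i. i < n \<Longrightarrow> h t i < N t" "\<And>t i. i < n \<Longrightarrow> word (y i) (q t) = U t (h t i)"
    by metis
  have th: "threaded (y i)" if "i < n" for i using threaded_S y(1) that by blast
  \<comment> \<open>The nodes that a branch passes at consecutive stages are related by
    \<open>old_index\<close>.\<close>
  have h_Suc: "h t i = old_index (m t) (j t) (h (Suc t) i)" if i: "i < n" for t i
  proof -
    let ?l = "h (Suc t) i"
    have p: "old_index (m t) (j t) ?l < N t" by (rule old_index_N[OF h(1)[OF i]])
    have "prefix (U t (old_index (m t) (j t) ?l)) (word (y i) (q (Suc t)))"
      unfolding h(2)[OF i] by (rule U_Suc[OF h(1)[OF i]])
    then have "take (q t) (word (y i) (q (Suc t))) = U t (old_index (m t) (j t) ?l)"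
      using length_U[OF p] by (auto simp: prefix_def)
    then have "U t (h t i) = U t (old_index (m t) (j t) ?l)"
      using take_word[OF th[OF i], of "q t" "q (Suc t)"] q_Suc[of t] h(2)[OF i, of t] by simp
    then show ?thesis using inj_U[of t] p h(1)[OF i] by (simp add: inj_on_def)
  qed
  obtain t0 where t0: "inj_on (h t0) {..<n}"
  proof -
    have "\<exists>t. \<forall>t'\<ge>t. word (y i) t' \<noteq> word (y l) t'" if "i < l" "l < n" for i l
    proof -
      have "y i \<noteq> y l" using y(2)[OF that] less_fun_irrefl by metis
      moreover have "i < n" using that by simp
      ultimately obtain q where "\<And>q'. q \<le> q' \<Longrightarrow> word (y i) q' \<noteq> word (y l) q'"
        using words_separate[OF th[of i] th[of l]] \<open>l < n\<close> by blast
      then show ?thesis by blast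
    qed
    then have "\<forall>i l. \<exists>t. i < l \<longrightarrow> l < n \<longrightarrow> (\<forall>t'\<ge>t. word (y i) t' \<noteq> word (y l) t')" by blast
    then obtain s where s: "\<And>i l t'. i < l \<Longrightarrow> l < n \<Longrightarrow> s i l \<le> t' \<Longrightarrow> word (y i) t' \<noteq> word (y l) t'" by metis
    define t where "t = Max ((\<lambda>(i, l). s i l) ` ({..<n} \<times> {..<n}))"
    have st: "s i l \<le> q t" if "i < n" "l < n" for i l
    proof -
      have "s i l \<le> t" unfolding t_def using that by (intro Max_ge) auto
      then show ?thesis using q_mono[of t] by simp
    qed
    have "inj_on (h t) {..<n}"
    proof (rule linorder_inj_onI)
      fix i l assume "i < l" "i \<in> {..<n}" "l \<in> {..<n}"
      then show "h t i \<noteq> h t l" using s[OF _ _ st, of i l] h(2)[of i t] h(2)[of l t] by auto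
    qed auto
    then show ?thesis by (rule that)
  qed
  \<comment> \<open>Stage \<open>0\<close> has one node, which the branches share; this is where
    \<open>2 \<le> n\<close> is needed.\<close>
  have h0: "\<not> inj_on (h 0) {..<n}"
  proof -
    have "h 0 0 = h 0 1" using h(1)[of 0 0] h(1)[of 1 0] y(3) N_0 by simp
    then show ?thesis using y(3) inj_onD[of "h 0" "{..<n}" 0 1] by auto
  qed
  \<comment> \<open>The last stage before the branches are separated for the first time.\<close>
  obtain t where t: "\<not> inj_on (h t) {..<n}" "inj_on (h (Suc t)) {..<n}"
    using ex_least_nat_less[of "\<lambda>t. inj_on (h t) {..<n}", OF t0 h0] by blast
  have W: "inj_on (\<lambda>x. word x (q (Suc t))) (y ` {..<n})"
  proof (rule inj_onI)
    fix x x' assume "x \<in> y ` {..<n}" "x' \<in> y ` {..<n}" and eq: "word x (q (Suc t)) = word x' (q (Suc t))"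
    then obtain i l where il: "i < n" "l < n" "x = y i" "x' = y l" by blast
    then have "h (Suc t) i = h (Suc t) l" using eq h inj_U[of "Suc t"] by (simp add: inj_on_def)
    then have "i = l" using inj_onD[OF t(2)] il(1,2) by blast
    then show "x = x'" using il by simp
  qed
  have "strict_mono_on {..<n} (h (Suc t))"
  proof (rule strict_mono_onI)
    fix i l assume il: "i \<in> {..<n}" "l \<in> {..<n}" "i < l"
    then have n: "i < n" "l < n" by simp_all
    show "h (Suc t) i < h (Suc t) l"
    proof (rule ccontr)
      assume "\<not> ?thesis"
      moreover have "h (Suc t) i \<noteq> h (Suc t) l" using t(2) il by (auto simp: inj_on_def)
      ultimately have "h (Suc t) l < h (Suc t) i" by simp
      then obtain L where L: "splits_at L (word (y l) (q (Suc t))) (word (y i) (q (Suc t)))"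
        "lt (word (y l) (q (Suc t)) ! L) (word (y i) (q (Suc t)) ! L)"
        using U_splits[OF _ h(1)[OF n(1)]] unfolding h(2)[OF n(1)] h(2)[OF n(2)] by blast
      then have "less_fun (y l) (y i)" using word_split(2)[OF th[OF n(2)] th[OF n(1)]] by blast
      then show False using y(2)[OF il(3) n(2)] less_fun_asym by blast
    qed
  qed
  moreover have "h (Suc t) ` {..<n} \<subseteq> {..<N (Suc t)}" using h(1) by auto
  moreover have "\<not> inj_on (old_index (m t) (j t) \<circ> h (Suc t)) {..<n}"
  proof -
    have "inj_on (h t) {..<n} \<longleftrightarrow> inj_on (old_index (m t) (j t) \<circ> h (Suc t)) {..<n}"
      by (rule inj_on_cong) (use h_Suc[of _ t] in simp)
    then show ?thesis using t(1) by blast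
  qed
  moreover have "skew_words (y ` {..<n}) (q (Suc t))" using skew_words_S[OF _ W] y(1) by blast
  ultimately show ?thesis using h(2)[of _ "Suc t"] by (intro that[of "h (Suc t)" t]) simp_all
qed

end


lemma strong_isomorphism_between:
  assumes \<phi>: "strong_isomorphism k F \<phi> A B" and \<psi>: "strong_isomorphism k F \<psi> A C"
  shows "\<exists>\<theta>. strong_isomorphism k F \<theta> B C"
proof -
  let ?i = "inv_into A \<phi>"
  have "isomorphism k \<phi> (induced (F_max F) A) (induced (F_max F) B)"
    and \<psi>i: "isomorphism k \<psi> (induced (F_max F) A) (induced (F_max F) C)"
    using assms by (simp_all add: strong_isomorphism_def)
  then have \<phi>i: "inj_on \<phi> A" "\<phi> ` A = B" "\<And>x y. x \<in> A \<Longrightarrow> y \<in> A \<Longrightarrow>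
      (less_fun x y \<longleftrightarrow> less_fun (\<phi> x) (\<phi> y)) \<and> (\<forall>l<k. rel (F_max F) l x y \<longleftrightarrow> rel (F_max F) l (\<phi> x) (\<phi> y))"
    unfolding isomorphism_def embedding_def by (simp_all add: F_max_def induced_def)
  have \<psi>i: "inj_on \<psi> A" "\<psi> ` A = C" "\<And>x y. x \<in> A \<Longrightarrow> y \<in> A \<Longrightarrow>
      (less_fun x y \<longleftrightarrow> less_fun (\<psi> x) (\<psi> y)) \<and> (\<forall>l<k. rel (F_max F) l x y \<longleftrightarrow> rel (F_max F) l (\<psi> x) (\<psi> y))"
    using \<psi>i unfolding isomorphism_def embedding_def by (simp_all add: F_max_def induced_def)
  have i: "?i b \<in> A" "\<phi> (?i b) = b" if "b \<in> B" for b
    using that \<phi>i(2) by (auto simp: inv_into_into f_inv_into_f)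
  have bij: "bij_betw ?i B A" using \<phi>i(1,2) bij_betw_inv_into unfolding bij_betw_def by blast
  have bij2: "bij_betw (\<psi> \<circ> ?i) B C"
    using bij \<psi>i(1,2) by (intro bij_betw_trans) (auto simp: bij_betw_def)
  have "isomorphism k (\<psi> \<circ> ?i) (induced (F_max F) B) (induced (F_max F) C)"
    unfolding isomorphism_def embedding_def
  proof (intro conjI ballI)
    show "inj_on (\<psi> \<circ> ?i) (universe (induced (F_max F) B))"
      "(\<psi> \<circ> ?i) ` universe (induced (F_max F) B) \<subseteq> universe (induced (F_max F) C)"
      "(\<psi> \<circ> ?i) ` universe (induced (F_max F) B) = universe (induced (F_max F) C)"
      using bij2 unfolding bij_betw_def by (simp_all add: induced_def)
    fix x y assume "x \<in> universe (induced (F_max F) B)" "y \<in> universe (induced (F_max F) B)"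
    then have B: "x \<in> B" "y \<in> B" by (simp_all add: induced_def)
    show "ordr (induced (F_max F) B) x y \<longleftrightarrow> ordr (induced (F_max F) C) ((\<psi> \<circ> ?i) x) ((\<psi> \<circ> ?i) y)"
      "\<forall>l<k. rel (induced (F_max F) B) l x y \<longleftrightarrow> rel (induced (F_max F) C) l ((\<psi> \<circ> ?i) x) ((\<psi> \<circ> ?i) y)"
      using \<phi>i(3)[OF i(1)[OF B(1)] i(1)[OF B(2)]] \<psi>i(3)[OF i(1)[OF B(1)] i(1)[OF B(2)]] i(2) B
      by (simp_all add: F_max_def induced_def)
  qed
  moreover have "meet_length x0 y0 \<le> meet_length x1 y1 \<longleftrightarrow>
      meet_length ((\<psi> \<circ> ?i) x0) ((\<psi> \<circ> ?i) y0) \<le> meet_length ((\<psi> \<circ> ?i) x1) ((\<psi> \<circ> ?i) y1)"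
    if "x0 \<in> B" "y0 \<in> B" "x1 \<in> B" "y1 \<in> B" "x0 \<noteq> y0 \<and> x1 \<noteq> y1" for x0 y0 x1 y1
  proof -
    have A: "?i x0 \<in> A" "?i y0 \<in> A" "?i x1 \<in> A" "?i y1 \<in> A" using i(1) that(1-4) by simp_all
    have ne: "?i x0 \<noteq> ?i y0 \<and> ?i x1 \<noteq> ?i y1" using i(2) that by metis
    have *: "meet_length (?i x0) (?i y0) \<le> meet_length (?i x1) (?i y1) \<longleftrightarrow>
        meet_length (f (?i x0)) (f (?i y0)) \<le> meet_length (f (?i x1)) (f (?i y1))"
      if "strong_isomorphism k F f A D" for f D
      using that A ne unfolding strong_isomorphism_def by blast
    from *[OF \<phi>] *[OF \<psi>] show ?thesis using i(2) that(1-4) by simp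
  qed
  ultimately have "strong_isomorphism k F (\<psi> \<circ> ?i) B C" unfolding strong_isomorphism_def by blast
  then show ?thesis by blast
qed

lemma strong_isomorphism_card: "strong_isomorphism k F \<phi> A B \<Longrightarrow> bij_betw \<phi> A B"
  by (simp add: strong_isomorphism_def isomorphism_def embedding_def induced_def bij_betw_def)

context embedded_tree
begin

text \<open>The construction handles one shape, to be fixed before \<open>S\<close> is known. If
  some member of \<open>\<S>\<close> is threaded and skew, its shape is used. A member inside
  \<open>S\<close> with \<open>2 \<le> n\<close> elements is threaded and skew as well and has the
  same shape by transport; in particular, if no reference exists, no such member lies in
  \<open>S\<close>.\<close>

lemma monochromatic_subtree:
  fixes c :: "(nat \<Rightarrow> nat) set \<Rightarrow> bool"
  assumes c: "\<And>B V q. B \<in> \<S> \<Longrightarrow> (\<And>y. y \<in> B \<Longrightarrow> threaded y) \<Longrightarrow> V \<subseteq> words q \<Longrightarrow> card V = n \<Longrightarrow>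
      (\<And>v. v \<in> V \<Longrightarrow> \<exists>y\<in>B. through y (g v)) \<Longrightarrow> c B = dd V"
    and \<S>: "\<And>B. B \<in> \<S> \<Longrightarrow> finite B \<and> card B = n"
      "\<And>B B'. B \<in> \<S> \<Longrightarrow> B' \<in> \<S> \<Longrightarrow> \<exists>\<phi>. strong_isomorphism k F \<phi> B B'"
  shows "\<exists>S. F_max_tree k K F S \<and> S \<subseteq> T \<and> c constant_on {B \<in> \<S>. B \<subseteq> branches S}"
proof -
  define reference where "reference B Q y s \<longleftrightarrow> B \<in> \<S> \<and> (\<forall>x\<in>B. threaded x) \<and> skew_words B Q \<and>
    bij_betw y {..<n} B \<and> (\<forall>i l. i < l \<longrightarrow> l < n \<longrightarrow> less_fun (y i) (y l)) \<and>
    arity s = n \<and> has_shape s (\<lambda>i. word (y i) Q)" for B Q y s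
  obtain s u0 where s: "has_shape s u0" "(\<exists>B Q y s. reference B Q y s) \<Longrightarrow> \<exists>B Q y. reference B Q y s"
  proof (cases "\<exists>B Q y s. reference B Q y s")
    case True
    then obtain B Q y s where r: "reference B Q y s" by (elim exE)
    then have "has_shape s (\<lambda>i. word (y i) Q)" unfolding reference_def by (elim conjE)
    then show ?thesis using r by (intro that[of s]) blast+
  next
    case False
    \<comment> \<open>Without a reference any shape will do, since no set with two or more members
      will have to be coloured.\<close>
    then show ?thesis by (intro that[of "[]"]) simp_all
  qed
  define d where "d u = dd (u ` {..<arity s})" for u :: "nat \<Rightarrow> nat list"
  have d_cong: "d u = d u'" if "\<And>i. i < arity (rev (rev s)) \<Longrightarrow> u i = u' i" for u u'
  proof -
    have "u ` {..<arity s} = u' ` {..<arity s}" using that by (intro image_cong) simp_all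
    then show ?thesis by (simp add: d_def)
  qed
  have s': "has_shape (rev (rev s)) u0" using s(1) by simp
  obtain N U q m j b where fus: "N 0 = 1" "q 0 = 0" "\<And>t. 0 < N t"
    "\<And>t i. i < N t \<Longrightarrow> length (U t i) = q t" "\<And>t i. i < N t \<Longrightarrow> U t i \<in> T_max"
    "\<And>t. increasing_nodes (N t) (U t) (q t)" "\<And>t. skew_nodes (N t) (U t) (q t)"
    "\<And>t. m t < N t" "\<And>t. 1 \<le> j t" "\<And>t. N (Suc t) = N t + j t - 1" "\<And>t. q t < q (Suc t)"
    "\<And>t i. i < N (Suc t) \<Longrightarrow> prefix (U t (old_index (m t) (j t) i)) (U (Suc t) i)"
    "\<And>t. \<exists>v \<eta>. prefix (U t (m t)) v \<and> v \<in> T_max \<and> partial_embedding (j t) \<eta> \<and>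
      (\<forall>a<j t. \<eta> (sorted_letters (j t) ! a) \<le> length v \<and>
         prefix (v @ [\<eta> (sorted_letters (j t) ! a)]) (U (Suc t) (m t + a)))"
    "\<And>t0 i a. i < N t0 \<Longrightarrow> \<exists>t\<ge>t0. a \<le> j t \<and> prefix (U t0 i) (U t (m t))"
    and col: "\<And>t h. strict_mono_on {..<arity (rev (rev s))} h \<Longrightarrow> h ` {..<arity (rev (rev s))} \<subseteq> {..<N (Suc t)} \<Longrightarrow>
      has_shape (rev (rev s)) (U (Suc t) \<circ> h) \<Longrightarrow> \<not> inj_on (old_index (m t) (j t) \<circ> h) {..<arity (rev (rev s))} \<Longrightarrow>
      d (U (Suc t) \<circ> h) = b"
  proof (rule colour_tree[of "rev s" d u0, OF d_cong s'], goal_cases)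
    case (2 N U q m j b)
    show ?case by (rule 2(1)[of N q U m j b]) (fact 2(2-))+
  qed
  interpret fusion k K M F T g sp e N q m j U
    by unfold_locales (fact fus)+
  have "c B = (if n = 0 then dd {} else if n = 1 then dd {[]} else b)"
    if B: "B \<in> \<S>" "B \<subseteq> branches S" for B
  proof (cases "2 \<le> n")
    case False
    \<comment> \<open>The empty word, the only one of length \<open>0\<close>, already separates a
      set with at most one member.\<close>
    let ?V = "if n = 0 then {} else {[]} :: nat list set"
    have th: "\<And>y. y \<in> B \<Longrightarrow> threaded y" using threaded_S B(2) by blast
    have "c B = dd ?V"
    proof (rule c[OF B(1) th, of _ 0])
      show "?V \<subseteq> words 0" by (simp add: words_def T_max_Nil)
      show "card ?V = n" using False by simp
      fix v assume "v \<in> ?V"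
      then have v: "v = []" "n \<noteq> 0" by (auto split: if_splits)
      then obtain y where y: "y \<in> B" using \<S>(1)[OF B(1)] by fastforce
      then have "word y 0 = []" "through y (g (word y 0))" using word[OF th[OF y], of 0] by simp_all
      then show "\<exists>y\<in>B. through y (g v)" using y v(1) by auto
    qed
    then show ?thesis using False by auto
  next
    case True
    have th: "\<And>y. y \<in> B \<Longrightarrow> threaded y" using threaded_S B(2) by blast
    \<comment> \<open>The stage that separates the members of \<open>B\<close> makes
      \<open>B\<close> itself a reference.\<close>
    have "\<exists>B Q y s. reference B Q y s"
    proof -
      obtain y where y: "bij_betw y {..<card B} B" "\<And>i l. i < l \<Longrightarrow> l < card B \<Longrightarrow> less_fun (y i) (y l)"
        using sorted_enumeration[of B] \<S>(1)[OF B(1)] th by blast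
      have n: "card B = n" using \<S>(1)[OF B(1)] by simp
      have im: "y ` {..<n} = B" using y(1) n by (simp add: bij_betw_def)
      have yS: "y i \<in> branches S" if "i < n" for i using im B(2) that by blast
      have ys: "less_fun (y i) (y l)" if "i < l" "l < n" for i l using y(2)[OF that(1)] that(2) n by simp
      obtain t where sk: "skew_words (y ` {..<n}) (q (Suc t))"
              proof (rule first_separation[of n y], goal_cases)
        case (4 t h)
        show ?case by (rule 4(1)[OF 4(6)])
      qed (use yS ys True in blast)+
      then have sk: "skew_words B (q (Suc t))" using im by simp
      have "\<exists>s. arity s = card B \<and> has_shape s (\<lambda>i. word (y i) (q (Suc t)))"
        by (rule reference_shape[OF _ th sk y]) (use n True in simp_all)
      then show ?thesis unfolding reference_def using B(1) th sk y n by blast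
    qed
    then obtain B0 Q y where "reference B0 Q y s" using s(2) by blast
    then have r: "B0 \<in> \<S>" "\<And>x. x \<in> B0 \<Longrightarrow> threaded x" "skew_words B0 Q" "bij_betw y {..<n} B0"
      "\<And>i l. i < l \<Longrightarrow> l < n \<Longrightarrow> less_fun (y i) (y l)" "arity s = n" "has_shape s (\<lambda>i. word (y i) Q)"
      unfolding reference_def by (elim conjE, blast)+
    obtain \<phi> where \<phi>: "strong_isomorphism k F \<phi> B0 B" using \<S>(2)[OF r(1) B(1)] by blast
    have bij: "bij_betw \<phi> B0 B" by (rule strong_isomorphism_card[OF \<phi>])
    \<comment> \<open>The enumeration of the reference set carried over to \<open>B\<close>. It is
      increasing, so \<open>first_separation\<close> applies to it.\<close>
    define z where "z = \<phi> \<circ> y"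
    have bz: "bij_betw z {..<n} B" using bij_betw_trans[OF r(4) bij] by (simp add: z_def)
    then have im: "z ` {..<n} = B" by (simp add: bij_betw_def)
    have zS: "z i \<in> branches S" if "i < n" for i using im B(2) that by blast
    have zs: "less_fun (z i) (z l)" if "i < l" "l < n" for i l
    proof -
      have "y i \<in> B0" "y l \<in> B0" using r(4) that by (auto simp: bij_betw_def)
      then show ?thesis using \<phi> r(5)[OF that]
        unfolding strong_isomorphism_def isomorphism_def embedding_def z_def
        by (simp add: F_max_def induced_def)
    qed
    obtain t h where h: "strict_mono_on {..<n} h" "h ` {..<n} \<subseteq> {..<N (Suc t)}"
      "\<And>i. i < n \<Longrightarrow> word (z i) (q (Suc t)) = U (Suc t) (h i)" "\<not> inj_on (old_index (m t) (j t) \<circ> h) {..<n}"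
      "skew_words (z ` {..<n}) (q (Suc t))"
      
    proof (rule first_separation[of n z], goal_cases)
      case (4 t h)
      show ?case by (rule 4(1)[of h t]) (fact 4(2-))+
    qed (use zS zs True in blast)+
    have sk: "skew_words B (q (Suc t))" using h(5) im by simp
    have "has_shape s (\<lambda>i. word (z i) (q (Suc t)))"
      unfolding z_def comp_apply by (rule transport_shape[OF r(2,3) th sk \<phi> _ r(7)]) (use r(4,6) in simp_all)
    then have "has_shape s (U (Suc t) \<circ> h)" by (rule has_shape_cong[rotated]) (use h(3) r(6) in simp)
    then have db: "d (U (Suc t) \<circ> h) = b" using h(1,2,4) r(6) by (intro col) simp_all
    have "c B = dd ((U (Suc t) \<circ> h) ` {..<n})"
    proof (rule c[OF B(1) th])
      show "(U (Suc t) \<circ> h) ` {..<n} \<subseteq> words (q (Suc t))" using h(2) U_in_words by auto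
      have "inj_on (U (Suc t) \<circ> h) {..<n}"
        using strict_mono_on_imp_inj_on[OF h(1)] inj_on_subset[OF inj_U h(2)] by (rule comp_inj_on)
      then show "card ((U (Suc t) \<circ> h) ` {..<n}) = n" by (simp only: card_image card_lessThan)
      fix v assume "v \<in> (U (Suc t) \<circ> h) ` {..<n}"
      then obtain i where i: "i < n" "v = U (Suc t) (h i)" by auto
      then have "z i \<in> B" using im by blast
      then show "\<exists>y\<in>B. through y (g v)" using word(2)[OF th, of "z i" "q (Suc t)"] h(3)[OF i(1)] i(2) by auto
    qed simp_all
    then show ?thesis using db r(6) True by (simp add: d_def)
  qed
  then have "c constant_on {B \<in> \<S>. B \<subseteq> branches S}" unfolding constant_on_def by blast
  then show ?thesis using F_max_tree_S S_subset by blast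
qed

end

theorem theorem5p8:
  fixes k :: nat
    and K :: "nat struct set"
    and M :: "nat struct"
    and F :: "nat list \<Rightarrow> nat list struct"
    and T :: "nat list set"
    and A :: "(nat \<Rightarrow> nat) set"
    and \<tau> :: "(nat \<Rightarrow> nat) set set"
    and c :: "(nat \<Rightarrow> nat) set \<Rightarrow> bool"
  assumes "fraisse_class k K"
    and "trivial_diagonal k K"
    and "ramsey_property k K"
    and "fraisse_limit k K M"
    and "node_structures k M F"
    and "F_max_tree k K F T"
    and "finite A" and "A \<subseteq> universe (F_max F)" and "\<tau> = type_of k F A"
    and "baire_measurable_coloring
           (subtopology (n_subsets_topology (card A)) (substructures_of_type F T \<tau>)) c"
  shows "\<exists>S. F_max_tree k K F S \<and> S \<subseteq> T \<and> c constant_on substructures_of_type F S \<tau>"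
proof -
  let ?\<S> = "substructures_of_type F T \<tau>"
  have sub: "substructures_of_type F S' \<tau> = {B. B \<subseteq> branches S' \<and> B \<in> \<tau>}" for S'
    by (simp add: substructures_of_type_def F_of_def induced_def)
  have iso: "\<exists>\<phi>. strong_isomorphism k F \<phi> A B" if "B \<in> \<tau>" for B
    using that assms(9) by (simp add: type_of_def)
  have card: "finite B \<and> card B = card A" if "B \<in> \<tau>" for B
    using iso[OF that] strong_isomorphism_card assms(7) bij_betw_finite bij_betw_same_card by metis
  have TT: "T \<subseteq> T_max" using assms(6) by (simp add: F_max_tree_def)
  interpret ramsey_limit k K M by unfold_locales (fact assms(1-4))+
  interpret ss: subset_space T "card A" ?\<S> by unfold_locales (use TT sub card in auto)
  interpret tc: tree_colouring k K M T "card A" ?\<S> F c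
    by unfold_locales (use assms(6,10) in \<open>simp_all add: ss.X_def\<close>)
  obtain g sp e dd where emb: "\<And>w. w \<in> T_max \<Longrightarrow> g w \<in> T" "\<And>w. w \<in> T_max \<Longrightarrow> sp w \<in> T"
    "\<And>w. w \<in> T_max \<Longrightarrow> prefix (g w) (sp w)"
    "\<And>w. w \<in> T_max \<Longrightarrow> embedding k (e w) (induced M {..length w}) (induced (F (sp w)) (succs T (sp w)))"
    "\<And>w a. w \<in> T_max \<Longrightarrow> a \<le> length w \<Longrightarrow> prefix (e w a) (g (w @ [a]))"
    "\<And>w w'. w \<in> T_max \<Longrightarrow> w' \<in> T_max \<Longrightarrow> length w < length w' \<Longrightarrow> length (sp w) < length (g w')"
    "\<And>q. incomparable (words q) g"
    and col: "\<And>B V q. B \<in> ?\<S> \<Longrightarrow> (\<And>y q. y \<in> B \<Longrightarrow> \<exists>w\<in>words q. through y (g w)) \<Longrightarrow> V \<subseteq> words q \<Longrightarrow>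
      card V = card A \<Longrightarrow> (\<And>v. v \<in> V \<Longrightarrow> \<exists>y\<in>B. through y (g v)) \<Longrightarrow> c B = dd V"
  proof (rule tc.tree_embedding, goal_cases)
    case (1 g sp e dd)
    show ?case by (rule 1(1)[of g sp e dd]) (fact 1(2-))+
  qed
  interpret et: embedded_tree k K M F T g sp e
    by unfold_locales (fact assms(5,6) emb)+
  have "\<exists>S. F_max_tree k K F S \<and> S \<subseteq> T \<and> c constant_on {B \<in> ?\<S>. B \<subseteq> branches S}"
  proof (rule et.monochromatic_subtree)
    fix B V q assume B: "B \<in> ?\<S>" "\<And>y. y \<in> B \<Longrightarrow> et.threaded y" and V: "V \<subseteq> words q" "card V = card A"
      "\<And>v. v \<in> V \<Longrightarrow> \<exists>y\<in>B. through y (g v)"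
    show "c B = dd V" by (rule col[OF B(1) _ V]) (use B(2) in \<open>simp add: et.threaded_def\<close>)
  next
    show "finite B \<and> card B = card A" if "B \<in> ?\<S>" for B using card sub that by simp
    show "\<exists>\<phi>. strong_isomorphism k F \<phi> B B'" if "B \<in> ?\<S>" "B' \<in> ?\<S>" for B B'
    proof -
      have "B \<in> \<tau>" "B' \<in> \<tau>" using that sub by simp_all
      then obtain \<phi> \<psi> where "strong_isomorphism k F \<phi> A B" "strong_isomorphism k F \<psi> A B'"
        using iso by blast
      then show ?thesis by (rule strong_isomorphism_between)
    qed
  qed
  then obtain S where S: "F_max_tree k K F S" "S \<subseteq> T" "c constant_on {B \<in> ?\<S>. B \<subseteq> branches S}" by blast
  have "branches S \<subseteq> branches T" using S(2) by (auto simp: branches_def)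
  then have "substructures_of_type F S \<tau> = {B \<in> ?\<S>. B \<subseteq> branches S}" using sub by auto
  then show ?thesis using S by (intro exI[of _ S]) simp
qed

end
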